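(* Let $\ell>0$, let $r$ be a vocal-tract radius in class $\mathcal{A}$ on $[0,\ell]$, and let $P(k,x)$ be the corresponding pressure. Say that data $X$ "yields" data $Y$ if any two pairs $(\ell,r)$, $(\tilde\ell,\tilde r)$ of this kind having the same $X$ have the same $Y$. Then: (a) The combined knowledge of $\ell$ and the poles (with multiplicities) of $P(k,\ell)$ in the open right-half complex plane yields the quantity $E(k)$, the constants $r_\ell$ and $r_0$, the normalized impedance $z(k)$ for $k\in\mathbf{C}$, the quantity $G(k)$ for $k\in\mathbf{C}$, and the Jost function $F(k)$ for $k\in\mathbf{C}$. (b) The combined knowledge of $\ell$ and the poles of $P(k,\ell)$ in the open right-half complex plane is equivalent to the combined knowledge of $r_\ell$ and the poles of $P(k,\ell)$ in the open right-half complex plane (each yields the other). Hence the latter set also yields the quantities mentioned in (a).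
   Context: Class $\mathcal{A}$: $r:[0,\ell]\to\mathbf{R}$ with $r(x)>0$ on $[0,\ell]$, $r'$ continuous on $[0,\ell]$ (and absolutely continuous), $r''$ integrable on $(0,\ell)$. Notation: prime is $d/dx$, $r_0=r(0)$, $r_\ell=r(\ell)$, $r_0'=r'(0)$, $r_\ell'=r'(\ell)$. The constants $c,\mu>0$ are fixed and known (the same for all $r$). Normalized impedance: $z(k)=1-\dfrac{J_1(2kr_\ell)}{kr_\ell}+i\,\dfrac{\mathbf{H}_1(2kr_\ell)}{kr_\ell}$, $k\in\mathbf{C}$ (value at $k=0$ by removing the singularity), $J_1$ the Bessel function and $\mathbf{H}_1$ the Struve function of order one. Pressure: $P(k,x)$ is the solution of $[r(x)^2P'(k,x)]'+k^2r(x)^2P(k,x)=0$, $x\in(0,\ell)$, with $P'(k,0)=-\dfrac{ikc\mu}{\pi r_0^2}$ and $P'(k,\ell)+\dfrac{ik}{z(k)}P(k,\ell)=0$ (for the $k$ for which this boundary value problem is uniquely solvable); $P(k,\ell)$ is regarded as a meromorphic function of $k\in\mathbf{C}$. With $q(x)=r''(x)/r(x)$, let $\varphi(k,x)$ be the solution of $-\psi''+q\psi=k^2\psi$ on $(0,\ell)$ with $\varphi(k,0)=1$, $\varphi'(k,0)=r_0'/r_0$. Set $$G(k)=\varphi(k,\ell)\Big[\frac{r_\ell'}{r_\ell}z(k)-ik\Big]-\varphi'(k,\ell)\,z(k),\qquad F(k)=-i\,e^{ik\ell}\big(ik\,\varphi(k,\ell)-\varphi'(k,\ell)\big),\qquad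 k\in\mathbf{C}.$$ $\{k_j^+\}_{j=1}^{N^+}$ and $\{k_j^-\}_{j=1}^{N^-}$ are the zeros of $G$ (equivalently the poles of $P(k,\ell)$), listed with multiplicity and in order of nondecreasing modulus, in the open first and open fourth quadrant, respectively ($N^-$ finite, $N^+=+\infty$), and $$E(k)=-ik\prod_{\sigma\in\{-,+\}}\ \prod_{j=1}^{N^\sigma}\Big(1-\frac{k}{k_j^\sigma}\Big)e^{k/k_j^\sigma}\Big(1+\frac{k}{(k_j^\sigma)^*}\Big)e^{-k/(k_j^\sigma)^*},$$ where $*$ is complex conjugation. *)

theory Defs
  imports "HOL-Complex_Analysis.Complex_Analysis"
begin

section \<open>Vocal-tract radii\<close>

definition absolutely_continuous_fun_on ::
    "real \<Rightarrow> real \<Rightarrow> (real \<Rightarrow> 'a::real_normed_vector) \<Rightarrow> bool" where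
  "absolutely_continuous_fun_on a b f \<longleftrightarrow>
     (\<forall>\<epsilon>>0. \<exists>\<delta>>0. \<forall>D.
        finite D \<and> (\<forall>(u, v)\<in>D. a \<le> u \<and> u \<le> v \<and> v \<le> b) \<and>
        disjoint_family_on (\<lambda>(u, v). {u<..<v}) D \<and> (\<Sum>(u, v)\<in>D. v - u) < \<delta>
        \<longrightarrow> (\<Sum>(u, v)\<in>D. norm (f v - f u)) < \<epsilon>)"

text \<open>The derivative on \<open>[0, l]\<close>, one-sided at the endpoints. All objects below depend
  only on the restriction of the radius \<open>r\<close> to \<open>[0, l]\<close>.\<close>

definition dx :: "real \<Rightarrow> (real \<Rightarrow> 'a::real_normed_vector) \<Rightarrow> real \<Rightarrow> 'a" where
  "dx l f x = vector_derivative f (at x within {0..l})"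

definition class_A :: "real \<Rightarrow> (real \<Rightarrow> real) \<Rightarrow> bool" where
  "class_A l r \<longleftrightarrow>
     (\<forall>x\<in>{0..l}. 0 < r x) \<and>
     r differentiable_on {0..l} \<and>
     continuous_on {0..l} (dx l r) \<and>
     absolutely_continuous_fun_on 0 l (dx l r) \<and>
     (AE x in lebesgue. x \<in> {0<..<l} \<longrightarrow> dx l r differentiable (at x)) \<and>
     dx l (dx l r) absolutely_integrable_on {0<..<l}"

definition vocal_tract :: "real \<Rightarrow> (real \<Rightarrow> real) \<Rightarrow> bool" where
  "vocal_tract l r \<longleftrightarrow> 0 < l \<and> class_A l r"


section \<open>The normalized impedance\<close>

definition bessel_J :: "nat \<Rightarrow> complex \<Rightarrow> complex" where
  "bessel_J n w = (\<Sum>m. (-1) ^ m / (fact m * fact (m + n)) * (w / 2) ^ (2 * m + n))"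

definition struve_H :: "nat \<Rightarrow> complex \<Rightarrow> complex" where
  "struve_H n w =
     (\<Sum>m. (-1) ^ m / (Gamma (of_nat m + 3 / 2) * Gamma (of_nat (m + n) + 3 / 2))
           * (w / 2) ^ (2 * m + n + 1))"

definition impedance :: "real \<Rightarrow> complex \<Rightarrow> complex" where
  "impedance rl = remove_sings (\<lambda>k.
     1 - bessel_J 1 (2 * k * of_real rl) / (k * of_real rl)
       + \<i> * (struve_H 1 (2 * k * of_real rl) / (k * of_real rl)))"


section \<open>The pressure at the lips\<close>

definition pressure_solution ::
    "real \<Rightarrow> real \<Rightarrow> real \<Rightarrow> (real \<Rightarrow> real) \<Rightarrow> complex \<Rightarrow> (real \<Rightarrow> complex) \<Rightarrow> bool" where
  "pressure_solution c \<mu> l r k P \<longleftrightarrow>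
     P differentiable_on {0..l} \<and>
     continuous_on {0..l} (dx l P) \<and>
     (\<forall>x\<in>{0<..<l}. \<exists>D.
        ((\<lambda>t. of_real ((r t)\<^sup>2) * dx l P t) has_vector_derivative D) (at x) \<and>
        D + k\<^sup>2 * of_real ((r x)\<^sup>2) * P x = 0) \<and>
     dx l P 0 = - (\<i> * k * of_real c * of_real \<mu>) / of_real (pi * (r 0)\<^sup>2) \<and>
     dx l P l + \<i> * k / impedance (r l) k * P l = 0"

text \<open>The boundary condition at \<open>l\<close> is meaningless when the impedance vanishes, so such \<open>k\<close>
  are excluded here (division by zero would silently replace the condition by another one).\<close>

definition pressure_solvable ::
    "real \<Rightarrow> real \<Rightarrow> real \<Rightarrow> (real \<Rightarrow> real) \<Rightarrow> complex \<Rightarrow> bool" where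
  "pressure_solvable c \<mu> l r k \<longleftrightarrow>
     impedance (r l) k \<noteq> 0 \<and>
     (\<exists>P. pressure_solution c \<mu> l r k P) \<and>
     (\<forall>P Q. pressure_solution c \<mu> l r k P \<and> pressure_solution c \<mu> l r k Q
        \<longrightarrow> (\<forall>x\<in>{0..l}. P x = Q x))"

text \<open>\<open>P(k, l)\<close> as a function of \<open>k\<close>. The value \<open>0\<close> at the isolated \<open>k\<close> where the problem is not
  uniquely solvable is a dummy: \<^const>\<open>is_pole\<close> and \<^const>\<open>zorder\<close>, the only notions applied
  to this function, depend only on the values in a punctured neighbourhood of a point.\<close>

definition pressure_end ::
    "real \<Rightarrow> real \<Rightarrow> real \<Rightarrow> (real \<Rightarrow> real) \<Rightarrow> complex \<Rightarrow> complex" where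
  "pressure_end c \<mu> l r k =
     (if pressure_solvable c \<mu> l r k
      then (THE p. \<exists>P. pressure_solution c \<mu> l r k P \<and> p = P l) else 0)"

definition pole_multiplicity :: "(complex \<Rightarrow> complex) \<Rightarrow> complex \<Rightarrow> nat" where
  "pole_multiplicity f k = (if is_pole f k then nat (- zorder f k) else 0)"

text \<open>The poles of \<open>P(k, l)\<close> in the open right half-plane with their multiplicities, encoded by
  the multiplicity function (zero at points that are not such poles).\<close>

definition right_poles ::
    "real \<Rightarrow> real \<Rightarrow> real \<Rightarrow> (real \<Rightarrow> real) \<Rightarrow> complex \<Rightarrow> nat" where
  "right_poles c \<mu> l r k =
     (if 0 < Re k then pole_multiplicity (pressure_end c \<mu> l r) k else 0)"


section \<open>The regular solution and the functions \<open>G\<close> and \<open>F\<close>\<close>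

definition potential :: "real \<Rightarrow> (real \<Rightarrow> real) \<Rightarrow> real \<Rightarrow> real" where
  "potential l r x = dx l (dx l r) x / r x"

text \<open>As the potential is merely integrable, solutions are understood in the Caratheodory sense.\<close>

definition regular_solution ::
    "real \<Rightarrow> (real \<Rightarrow> real) \<Rightarrow> complex \<Rightarrow> (real \<Rightarrow> complex) \<Rightarrow> bool" where
  "regular_solution l r k \<psi> \<longleftrightarrow>
     \<psi> differentiable_on {0..l} \<and>
     absolutely_continuous_fun_on 0 l (dx l \<psi>) \<and>
     (AE x in lebesgue. x \<in> {0<..<l} \<longrightarrow>
        (\<exists>D. (dx l \<psi> has_vector_derivative D) (at x) \<and>
             - D + of_real (potential l r x) * \<psi> x = k\<^sup>2 * \<psi> x)) \<and>
     \<psi> 0 = 1 \<and>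
     dx l \<psi> 0 = of_real (dx l r 0 / r 0)"

text \<open>The solution is unique on \<open>[0, l]\<close>; it is extended by zero only to make it unique as a
  function on the whole line.\<close>

definition phi :: "real \<Rightarrow> (real \<Rightarrow> real) \<Rightarrow> complex \<Rightarrow> real \<Rightarrow> complex" where
  "phi l r k = (THE \<psi>. regular_solution l r k \<psi> \<and> (\<forall>x. x \<notin> {0..l} \<longrightarrow> \<psi> x = 0))"

definition G_fun :: "real \<Rightarrow> (real \<Rightarrow> real) \<Rightarrow> complex \<Rightarrow> complex" where
  "G_fun l r k =
     phi l r k l * (of_real (dx l r l / r l) * impedance (r l) k - \<i> * k)
     - dx l (phi l r k) l * impedance (r l) k"

definition jost_F :: "real \<Rightarrow> (real \<Rightarrow> real) \<Rightarrow> complex \<Rightarrow> complex" where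
  "jost_F l r k =
     - \<i> * exp (\<i> * k * of_real l) * (\<i> * k * phi l r k l - dx l (phi l r k) l)"


section \<open>The product \<open>E\<close> over the zeros of \<open>G\<close>\<close>

definition zero_multiplicity :: "(complex \<Rightarrow> complex) \<Rightarrow> complex \<Rightarrow> nat" where
  "zero_multiplicity f w = (if f w = 0 then nat (zorder f w) else 0)"

text \<open>\<open>a 0, a 1, \<dots>\<close> (\<open>N\<close> entries, possibly infinitely many) lists the zeros of \<open>f\<close> in \<open>S\<close>,
  repeated according to multiplicity, in order of nondecreasing modulus.\<close>

definition lists_zeros ::
    "(complex \<Rightarrow> complex) \<Rightarrow> complex set \<Rightarrow> enat \<Rightarrow> (nat \<Rightarrow> complex) \<Rightarrow> bool" where
  "lists_zeros f S N a \<longleftrightarrow>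
     (\<forall>j. enat j < N \<longrightarrow> a j \<in> S) \<and>
     (\<forall>w\<in>S. finite {j. enat j < N \<and> a j = w} \<and>
            card {j. enat j < N \<and> a j = w} = zero_multiplicity f w) \<and>
     (\<forall>i j. i \<le> j \<and> enat j < N \<longrightarrow> cmod (a i) \<le> cmod (a j))"

text \<open>The order among zeros of equal modulus is immaterial since the product defining \<open>E\<close>
  converges absolutely.\<close>

definition zero_list ::
    "(complex \<Rightarrow> complex) \<Rightarrow> complex set \<Rightarrow> enat \<times> (nat \<Rightarrow> complex)" where
  "zero_list f S = (SOME (N, a). lists_zeros f S N a)"

definition quadrant1 :: "complex set" where
  "quadrant1 = {k. 0 < Re k \<and> 0 < Im k}"

definition quadrant4 :: "complex set" where
  "quadrant4 = {k. 0 < Re k \<and> Im k < 0}"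

definition E_factor :: "complex \<Rightarrow> complex \<Rightarrow> complex" where
  "E_factor a k =
     (1 - k / a) * exp (k / a) * (1 + k / cnj a) * exp (- k / cnj a)"

definition zero_product :: "enat \<times> (nat \<Rightarrow> complex) \<Rightarrow> complex \<Rightarrow> complex" where
  "zero_product L k =
     (case L of (N, a) \<Rightarrow> (\<Prod>j. if enat j < N then E_factor (a j) k else 1))"

definition E_fun :: "real \<Rightarrow> (real \<Rightarrow> real) \<Rightarrow> complex \<Rightarrow> complex" where
  "E_fun l r k =
     - \<i> * k * zero_product (zero_list (G_fun l r) quadrant4) k
           * zero_product (zero_list (G_fun l r) quadrant1) k"


section \<open>Data determining data\<close>

definition yields ::
    "(real \<Rightarrow> (real \<Rightarrow> real) \<Rightarrow> 'x) \<Rightarrow> (real \<Rightarrow> (real \<Rightarrow> real) \<Rightarrow> 'y) \<Rightarrow> bool" where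
  "yields X Y \<longleftrightarrow>
     (\<forall>l r l' r'. vocal_tract l r \<and> vocal_tract l' r' \<and> X l r = X l' r' \<longrightarrow> Y l r = Y l' r')"

end

theory Submission
  imports Defs "HOL-Real_Asymp.Real_Asymp"
begin

text \<open>
  Writing \<open>\<phi> = r p / r 0\<close>, where \<open>p\<close> solves \<open>(r\<^sup>2 p')' + k\<^sup>2 r\<^sup>2 p = 0\<close> with \<open>p 0 = 1\<close>, \<open>p' 0 = 0\<close>, one finds
  that \<open>P(k, l)\<close> is a constant multiple of \<open>k z(k) / G(k)\<close>. Its poles in the right half-plane are the
  zeros of \<open>G\<close>, because \<open>z\<close> and \<open>G\<close> have no common zero there. The symmetry \<open>G(- k\<^sup>*) = G(k)\<^sup>*\<close> gives the
  zeros in the left half-plane, and on the imaginary axis the only zero is a simple one at \<open>0\<close>. So two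
  tracts with the same right poles have functions \<open>G\<close> with the same zeros; both are of exponential type,
  hence their quotient is \<open>exp (a + b k)\<close>. As \<open>\<eta> \<rightarrow> \<infinity>\<close>, \<open>G(- \<i> \<eta>)\<close> behaves like \<open>- \<eta> exp (\<eta> l)\<close> and
  \<open>ln (G(\<i> \<eta>)) / \<eta>\<close> tends to \<open>l + 2 r\<^sub>l\<close>, the summand \<open>2 r\<^sub>l\<close> coming from the growth of \<open>z\<close> in the upper
  half-plane. The first asymptotics turns the quotient into \<open>exp (\<i> d k)\<close> with \<open>d\<close> the difference of the
  lengths, and the second shows that \<open>l + r\<^sub>l\<close> is determined. Hence \<open>l\<close> and \<open>r\<^sub>l\<close> determine each other,
  and \<open>G\<close>; the even and odd parts of \<open>G\<close> then separate \<open>\<phi>(k, l)\<close> from \<open>p'(k, l)\<close>, and the logarithmic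
  derivative \<open>r\<^sub>l' / r\<^sub>l\<close> needed for \<open>F\<close> is the second term of the expansion of \<open>\<phi>\<close> on the imaginary axis.
\<close>

section \<open>Absolutely continuous functions\<close>

text \<open>The potential r''/r is merely integrable, so the equation for \<phi> holds only almost
  everywhere. The pair p, u = r^2 p' obeys a first-order system with continuous coefficients; all
  analysis is done there, by power series in -k^2 with nonnegative coefficients, and absolute
  continuity serves to identify \<phi> with this solution. On the imaginary axis -k^2 is positive,
  so p is positive and u nonnegative there. The impedance is 1 - S(-2 i k r_l), where S is the
  Laplace transform of a probability density on [0,1]; this fixes the sign of z on both imaginary
  half-axes, makes z tend to 1 downwards and gives it the exponential rate 2 r_l upwards. The form
  exp(a + b k) of the quotient comes from a linear bound on its logarithm, obtained by removing the
  zeros of both functions in a disc with the same Blaschke factors. Comparing growth upwards gives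
  l' + 2 r_l' = l + 2 r_l - d with d = l' - l, that is l + r_l = l' + r_l'. Both E and z are
  functions of G and r_l alone.\<close>

lemma absolutely_continuous_fun_onD:
  assumes "absolutely_continuous_fun_on a b f" "0 < e"
  obtains d where "0 < d"
    "\<And>D. \<lbrakk>finite D; \<And>u v. (u, v) \<in> D \<Longrightarrow> a \<le> u \<and> u \<le> v \<and> v \<le> b;
       disjoint_family_on (\<lambda>(u, v). {u<..<v}) D; (\<Sum>(u, v)\<in>D. v - u) < d\<rbrakk>
      \<Longrightarrow> (\<Sum>(u, v)\<in>D. norm (f v - f u)) < e"
proof -
  from assms obtain d where "0 < d" and d: "\<forall>D.
        finite D \<and> (\<forall>(u, v)\<in>D. a \<le> u \<and> u \<le> v \<and> v \<le> b) \<and>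
        disjoint_family_on (\<lambda>(u, v). {u<..<v}) D \<and> (\<Sum>(u, v)\<in>D. v - u) < d
        \<longrightarrow> (\<Sum>(u, v)\<in>D. norm (f v - f u)) < e"
    unfolding absolutely_continuous_fun_on_def by blast
  show thesis
    by (rule that[OF \<open>0 < d\<close>]) (use d in blast)
qed

text \<open>A gauge replaces a Vitali covering. In a fine tagged division the intervals tagged in
  \<open>N\<close> lie in an open set of small measure, so absolute continuity bounds their
  increments; the other intervals contribute at most \<open>e\<close> times their length.\<close>

lemma absolutely_continuous_zero_derivative:
  fixes f :: "real \<Rightarrow> 'a::real_normed_vector"
  assumes ac: "absolutely_continuous_fun_on a b f" and "a \<le> b" and N: "negligible N"
    and der: "\<And>x. x \<in> {a..b} - N \<Longrightarrow> (f has_vector_derivative 0) (at x within {a..b})"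
  shows "f b = f a"
proof -
  have bound: "norm (f b - f a) \<le> e * (1 + (b - a))" if "e > 0" for e
  proof -
    obtain d where "0 < d" and d: "\<And>D. \<lbrakk>finite D; \<And>u v. (u, v) \<in> D \<Longrightarrow> a \<le> u \<and> u \<le> v \<and> v \<le> b;
       disjoint_family_on (\<lambda>(u, v). {u<..<v}) D; (\<Sum>(u, v)\<in>D. v - u) < d\<rbrakk>
      \<Longrightarrow> (\<Sum>(u, v)\<in>D. norm (f v - f u)) < e"
      using absolutely_continuous_fun_onD[OF ac \<open>e > 0\<close>] by metis
    have Nleb: "N \<in> sets lebesgue"
      using N negligible_imp_sets by blast
    obtain U where U: "open U" "N \<subseteq> U" "U - N \<in> lmeasurable" "emeasure lebesgue (U - N) < ennreal d"
      using sets_lebesgue_outer_open[OF Nleb \<open>0 < d\<close>] by metis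
    have Nl: "N \<in> lmeasurable" using N negligible_imp_measurable by blast
    have Ueq: "U = (U - N) \<union> N" using U by auto
    have Um: "U \<in> lmeasurable"
      by (subst Ueq) (rule fmeasurable.Un[OF U(3) Nl])
    have "measure lebesgue U \<le> measure lebesgue (U - N) + measure lebesgue N"
      by (subst Ueq) (rule measure_Un_le; use U Nleb in auto)
    also have "measure lebesgue N = 0" using N negligible_imp_measure0 by blast
    finally have Ud: "measure lebesgue U < d"
      using U(3,4) \<open>0 < d\<close>
      by (simp add: emeasure_eq_measure2 ennreal_less_iff)
    have "\<exists>r>0. \<forall>y\<in>{a..b}. \<bar>y - x\<bar> < r \<longrightarrow> norm (f y - f x) \<le> e * \<bar>y - x\<bar>"
      if "x \<in> {a..b} - N" for x
      using der[OF that] \<open>e > 0\<close>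
      unfolding has_vector_derivative_def has_derivative_within_alt by auto
    then obtain r where r: "\<And>x. x \<in> {a..b} - N \<Longrightarrow> r x > 0"
       "\<And>x y. \<lbrakk>x \<in> {a..b} - N; y \<in> {a..b}; \<bar>y - x\<bar> < r x\<rbrakk> \<Longrightarrow> norm (f y - f x) \<le> e * \<bar>y - x\<bar>"
      by metis
    \<comment> \<open>Points of \<open>N\<close> all receive the same neighbourhood
      \<open>U\<close>, of measure below \<open>d\<close>; other points of the interval receive the
      radius on which the zero derivative gives slope at most \<open>e\<close>.\<close>
    define g where "g x = (if x \<in> N then U else if x \<in> {a..b} then ball x (r x) else ball x 1)" for x
    have "gauge g"
      unfolding gauge_def g_def using U r(1) by auto
    then obtain p where p: "p tagged_division_of {a..b}" "g fine p"
      using fine_division_exists_real by blast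
    have fin: "finite p" using p(1) by blast
    have K: "\<exists>u v. K = {u..v} \<and> u \<le> v \<and> a \<le> u \<and> v \<le> b \<and> x \<in> K \<and> u \<le> x \<and> x \<le> v" if pK: "(x, K) \<in> p" for x K
    proof -
      obtain u v where uv: "K = cbox u v" using tagged_division_ofD(4)[OF p(1) pK] by blast
      have "x \<in> K" "K \<subseteq> {a..b}" using tagged_division_ofD(2,3)[OF p(1) pK] by auto
      with uv show ?thesis by (intro exI[of _ u] exI[of _ v]) auto
    qed
    have inc: "f b - f a = (\<Sum>(x, K)\<in>p. f (Sup K) - f (Inf K))"
      using additive_tagged_division_1[OF \<open>a \<le> b\<close> p(1), of f] by simp
    have len: "b - a = (\<Sum>(x, K)\<in>p. Sup K - Inf K)"
      using additive_tagged_division_1[OF \<open>a \<le> b\<close> p(1), of "\<lambda>x. x"] by simp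
    \<comment> \<open>Degenerate intervals are dropped: their increments vanish, and without them an
      interval is determined by its endpoints and has nonempty interior.\<close>
    define q where "q = {(x, K)\<in>p. x \<in> N \<and> Inf K < Sup K}"
    have qp: "q \<subseteq> p" by (auto simp: q_def)
    have "finite q" using fin qp finite_subset by blast
    define D where "D = (\<lambda>(x, K). (Inf K, Sup K)) ` q"
    have qK: "\<exists>u v. K = {u..v} \<and> u < v \<and> a \<le> u \<and> v \<le> b \<and> Inf K = u \<and> Sup K = v \<and> K \<subseteq> U"
      if "(x, K) \<in> q" for x K
    proof -
      have pK: "(x, K) \<in> p" and "x \<in> N" "Inf K < Sup K" using that by (auto simp: q_def)
      have "K \<subseteq> U" using p(2) pK \<open>x \<in> N\<close> unfolding fine_def g_def by fastforce
      with K[OF pK] \<open>Inf K < Sup K\<close> show ?thesis by auto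
    qed
    have dis: "interior K1 \<inter> interior K2 = {}" if "(x1, K1) \<in> q" "(x2, K2) \<in> q" "(x1, K1) \<noteq> (x2, K2)" for x1 K1 x2 K2
      using tagged_division_ofD(5)[OF p(1)] that qp by blast
    have ne: "interior K \<noteq> {}" if "(x, K) \<in> q" for x K
    proof -
      from qK[OF that] obtain u v where "K = {u..v}" "u < v" by blast
      then show ?thesis by simp
    qed
    \<comment> \<open>Two members of \<open>q\<close> with equal endpoints would share a nonempty
      interior, so they coincide together with their tags.\<close>
    have inj: "inj_on (\<lambda>(x, K). (Inf K, Sup K)) q"
    proof (rule inj_onI, clarify)
      fix x K x' K' assume *: "(x, K) \<in> q" "(x', K') \<in> q" "Inf K = Inf K'" "Sup K = Sup K'"
      then have "K = K'" using qK[OF *(1)] qK[OF *(2)] by auto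
      then show "x = x' \<and> K = K'" using dis[OF *(1,2)] ne[OF *(1)] by auto
    qed
    have injs: "inj_on snd q"
    proof (rule inj_onI, clarsimp)
      fix x K x' assume *: "(x, K) \<in> q" "(x', K) \<in> q"
      then show "x = x'" using dis[OF *(1,2)] ne[OF *(1)] by auto
    qed
    have Dsum: "(\<Sum>(u, v)\<in>D. h u v) = (\<Sum>(x, K)\<in>q. h (Inf K) (Sup K))" for h :: "real \<Rightarrow> real \<Rightarrow> real"
      unfolding D_def by (subst sum.reindex[OF inj]) (auto intro!: sum.cong)
    have div: "(snd ` q) division_of \<Union>(snd ` q)"
    proof (rule division_ofI)
      fix L assume L: "L \<in> snd ` q"
      then obtain x where "(x, L) \<in> q" by auto
      from qK[OF this] obtain u v where "L = {u..v}" "u < v" by blast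
      then show "L \<noteq> {}" "\<exists>u v. L = cbox u v" by auto
      show "L \<subseteq> \<Union>(snd ` q)" using L by auto
    next
      fix L M assume "L \<in> snd ` q" "M \<in> snd ` q" "L \<noteq> M"
      moreover from this obtain x y where "(x, L) \<in> q" "(y, M) \<in> q" by (metis imageE prod.collapse)
      ultimately show "interior L \<inter> interior M = {}" using dis by blast
    qed (use \<open>finite q\<close> in auto)
    have "(\<Sum>(u, v)\<in>D. v - u) = (\<Sum>(x, K)\<in>q. measure lebesgue K)"
      unfolding Dsum
    proof (intro sum.cong refl, clarify)
      fix x K assume "(x, K) \<in> q"
      from qK[OF this] obtain u v where "K = {u..v}" "u < v" by blast
      then show "Sup K - Inf K = measure lebesgue K" by simp
    qed
    also have "\<dots> = (\<Sum>K\<in>snd ` q. measure lebesgue K)"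
      by (subst sum.reindex[OF injs]) (auto intro!: sum.cong)
    also have "\<dots> = measure lebesgue (\<Union>(snd ` q))"
      by (rule content_division[OF div])
    also have "\<dots> \<le> measure lebesgue U"
    proof (rule measure_mono_fmeasurable)
      show "\<Union>(snd ` q) \<subseteq> U" using qK by (metis Union_least imageE prod.collapse)
      show "\<Union>(snd ` q) \<in> sets lebesgue" using lmeasurable_division[OF div] by auto
    qed (use Um in auto)
    finally have "(\<Sum>(u, v)\<in>D. v - u) < d" using Ud by linarith
    moreover have "disjoint_family_on (\<lambda>(u, v). {u<..<v}) D"
      unfolding disjoint_family_on_def
    proof (intro ballI impI)
      fix m n assume "m \<in> D" "n \<in> D" "m \<noteq> n"
      then obtain x K y L where *: "(x, K) \<in> q" "(y, L) \<in> q" "m = (Inf K, Sup K)" "n = (Inf L, Sup L)"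
        unfolding D_def by auto
      with \<open>m \<noteq> n\<close> have "(x, K) \<noteq> (y, L)" by auto
      moreover obtain u v where "K = {u..v}" "Inf K = u" "Sup K = v" using qK[OF *(1)] by blast
      moreover obtain s t where "L = {s..t}" "Inf L = s" "Sup L = t" using qK[OF *(2)] by blast
      ultimately show "(case m of (u, v) \<Rightarrow> {u<..<v}) \<inter> (case n of (u, v) \<Rightarrow> {u<..<v}) = {}"
        using dis[OF *(1,2)] *(3,4) by auto
    qed
    ultimately have D: "(\<Sum>(u, v)\<in>D. norm (f v - f u)) < e"
    proof (intro d)
      fix u v assume "(u, v) \<in> D"
      then obtain x K where "(x, K) \<in> q" "u = Inf K" "v = Sup K" unfolding D_def by auto
      with qK[OF this(1)] show "a \<le> u \<and> u \<le> v \<and> v \<le> b" by (metis less_imp_le)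
    qed (use \<open>finite q\<close> in \<open>auto simp: D_def\<close>)
    have split: "(\<Sum>(x, K)\<in>p. f (Sup K) - f (Inf K))
        = (\<Sum>(x, K)\<in>q. f (Sup K) - f (Inf K)) + (\<Sum>(x, K)\<in>p - q. f (Sup K) - f (Inf K))"
      using sum.subset_diff[OF qp fin] by (simp add: add.commute)
    have "norm (\<Sum>(x, K)\<in>q. f (Sup K) - f (Inf K)) \<le> (\<Sum>(x, K)\<in>q. norm (f (Sup K) - f (Inf K)))"
      by (rule order_trans[OF norm_sum]) (auto intro!: sum_mono)
    also have "\<dots> < e" using D unfolding Dsum .
    finally have 1: "norm (\<Sum>(x, K)\<in>q. f (Sup K) - f (Inf K)) < e" .
    have each: "norm (f (Sup K) - f (Inf K)) \<le> e * (Sup K - Inf K)" if xK: "(x, K) \<in> p - q" for x K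
    proof -
      from xK have "(x, K) \<in> p" by blast
      from K[OF this] obtain u v where uv: "K = {u..v}" "u \<le> v" "a \<le> u" "v \<le> b" "u \<le> x" "x \<le> v"
        by blast
      show ?thesis
      proof (cases "x \<in> N")
        case True
        then have "\<not> Inf K < Sup K" using xK by (auto simp: q_def)
        with uv have "u = v" by simp
        with uv show ?thesis by simp
      next
        case False
        have xin: "x \<in> {a..b} - N" using False uv by auto
        have "K \<subseteq> ball x (r x)" using p(2) xK xin unfolding fine_def g_def by fastforce
        moreover have "u \<in> K" "v \<in> K" using uv by auto
        ultimately have "u \<in> ball x (r x)" "v \<in> ball x (r x)" by blast+
        then have "\<bar>u - x\<bar> < r x" "\<bar>v - x\<bar> < r x" by (auto simp: dist_real_def)
        then have "norm (f u - f x) \<le> e * \<bar>u - x\<bar>" "norm (f v - f x) \<le> e * \<bar>v - x\<bar>"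
          by (intro r(2)[OF xin]; use uv in simp)+
        moreover have "norm (f v - f u) \<le> norm (f v - f x) + norm (f u - f x)"
          using norm_triangle_ineq4[of "f v - f x" "f u - f x"] by simp
        moreover have "e * \<bar>u - x\<bar> + e * \<bar>v - x\<bar> = e * (v - u)"
          using uv by (simp add: algebra_simps)
        moreover have "Inf K = u" "Sup K = v" using uv by auto
        ultimately show ?thesis by simp
      qed
    qed
    have "norm (\<Sum>(x, K)\<in>p - q. f (Sup K) - f (Inf K)) \<le> (\<Sum>(x, K)\<in>p - q. e * (Sup K - Inf K))"
      by (rule order_trans[OF norm_sum]) (use each in \<open>auto intro!: sum_mono\<close>)
    also have "\<dots> \<le> (\<Sum>(x, K)\<in>p. e * (Sup K - Inf K))"
    proof (rule sum_mono2[OF fin])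
      fix xK assume "xK \<in> p - (p - q)"
      then obtain x K where xK: "xK = (x, K)" "(x, K) \<in> p" by (cases xK) auto
      from K[OF xK(2)] obtain u v where "K = {u..v}" "u \<le> v" by blast
      then show "0 \<le> (case xK of (x, K) \<Rightarrow> e * (Sup K - Inf K))" using \<open>e > 0\<close> xK by simp
    qed blast
    also have "\<dots> = e * (b - a)"
      unfolding len sum_distrib_left by (auto intro!: sum.cong)
    finally have 2: "norm (\<Sum>(x, K)\<in>p - q. f (Sup K) - f (Inf K)) \<le> e * (b - a)" .
    have "norm (f b - f a) \<le> e + e * (b - a)"
      unfolding inc split by (rule order_trans[OF norm_triangle_ineq]) (use 1 2 in linarith)
    then show ?thesis by (simp add: algebra_simps)
  qed
  have "norm (f b - f a) \<le> 0"
  proof (rule field_le_epsilon)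
    fix e :: real assume "e > 0"
    have "norm (f b - f a) \<le> e / (1 + (b - a)) * (1 + (b - a))"
      using bound[of "e / (1 + (b - a))"] \<open>e > 0\<close> \<open>a \<le> b\<close> by auto
    then show "norm (f b - f a) \<le> 0 + e" using \<open>a \<le> b\<close> by simp
  qed
  then show ?thesis by simp
qed

section \<open>Closure properties of absolute continuity\<close>

lemma absolutely_continuous_fun_on_subset:
  assumes "absolutely_continuous_fun_on a b f" "a \<le> c" "d \<le> b"
  shows "absolutely_continuous_fun_on c d f"
  unfolding absolutely_continuous_fun_on_def
proof (intro allI impI)
  fix e :: real assume "e > 0"
  from absolutely_continuous_fun_onD[OF assms(1) this] obtain \<delta> where "0 < \<delta>" and
    \<delta>: "\<And>D. \<lbrakk>finite D; \<And>u v. (u, v) \<in> D \<Longrightarrow> a \<le> u \<and> u \<le> v \<and> v \<le> b;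
       disjoint_family_on (\<lambda>(u, v). {u<..<v}) D; (\<Sum>(u, v)\<in>D. v - u) < \<delta>\<rbrakk>
      \<Longrightarrow> (\<Sum>(u, v)\<in>D. norm (f v - f u)) < e"
    by metis
  show "\<exists>\<delta>>0. \<forall>D. finite D \<and> (\<forall>(u, v)\<in>D. c \<le> u \<and> u \<le> v \<and> v \<le> d) \<and>
        disjoint_family_on (\<lambda>(u, v). {u<..<v}) D \<and> (\<Sum>(u, v)\<in>D. v - u) < \<delta>
        \<longrightarrow> (\<Sum>(u, v)\<in>D. norm (f v - f u)) < e"
  proof (intro exI[of _ \<delta>] conjI \<open>0 < \<delta>\<close> allI impI, elim conjE)
    fix D :: "(real \<times> real) set"
    assume D: "finite D" "\<forall>(u, v)\<in>D. c \<le> u \<and> u \<le> v \<and> v \<le> d"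
      "disjoint_family_on (\<lambda>(u, v). {u<..<v}) D" "(\<Sum>(u, v)\<in>D. v - u) < \<delta>"
    show "(\<Sum>(u, v)\<in>D. norm (f v - f u)) < e"
      by (rule \<delta>) (use D assms in auto)
  qed
qed

text \<open>Membership is checked with an increment estimate by increments of absolutely continuous
  functions; this covers sums, products and Lipschitz functions at once.\<close>

lemma absolutely_continuous_fun_on_dominated:
  fixes f :: "real \<Rightarrow> 'a::real_normed_vector" and g :: "real \<Rightarrow> 'b::real_normed_vector"
    and h :: "real \<Rightarrow> 'c::real_normed_vector"
  assumes f: "absolutely_continuous_fun_on a b f" and g: "absolutely_continuous_fun_on a b g"
    and C: "\<And>u v. \<lbrakk>a \<le> u; u \<le> v; v \<le> b\<rbrakk>
      \<Longrightarrow> norm (h v - h u) \<le> C * (norm (f v - f u) + norm (g v - g u) + (v - u))"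
  shows "absolutely_continuous_fun_on a b h"
  unfolding absolutely_continuous_fun_on_def
proof (intro allI impI)
  fix e :: real assume "e > 0"
  define K where "K = max C 1"
  have K: "K \<ge> 1" "C \<le> K" by (auto simp: K_def)
  have e3: "e / (3 * K) > 0" using \<open>e > 0\<close> K by auto
  from absolutely_continuous_fun_onD[OF f e3] obtain d1 where "0 < d1" and
    d1: "\<And>D. \<lbrakk>finite D; \<And>u v. (u, v) \<in> D \<Longrightarrow> a \<le> u \<and> u \<le> v \<and> v \<le> b;
       disjoint_family_on (\<lambda>(u, v). {u<..<v}) D; (\<Sum>(u, v)\<in>D. v - u) < d1\<rbrakk>
      \<Longrightarrow> (\<Sum>(u, v)\<in>D. norm (f v - f u)) < e / (3 * K)"
    by metis
  from absolutely_continuous_fun_onD[OF g e3] obtain d2 where "0 < d2" and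
    d2: "\<And>D. \<lbrakk>finite D; \<And>u v. (u, v) \<in> D \<Longrightarrow> a \<le> u \<and> u \<le> v \<and> v \<le> b;
       disjoint_family_on (\<lambda>(u, v). {u<..<v}) D; (\<Sum>(u, v)\<in>D. v - u) < d2\<rbrakk>
      \<Longrightarrow> (\<Sum>(u, v)\<in>D. norm (g v - g u)) < e / (3 * K)"
    by metis
  show "\<exists>\<delta>>0. \<forall>D. finite D \<and> (\<forall>(u, v)\<in>D. a \<le> u \<and> u \<le> v \<and> v \<le> b) \<and>
        disjoint_family_on (\<lambda>(u, v). {u<..<v}) D \<and> (\<Sum>(u, v)\<in>D. v - u) < \<delta>
        \<longrightarrow> (\<Sum>(u, v)\<in>D. norm (h v - h u)) < e"
  proof (intro exI[of _ "min (min d1 d2) (e / (3 * K))"] conjI allI impI)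
    fix D :: "(real \<times> real) set"
    assume D: "finite D \<and> (\<forall>(u, v)\<in>D. a \<le> u \<and> u \<le> v \<and> v \<le> b) \<and>
        disjoint_family_on (\<lambda>(u, v). {u<..<v}) D \<and> (\<Sum>(u, v)\<in>D. v - u) < min (min d1 d2) (e / (3 * K))"
    have 1: "(\<Sum>(u, v)\<in>D. norm (f v - f u)) < e / (3 * K)" by (rule d1) (use D in auto)
    have 2: "(\<Sum>(u, v)\<in>D. norm (g v - g u)) < e / (3 * K)" by (rule d2) (use D in auto)
    have 3: "(\<Sum>(u, v)\<in>D. v - u) < e / (3 * K)" using D by auto
    have "(\<Sum>(u, v)\<in>D. norm (h v - h u))
      \<le> (\<Sum>(u, v)\<in>D. K * (norm (f v - f u) + norm (g v - g u) + (v - u)))"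
    proof (rule sum_mono, clarify)
      fix u v assume "(u, v) \<in> D"
      then have uv: "a \<le> u" "u \<le> v" "v \<le> b" using D by auto
      show "norm (h v - h u) \<le> K * (norm (f v - f u) + norm (g v - g u) + (v - u))"
        by (rule order_trans[OF C[OF uv] mult_right_mono[OF K(2)]]) (use uv in auto)
    qed
    also have "\<dots> = K * ((\<Sum>(u, v)\<in>D. norm (f v - f u)) + (\<Sum>(u, v)\<in>D. norm (g v - g u))
        + (\<Sum>(u, v)\<in>D. v - u))"
      by (simp add: sum_distrib_left split_def sum.distrib distrib_left)
    also have "\<dots> < K * (e / (3 * K) + e / (3 * K) + e / (3 * K))"
      using 1 2 3 K by (intro mult_strict_left_mono) auto
    also have "\<dots> = e" using K by (simp add: field_simps)
    finally show "(\<Sum>(u, v)\<in>D. norm (h v - h u)) < e" .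
  qed (use \<open>0 < d1\<close> \<open>0 < d2\<close> e3 in auto)
qed

lemma absolutely_continuous_fun_on_const: "absolutely_continuous_fun_on a b (\<lambda>x. c)"
  unfolding absolutely_continuous_fun_on_def by (intro allI impI exI[of _ 1]) (simp add: split_def)

lemma absolutely_continuous_fun_on_imp_continuous_on:
  fixes f :: "real \<Rightarrow> 'a::real_normed_vector"
  assumes "absolutely_continuous_fun_on a b f"
  shows "continuous_on {a..b} f"
proof (rule continuous_onI)
  fix x and e :: real assume x: "x \<in> {a..b}" and "e > 0"
  from absolutely_continuous_fun_onD[OF assms \<open>e > 0\<close>] obtain d where "0 < d" and
    d: "\<And>D. \<lbrakk>finite D; \<And>u v. (u, v) \<in> D \<Longrightarrow> a \<le> u \<and> u \<le> v \<and> v \<le> b;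
       disjoint_family_on (\<lambda>(u, v). {u<..<v}) D; (\<Sum>(u, v)\<in>D. v - u) < d\<rbrakk>
      \<Longrightarrow> (\<Sum>(u, v)\<in>D. norm (f v - f u)) < e"
    by metis
  have "dist (f x') (f x) \<le> e" if x': "x' \<in> {a..b}" "dist x' x < d" for x'
  proof -
    have "(\<Sum>(u, v)\<in>{(min x x', max x x')}. norm (f v - f u)) < e"
      by (rule d) (use x x' in \<open>auto simp: disjoint_family_on_def dist_real_def min_def max_def\<close>)
    then show ?thesis
      by (cases "x \<le> x'") (auto simp: dist_norm min_def max_def norm_minus_commute)
  qed
  with \<open>0 < d\<close> show "\<exists>d>0. \<forall>x'\<in>{a..b}. dist x' x < d \<longrightarrow> dist (f x') (f x) \<le> e" by blast
qed

lemma C1_imp_Lipschitz: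
  fixes f :: "real \<Rightarrow> 'a::real_normed_vector"
  assumes der: "\<And>x. x \<in> {a..b} \<Longrightarrow> (f has_vector_derivative f' x) (at x within {a..b})"
    and cont: "continuous_on {a..b} f'"
  obtains L where "\<And>u v. \<lbrakk>a \<le> u; u \<le> v; v \<le> b\<rbrakk> \<Longrightarrow> norm (f v - f u) \<le> L * (v - u)"
proof -
  have "compact (f' ` {a..b})" by (rule compact_continuous_image[OF cont]) auto
  then obtain L where L: "\<And>x. x \<in> {a..b} \<Longrightarrow> norm (f' x) \<le> L"
    using compact_imp_bounded bounded_iff by (metis image_eqI)
  show thesis
  proof (rule that)
    fix u v :: real assume uv: "a \<le> u" "u \<le> v" "v \<le> b"
    have onorm: "onorm (\<lambda>h. h *\<^sub>R f' x) \<le> L" if "x \<in> {a..b}" for x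
    proof (rule onorm_le)
      fix h :: real show "norm (h *\<^sub>R f' x) \<le> L * norm h"
        using mult_right_mono[OF L[OF that], of "\<bar>h\<bar>"] by (simp add: mult.commute)
    qed
    have "norm (f v - f u) \<le> L * norm (v - u)"
      by (rule differentiable_bound[of "{a..b}" f "\<lambda>x h. h *\<^sub>R f' x"])
        (use uv der onorm in \<open>auto simp: has_vector_derivative_def\<close>)
    with uv show "norm (f v - f u) \<le> L * (v - u)" by simp
  qed
qed

lemma continuous_on_bounded_normE:
  fixes f :: "'a::topological_space \<Rightarrow> 'b::real_normed_vector"
  assumes "compact S" "continuous_on S f"
  obtains B where "0 < B" "\<And>x. x \<in> S \<Longrightarrow> norm (f x) \<le> B"
  using compact_imp_bounded[OF compact_continuous_image[OF assms(2,1)]] bounded_pos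
  by (metis imageI)

lemma absolutely_continuous_fun_on_mult:
  fixes f g :: "real \<Rightarrow> 'a::real_normed_algebra"
  assumes f: "absolutely_continuous_fun_on a b f" and g: "absolutely_continuous_fun_on a b g"
  shows "absolutely_continuous_fun_on a b (\<lambda>x. f x * g x)"
proof -
  obtain A where A: "0 < A" "\<And>x. x \<in> {a..b} \<Longrightarrow> norm (f x) \<le> A"
    using continuous_on_bounded_normE[OF _ absolutely_continuous_fun_on_imp_continuous_on[OF f]] by auto
  obtain B where B: "0 < B" "\<And>x. x \<in> {a..b} \<Longrightarrow> norm (g x) \<le> B"
    using continuous_on_bounded_normE[OF _ absolutely_continuous_fun_on_imp_continuous_on[OF g]] by auto
  show ?thesis
  proof (rule absolutely_continuous_fun_on_dominated[OF f g])
    fix u v :: real assume uv: "a \<le> u" "u \<le> v" "v \<le> b"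
    have nonneg: "0 \<le> A * (v - u)" "0 \<le> B * (v - u)" "0 \<le> A * norm (f v - f u)" "0 \<le> B * norm (g v - g u)"
      using A(1) B(1) uv by auto
    have "norm (f v * g v - f u * g u) = norm ((f v - f u) * g v + f u * (g v - g u))"
      by (simp add: algebra_simps)
    also have "\<dots> \<le> norm (f v - f u) * B + A * norm (g v - g u)"
      using A B uv by (intro norm_triangle_le add_mono order_trans[OF norm_mult_ineq] mult_mono) auto
    also have "\<dots> \<le> (A + B) * (norm (f v - f u) + norm (g v - g u) + (v - u))"
      using nonneg by (simp only: algebra_simps)
    finally show "norm (f v * g v - f u * g u) \<le> (A + B) * (norm (f v - f u) + norm (g v - g u) + (v - u))" .
  qed
qed

lemma absolutely_continuous_fun_on_add:
  fixes f g :: "real \<Rightarrow> 'a::real_normed_vector"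
  assumes f: "absolutely_continuous_fun_on a b f" and g: "absolutely_continuous_fun_on a b g"
  shows "absolutely_continuous_fun_on a b (\<lambda>x. f x + g x)"
proof (rule absolutely_continuous_fun_on_dominated[OF f g, where C = 1])
  fix u v :: real assume "u \<le> v"
  with norm_triangle_ineq[of "f v - f u" "g v - g u"]
  show "norm (f v + g v - (f u + g u)) \<le> 1 * (norm (f v - f u) + norm (g v - g u) + (v - u))"
    by (simp add: algebra_simps)
qed

lemma absolutely_continuous_fun_on_diff:
  fixes f g :: "real \<Rightarrow> 'a::real_normed_vector"
  assumes f: "absolutely_continuous_fun_on a b f" and g: "absolutely_continuous_fun_on a b g"
  shows "absolutely_continuous_fun_on a b (\<lambda>x. f x - g x)"
proof (rule absolutely_continuous_fun_on_dominated[OF f g, where C = 1])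
  fix u v :: real assume "u \<le> v"
  with norm_triangle_ineq4[of "f v - f u" "g v - g u"]
  show "norm (f v - g v - (f u - g u)) \<le> 1 * (norm (f v - f u) + norm (g v - g u) + (v - u))"
    by (simp add: algebra_simps)
qed

lemma absolutely_continuous_fun_on_C1:
  fixes f :: "real \<Rightarrow> 'a::real_normed_vector"
  assumes "\<And>x. x \<in> {a..b} \<Longrightarrow> (f has_vector_derivative f' x) (at x within {a..b})"
    and "continuous_on {a..b} f'"
  shows "absolutely_continuous_fun_on a b f"
proof -
  obtain L where "\<And>u v. \<lbrakk>a \<le> u; u \<le> v; v \<le> b\<rbrakk> \<Longrightarrow> norm (f v - f u) \<le> L * (v - u)"
    using C1_imp_Lipschitz[OF assms] by metis
  then show ?thesis
    by (intro absolutely_continuous_fun_on_dominated[OF absolutely_continuous_fun_on_const[of a b 0]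
          absolutely_continuous_fun_on_const[of a b 0], where C = L]) simp
qed

lemma absolutely_continuous_fun_on_of_real:
  assumes "absolutely_continuous_fun_on a b f"
  shows "absolutely_continuous_fun_on a b (\<lambda>x. of_real (f x) :: 'a::real_normed_algebra_1)"
proof (rule absolutely_continuous_fun_on_dominated[OF assms assms, where C = 1])
  fix u v :: real assume "u \<le> v"
  then show "norm (of_real (f v) - of_real (f u) :: 'a)
      \<le> 1 * (norm (f v - f u) + norm (f v - f u) + (v - u))"
    by (simp flip: of_real_diff)
qed

section \<open>The pressure equation as a power series in the spectral parameter\<close>

text \<open>The majorant \<open>M\<close> makes the series of derivatives converge uniformly
  (Weierstrass test), which permits termwise differentiation up to the endpoints.\<close>

lemma has_vector_derivative_suminf:
  fixes f :: "nat \<Rightarrow> real \<Rightarrow> 'a::banach"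
  assumes der: "\<And>n x. x \<in> {a..b} \<Longrightarrow> (f n has_vector_derivative f' n x) (at x within {a..b})"
    and bound: "\<And>n x. x \<in> {a..b} \<Longrightarrow> norm (f' n x) \<le> M n" and M: "summable M"
    and sf: "\<And>x. x \<in> {a..b} \<Longrightarrow> summable (\<lambda>n. f n x)" and x: "x \<in> {a..b}"
  shows "((\<lambda>x. \<Sum>n. f n x) has_vector_derivative (\<Sum>n. f' n x)) (at x within {a..b})"
proof -
  define g' where "g' x = (\<Sum>n. f' n x)" for x
  have ul: "uniform_limit {a..b} (\<lambda>n x. \<Sum>i<n. f' i x) g' sequentially"
    unfolding g'_def by (rule Weierstrass_m_test[OF _ M]) (use bound in auto)
  have "\<exists>g. \<forall>x\<in>{a..b}. (\<lambda>n. f n x) sums (g x) \<and> (g has_derivative (\<lambda>h. h *\<^sub>R g' x)) (at x within {a..b})"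
  proof (rule has_derivative_series[where f' = "\<lambda>n x h. h *\<^sub>R f' n x"])
    fix e :: real assume "e > 0"
    from uniform_limitD[OF ul this]
    have ev: "\<forall>\<^sub>F n in sequentially. \<forall>x\<in>{a..b}. dist (\<Sum>i<n. f' i x) (g' x) < e" .
    show "\<forall>\<^sub>F n in sequentially. \<forall>x\<in>{a..b}. \<forall>h. norm ((\<Sum>i<n. h *\<^sub>R f' i x) - h *\<^sub>R g' x) \<le> e * norm h"
      using ev
    proof (rule eventually_mono, intro ballI allI)
      fix n x and h :: real assume *: "\<forall>x\<in>{a..b}. dist (\<Sum>i<n. f' i x) (g' x) < e" "x \<in> {a..b}"
      have "(\<Sum>i<n. h *\<^sub>R f' i x) - h *\<^sub>R g' x = h *\<^sub>R ((\<Sum>i<n. f' i x) - g' x)"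
        by (simp add: scaleR_sum_right scaleR_diff_right)
      moreover have "norm ((\<Sum>i<n. f' i x) - g' x) \<le> e" using * by (auto simp: dist_norm less_imp_le)
      ultimately show "norm ((\<Sum>i<n. h *\<^sub>R f' i x) - h *\<^sub>R g' x) \<le> e * norm h"
        by (metis norm_scaleR real_norm_def mult.commute mult_right_mono abs_ge_zero)
    qed
  qed (use der sf[OF x] x in \<open>auto simp: has_vector_derivative_def summable_sums\<close>)
  then obtain g where g: "\<And>x. x \<in> {a..b} \<Longrightarrow> (\<lambda>n. f n x) sums (g x)"
    "\<And>x. x \<in> {a..b} \<Longrightarrow> (g has_vector_derivative g' x) (at x within {a..b})"
    unfolding has_vector_derivative_def by blast
  have "(g has_vector_derivative g' x) (at x within {a..b})" using g(2) x .
  then show ?thesis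
    unfolding g'_def
    by (rule has_vector_derivative_transform[OF x, rotated]) (use g(1) in \<open>auto simp: sums_iff\<close>)
qed

text \<open>The pressure equation involves only r^2, so a continuous positive weight carries the
  whole theory of its solutions; the derivative of \<open>r\<close> enters only on passing to
  \<phi>.\<close>

locale weight =
  fixes l :: real and r :: "real \<Rightarrow> real"
  assumes l_pos: "0 < l" and r_cont: "continuous_on {0..l} r" and r_pos: "\<And>x. x \<in> {0..l} \<Longrightarrow> 0 < r x"
begin

text \<open>The system \<open>p' = u / r\<^sup>2\<close>, \<open>u' = \<Lambda> r\<^sup>2 p\<close> with \<open>p 0 = \<alpha>\<close>, \<open>u 0 = \<beta>\<close> is solved by
  power series in \<open>\<Lambda>\<close> with the following coefficients.\<close>

primrec p_coeff :: "real \<Rightarrow> real \<Rightarrow> nat \<Rightarrow> real \<Rightarrow> real" where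
  "p_coeff \<alpha> \<beta> 0 = (\<lambda>x. \<alpha> + integral {0..x} (\<lambda>s. \<beta> / (r s)\<^sup>2))"
| "p_coeff \<alpha> \<beta> (Suc n) =
     (\<lambda>x. integral {0..x} (\<lambda>s. integral {0..s} (\<lambda>t. (r t)\<^sup>2 * p_coeff \<alpha> \<beta> n t) / (r s)\<^sup>2))"

definition u_coeff :: "real \<Rightarrow> real \<Rightarrow> nat \<Rightarrow> real \<Rightarrow> real" where
  "u_coeff \<alpha> \<beta> n = (case n of 0 \<Rightarrow> \<lambda>x. \<beta> | Suc m \<Rightarrow> \<lambda>x. integral {0..x} (\<lambda>t. (r t)\<^sup>2 * p_coeff \<alpha> \<beta> m t))"

text \<open>The spectral parameter has a polymorphic type because the series is used twice: at
  complex \<Lambda> = -k^2 for analyticity, and at real \<Lambda> = \<eta>^2, which is k = i \<eta>,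
  for positivity and asymptotics.\<close>

definition p_ser :: "real \<Rightarrow> real \<Rightarrow> 'a \<Rightarrow> real \<Rightarrow> 'a::{real_normed_field, banach}" where
  "p_ser \<alpha> \<beta> \<Lambda> x = (\<Sum>n. of_real (p_coeff \<alpha> \<beta> n x) * \<Lambda> ^ n)"

definition u_ser :: "real \<Rightarrow> real \<Rightarrow> 'a \<Rightarrow> real \<Rightarrow> 'a::{real_normed_field, banach}" where
  "u_ser \<alpha> \<beta> \<Lambda> x = (\<Sum>n. of_real (u_coeff \<alpha> \<beta> n x) * \<Lambda> ^ n)"

lemma r_nonzero: "x \<in> {0..l} \<Longrightarrow> r x \<noteq> 0"
  using r_pos[of x] by simp

lemma continuous_p_coeff: "continuous_on {0..l} (p_coeff \<alpha> \<beta> n)"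
proof (induction n)
  case 0
  show ?case unfolding p_coeff.simps
    by (intro continuous_intros indefinite_integral_continuous_1 integrable_continuous_real)
      (use r_cont r_nonzero in auto)
next
  case (Suc n)
  show ?case unfolding p_coeff.simps
    by (intro continuous_intros indefinite_integral_continuous_1 integrable_continuous_real)
      (use r_cont r_nonzero Suc in auto)
qed

lemma continuous_u_coeff: "continuous_on {0..l} (u_coeff \<alpha> \<beta> n)"
  unfolding u_coeff_def
  by (cases n) (auto intro!: continuous_intros indefinite_integral_continuous_1 integrable_continuous_real
      r_cont continuous_p_coeff)

lemma p_coeff_deriv:
  assumes "x \<in> {0..l}"
  shows "(p_coeff \<alpha> \<beta> n has_vector_derivative u_coeff \<alpha> \<beta> n x / (r x)\<^sup>2) (at x within {0..l})"
proof (cases n)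
  case 0
  have "((\<lambda>u. integral {0..u} (\<lambda>s. \<beta> / (r s)\<^sup>2)) has_vector_derivative \<beta> / (r x)\<^sup>2) (at x within {0..l})"
    by (rule integral_has_vector_derivative[OF _ assms])
      (use r_nonzero in \<open>auto intro!: continuous_intros r_cont\<close>)
  then show ?thesis
    using 0 by (auto simp: u_coeff_def intro: has_vector_derivative_add[OF has_vector_derivative_const, simplified])
next
  case (Suc m)
  have "((\<lambda>u. integral {0..u} (\<lambda>s. u_coeff \<alpha> \<beta> n s / (r s)\<^sup>2)) has_vector_derivative
      u_coeff \<alpha> \<beta> n x / (r x)\<^sup>2) (at x within {0..l})"
    by (rule integral_has_vector_derivative[OF _ assms])
      (use r_nonzero in \<open>auto intro!: continuous_intros r_cont continuous_u_coeff\<close>)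
  then show ?thesis by (simp add: Suc u_coeff_def)
qed

lemma u_coeff_deriv:
  assumes "x \<in> {0..l}"
  shows "(u_coeff \<alpha> \<beta> n has_vector_derivative (case n of 0 \<Rightarrow> 0 | Suc m \<Rightarrow> (r x)\<^sup>2 * p_coeff \<alpha> \<beta> m x))
     (at x within {0..l})"
  unfolding u_coeff_def
  by (cases n) (use assms in \<open>auto intro!: integral_has_vector_derivative continuous_intros r_cont continuous_p_coeff\<close>)

text \<open>One integration raises the degree of x^n / n! by one and keeps the constant
  \<open>B\<close>. Each coefficient of the series arises from the previous one by two such
  integrations.\<close>

lemma integral_mono_monomial:
  assumes f: "continuous_on {0..l} f" and x: "x \<in> {0..l}"
    and bnd: "\<And>t. t \<in> {0..l} \<Longrightarrow> 0 \<le> f t \<and> f t \<le> B * (t ^ n / fact n)"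
  shows "0 \<le> integral {0..x} f \<and> integral {0..x} f \<le> B * (x ^ Suc n / fact (Suc n))"
proof -
  have sub: "{0..x} \<subseteq> {0..l}" using x by auto
  have int: "f integrable_on {0..x}"
    by (rule integrable_continuous_real[OF continuous_on_subset[OF f sub]])
  have "((\<lambda>t. B * (t ^ n / fact n)) has_integral
      B * (x ^ Suc n / fact (Suc n)) - B * (0 ^ Suc n / fact (Suc n))) {0..x}"
  proof (rule fundamental_theorem_of_calculus)
    fix t assume "t \<in> {0..x}"
    have "((\<lambda>t. B * (t ^ Suc n / fact (Suc n))) has_real_derivative
        B * ((real (Suc n) * t ^ n) / fact (Suc n))) (at t within {0..x})"
      by (auto intro!: derivative_eq_intros simp del: fact_Suc of_nat_Suc power_Suc)
    also have "B * ((real (Suc n) * t ^ n) / fact (Suc n)) = B * (t ^ n / fact n)"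
      by (simp add: field_simps del: of_nat_Suc)
    finally show "((\<lambda>t. B * (t ^ Suc n / fact (Suc n))) has_vector_derivative B * (t ^ n / fact n)) (at t within {0..x})"
      by (simp add: has_real_derivative_iff_has_vector_derivative)
  qed (use x in auto)
  then have *: "((\<lambda>t. B * (t ^ n / fact n)) has_integral B * (x ^ Suc n / fact (Suc n))) {0..x}"
    by simp
  have "integral {0..x} f \<le> B * (x ^ Suc n / fact (Suc n))"
    by (rule has_integral_le[OF integrable_integral[OF int] *]) (use bnd sub in auto)
  moreover have "0 \<le> integral {0..x} f"
    by (rule integral_nonneg[OF int]) (use bnd sub in auto)
  ultimately show ?thesis by blast
qed

text \<open>Two integrations per step produce (2n)! rather than n!. Hence the series at -k^2 is
  dominated by cosh of a multiple of |k|, that is, it is of exponential type in k. Nonnegative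
  initial data keep every coefficient nonnegative.\<close>

lemma coeff_bounds:
  assumes "0 \<le> \<alpha>" "0 \<le> \<beta>"
  obtains A B M where "0 < A" "0 < B" "0 < M"
    "\<And>n x. x \<in> {0..l} \<Longrightarrow> 0 \<le> p_coeff \<alpha> \<beta> n x \<and> p_coeff \<alpha> \<beta> n x \<le> A * M ^ n * (x ^ (2 * n) / fact (2 * n))"
    "\<And>n x. x \<in> {0..l} \<Longrightarrow> 0 \<le> u_coeff \<alpha> \<beta> (Suc n) x
        \<and> u_coeff \<alpha> \<beta> (Suc n) x \<le> B * M ^ n * (x ^ Suc (2 * n) / fact (Suc (2 * n)))"
proof -
  obtain R where R: "0 < R" "\<And>x. x \<in> {0..l} \<Longrightarrow> norm ((r x)\<^sup>2) \<le> R"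
    using continuous_on_bounded_normE[of "{0..l}" "\<lambda>x. (r x)\<^sup>2"] by (auto intro!: continuous_intros r_cont)
  obtain S where S: "0 < S" "\<And>x. x \<in> {0..l} \<Longrightarrow> norm (1 / (r x)\<^sup>2) \<le> S"
  proof (rule continuous_on_bounded_normE)
    show "continuous_on {0..l} (\<lambda>x. 1 / (r x)\<^sup>2)"
      using r_nonzero by (auto intro!: continuous_intros r_cont)
  qed auto
  obtain A where A: "0 < A" "\<And>x. x \<in> {0..l} \<Longrightarrow> norm (p_coeff \<alpha> \<beta> 0 x) \<le> A"
    using continuous_on_bounded_normE[OF _ continuous_p_coeff[of \<alpha> \<beta> 0]] by auto
  have p0: "0 \<le> p_coeff \<alpha> \<beta> 0 x" if "x \<in> {0..l}" for x
  proof -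
    have "0 \<le> integral {0..x} (\<lambda>s. \<beta> / (r s)\<^sup>2)"
      by (rule integral_nonneg)
        (use assms that r_nonzero in \<open>auto intro!: integrable_continuous_real continuous_intros
          continuous_on_subset[OF r_cont]\<close>)
    then show ?thesis using assms by simp
  qed
  \<comment> \<open>\<open>R\<close> bounds r^2 and \<open>S\<close> bounds 1/r^2, so a full step
    from \<open>p_coeff\<close> through \<open>u_coeff\<close> to the next \<open>p_coeff\<close>
    costs the factor \<open>R * S\<close>.\<close>
  have step_u: "0 \<le> u_coeff \<alpha> \<beta> (Suc n) x
        \<and> u_coeff \<alpha> \<beta> (Suc n) x \<le> (R * A * (R * S) ^ n) * (x ^ Suc (2 * n) / fact (Suc (2 * n)))"
    if IH: "\<And>x. x \<in> {0..l} \<Longrightarrow> 0 \<le> p_coeff \<alpha> \<beta> n x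
        \<and> p_coeff \<alpha> \<beta> n x \<le> A * (R * S) ^ n * (x ^ (2 * n) / fact (2 * n))" and x: "x \<in> {0..l}" for n x
    unfolding u_coeff_def nat.case
  proof (rule integral_mono_monomial[OF _ x])
    fix t assume t: "t \<in> {0..l}"
    have "(r t)\<^sup>2 * p_coeff \<alpha> \<beta> n t \<le> R * (A * (R * S) ^ n * (t ^ (2 * n) / fact (2 * n)))"
      using IH[OF t] R(2)[OF t] R(1) by (intro mult_mono) auto
    then show "0 \<le> (r t)\<^sup>2 * p_coeff \<alpha> \<beta> n t \<and> (r t)\<^sup>2 * p_coeff \<alpha> \<beta> n t
        \<le> R * A * (R * S) ^ n * (t ^ (2 * n) / fact (2 * n))"
      using IH[OF t] by (simp add: mult.assoc)
  qed (auto intro!: continuous_intros r_cont continuous_p_coeff)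
  have pb: "0 \<le> p_coeff \<alpha> \<beta> n x \<and> p_coeff \<alpha> \<beta> n x \<le> A * (R * S) ^ n * (x ^ (2 * n) / fact (2 * n))"
    if "x \<in> {0..l}" for n x
    using that
  proof (induction n arbitrary: x)
    case 0
    then show ?case using p0[of x] A(2)[of x] by auto
  next
    case (Suc n)
    have eq: "p_coeff \<alpha> \<beta> (Suc n) x = integral {0..x} (\<lambda>s. u_coeff \<alpha> \<beta> (Suc n) s / (r s)\<^sup>2)"
      by (simp add: u_coeff_def)
    have "0 \<le> integral {0..x} (\<lambda>s. u_coeff \<alpha> \<beta> (Suc n) s / (r s)\<^sup>2) \<and>
      integral {0..x} (\<lambda>s. u_coeff \<alpha> \<beta> (Suc n) s / (r s)\<^sup>2)
        \<le> A * (R * S) ^ Suc n * (x ^ Suc (Suc (2 * n)) / fact (Suc (Suc (2 * n))))"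
    proof (rule integral_mono_monomial[OF _ Suc.prems])
      fix t assume t: "t \<in> {0..l}"
      have u: "0 \<le> u_coeff \<alpha> \<beta> (Suc n) t" "u_coeff \<alpha> \<beta> (Suc n) t
           \<le> (R * A * (R * S) ^ n) * (t ^ Suc (2 * n) / fact (Suc (2 * n)))"
        using step_u[OF Suc.IH t] by auto
      have S': "0 \<le> 1 / (r t)\<^sup>2" "1 / (r t)\<^sup>2 \<le> S" using S(2)[OF t] by auto
      have nn: "0 \<le> (R * A * (R * S) ^ n) * (t ^ Suc (2 * n) / fact (Suc (2 * n)))"
        using R(1) S(1) A(1) t by (intro mult_nonneg_nonneg divide_nonneg_nonneg) auto
      have "u_coeff \<alpha> \<beta> (Suc n) t * (1 / (r t)\<^sup>2)
          \<le> ((R * A * (R * S) ^ n) * (t ^ Suc (2 * n) / fact (Suc (2 * n)))) * S"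
        by (rule mult_mono[OF u(2) S'(2) nn S'(1)])
      then have "u_coeff \<alpha> \<beta> (Suc n) t / (r t)\<^sup>2
          \<le> A * (R * S) ^ Suc n * (t ^ Suc (2 * n) / fact (Suc (2 * n)))"
        by (simp add: algebra_simps)
      then show "0 \<le> u_coeff \<alpha> \<beta> (Suc n) t / (r t)\<^sup>2 \<and> u_coeff \<alpha> \<beta> (Suc n) t / (r t)\<^sup>2
          \<le> A * (R * S) ^ Suc n * (t ^ Suc (2 * n) / fact (Suc (2 * n)))"
        using u(1) by simp
    qed (use r_nonzero in \<open>auto intro!: continuous_intros r_cont continuous_u_coeff\<close>)
    then show ?case unfolding eq by simp
  qed
  show thesis
  proof (rule that[of A "R * A" "R * S"])
    show "0 \<le> u_coeff \<alpha> \<beta> (Suc n) x \<and> u_coeff \<alpha> \<beta> (Suc n) x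
       \<le> R * A * (R * S) ^ n * (x ^ Suc (2 * n) / fact (Suc (2 * n)))" if "x \<in> {0..l}" for n x
      by (rule step_u[OF pb that])
  qed (use pb R S A in auto)
qed

text \<open>A coarser majorant with n!, common to both families and uniform in x, is enough for
  convergence and for termwise differentiation.\<close>

lemma coeff_exp_bounds:
  assumes "0 \<le> \<alpha>" "0 \<le> \<beta>"
  obtains K M where "0 < K" "0 < M"
    "\<And>n x. x \<in> {0..l} \<Longrightarrow> \<bar>p_coeff \<alpha> \<beta> n x\<bar> \<le> K * M ^ n / fact n"
    "\<And>n x. x \<in> {0..l} \<Longrightarrow> \<bar>u_coeff \<alpha> \<beta> n x\<bar> \<le> K * M ^ n / fact n"
proof -
  from coeff_bounds[OF assms] obtain A B M where ABM: "0 < A" "0 < B" "0 < M" and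
    p: "\<And>n x. x \<in> {0..l} \<Longrightarrow> 0 \<le> p_coeff \<alpha> \<beta> n x \<and> p_coeff \<alpha> \<beta> n x \<le> A * M ^ n * (x ^ (2 * n) / fact (2 * n))" and
    u: "\<And>n x. x \<in> {0..l} \<Longrightarrow> 0 \<le> u_coeff \<alpha> \<beta> (Suc n) x
        \<and> u_coeff \<alpha> \<beta> (Suc n) x \<le> B * M ^ n * (x ^ Suc (2 * n) / fact (Suc (2 * n)))"
    by metis
  \<comment> \<open>The term \<open>B / (M * l)\<close> corrects the index shift in
    \<open>u_coeff\<close>: \<open>B * M ^ m * l ^ (2 * m + 1)\<close> equals
    \<open>B / (M * l)\<close> times the power \<open>Suc m\<close> of M l^2.\<close>
  define K where "K = A + \<beta> + B / (M * l)"
  define N where "N = M * l\<^sup>2"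
  have Mpos: "0 < N" "0 < M * l" using ABM l_pos by (auto simp: N_def)
  have KA: "A \<le> K" "B / (M * l) \<le> K" "\<beta> \<le> K" "0 < K"
    using ABM assms Mpos by (auto simp: K_def intro!: add_nonneg_nonneg add_pos_nonneg)
  show thesis
  proof (rule that[of K N])
    fix n x assume x: "x \<in> {0..l}"
    have "A * M ^ n * (x ^ (2 * n) / fact (2 * n)) \<le> A * M ^ n * (l ^ (2 * n) / fact n)"
      using ABM x by (intro mult_left_mono frac_le power_mono) (auto intro!: fact_mono mult_nonneg_nonneg)
    also have "\<dots> = A * N ^ n / fact n"
      by (simp add: N_def power_mult_distrib power_mult)
    also have "\<dots> \<le> K * N ^ n / fact n"
      using KA Mpos by (intro divide_right_mono mult_right_mono) auto
    finally show "\<bar>p_coeff \<alpha> \<beta> n x\<bar> \<le> K * N ^ n / fact n"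
      using p[OF x, of n] by linarith
    show "\<bar>u_coeff \<alpha> \<beta> n x\<bar> \<le> K * N ^ n / fact n"
    proof (cases n)
      case 0
      then show ?thesis using KA assms by (simp add: u_coeff_def)
    next
      case (Suc m)
      have "B * M ^ m * (x ^ Suc (2 * m) / fact (Suc (2 * m))) \<le> B * M ^ m * (l ^ Suc (2 * m) / fact (Suc m))"
        using ABM x
        by (intro mult_left_mono frac_le power_mono) (auto intro!: fact_mono mult_nonneg_nonneg simp del: fact_Suc)
      also have "\<dots> = B / (M * l) * N ^ Suc m / fact (Suc m)"
        using ABM l_pos by (simp add: N_def power_mult_distrib power_mult power2_eq_square del: fact_Suc)
      also have "\<dots> \<le> K * N ^ Suc m / fact (Suc m)"
        using KA Mpos by (intro divide_right_mono mult_right_mono) auto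
      finally show ?thesis
        using u[OF x, of m] Suc by simp
    qed
  qed (use KA Mpos in auto)
qed

lemma summable_exp_bound: "summable (\<lambda>n. K * (M * norm (\<Lambda>::'a::{real_normed_field, banach})) ^ n / fact n)"
  using summable_mult[OF summable_exp[of "M * norm \<Lambda>"], of K] by (simp add: field_simps)

context
  fixes \<alpha> \<beta> :: real
  assumes ab: "0 \<le> \<alpha>" "0 \<le> \<beta>"
begin

lemma p_ser_summable:
  fixes \<Lambda> :: "'a::{real_normed_field, banach}"
  assumes x: "x \<in> {0..l}"
  shows "summable (\<lambda>n. of_real (p_coeff \<alpha> \<beta> n x) * \<Lambda> ^ n)"
    and "summable (\<lambda>n. of_real (u_coeff \<alpha> \<beta> n x) * \<Lambda> ^ n)"
proof -
  from coeff_exp_bounds[OF ab] obtain K M where KM: "0 < K" "0 < M" and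
    p: "\<And>n x. x \<in> {0..l} \<Longrightarrow> \<bar>p_coeff \<alpha> \<beta> n x\<bar> \<le> K * M ^ n / fact n" and
    u: "\<And>n x. x \<in> {0..l} \<Longrightarrow> \<bar>u_coeff \<alpha> \<beta> n x\<bar> \<le> K * M ^ n / fact n" by metis
  have *: "norm (of_real y * \<Lambda> ^ n) \<le> K * (M * norm \<Lambda>) ^ n / fact n" if "\<bar>y\<bar> \<le> K * M ^ n / fact n" for y n
    using mult_right_mono[OF that, of "norm \<Lambda> ^ n"] by (simp add: norm_mult norm_power power_mult_distrib)
  show "summable (\<lambda>n. of_real (p_coeff \<alpha> \<beta> n x) * \<Lambda> ^ n)"
    by (rule summable_comparison_test'[OF summable_exp_bound[of K M \<Lambda>]]) (use p x * in blast)
  show "summable (\<lambda>n. of_real (u_coeff \<alpha> \<beta> n x) * \<Lambda> ^ n)"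
    by (rule summable_comparison_test'[OF summable_exp_bound[of K M \<Lambda>]]) (use u x * in blast)
qed

lemma p_ser_deriv:
  fixes \<Lambda> :: "'a::{real_normed_field, banach}"
  assumes x: "x \<in> {0..l}"
  shows "(p_ser \<alpha> \<beta> \<Lambda> has_vector_derivative u_ser \<alpha> \<beta> \<Lambda> x / of_real ((r x)\<^sup>2)) (at x within {0..l})"
proof -
  from coeff_exp_bounds[OF ab] obtain K M where KM: "0 < K" "0 < M" and
    u: "\<And>n x. x \<in> {0..l} \<Longrightarrow> \<bar>u_coeff \<alpha> \<beta> n x\<bar> \<le> K * M ^ n / fact n" by metis
  obtain S where S: "0 < S" "\<And>x. x \<in> {0..l} \<Longrightarrow> norm (1 / (r x)\<^sup>2) \<le> S"
  proof (rule continuous_on_bounded_normE)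
    show "continuous_on {0..l} (\<lambda>x. 1 / (r x)\<^sup>2)"
      using r_nonzero by (auto intro!: continuous_intros r_cont)
  qed auto
  have "((\<lambda>x. \<Sum>n. of_real (p_coeff \<alpha> \<beta> n x) * \<Lambda> ^ n) has_vector_derivative
      (\<Sum>n. of_real (u_coeff \<alpha> \<beta> n x / (r x)\<^sup>2) * \<Lambda> ^ n)) (at x within {0..l})"
  proof (rule has_vector_derivative_suminf[OF _ _ summable_exp_bound[of "S * K" M \<Lambda>] p_ser_summable(1) x])
    fix n x assume x: "x \<in> {0..l}"
    have "((\<lambda>x. of_real (p_coeff \<alpha> \<beta> n x) :: 'a) has_vector_derivative of_real (u_coeff \<alpha> \<beta> n x / (r x)\<^sup>2))
       (at x within {0..l})"
      by (rule has_vector_derivative_of_real[OF p_coeff_deriv[OF x, folded has_real_derivative_iff_has_vector_derivative]])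
    then show "((\<lambda>x. of_real (p_coeff \<alpha> \<beta> n x) * \<Lambda> ^ n) has_vector_derivative
        of_real (u_coeff \<alpha> \<beta> n x / (r x)\<^sup>2) * \<Lambda> ^ n) (at x within {0..l})"
      by (rule has_vector_derivative_mult_left)
    have "\<bar>u_coeff \<alpha> \<beta> n x / (r x)\<^sup>2\<bar> \<le> S * (K * M ^ n / fact n)"
      using mult_mono[OF S(2)[OF x] u[OF x, of n]] S(1) by (simp add: abs_mult)
    from mult_right_mono[OF this, of "norm \<Lambda> ^ n"]
    show "norm (of_real (u_coeff \<alpha> \<beta> n x / (r x)\<^sup>2) * \<Lambda> ^ n) \<le> S * K * (M * norm \<Lambda>) ^ n / fact n"
      by (simp add: norm_mult norm_power norm_divide power_mult_distrib)
  qed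
  also have "(\<Sum>n. of_real (u_coeff \<alpha> \<beta> n x / (r x)\<^sup>2) * \<Lambda> ^ n)
      = (\<Sum>n. of_real (u_coeff \<alpha> \<beta> n x) * \<Lambda> ^ n) / of_real ((r x)\<^sup>2)"
    by (subst suminf_divide[symmetric, OF p_ser_summable(2)[OF x]]) simp
  finally show ?thesis unfolding p_ser_def u_ser_def .
qed

lemma u_ser_deriv:
  fixes \<Lambda> :: "'a::{real_normed_field, banach}"
  assumes x: "x \<in> {0..l}"
  shows "(u_ser \<alpha> \<beta> \<Lambda> has_vector_derivative \<Lambda> * of_real ((r x)\<^sup>2) * p_ser \<alpha> \<beta> \<Lambda> x) (at x within {0..l})"
proof -
  from coeff_exp_bounds[OF ab] obtain K M where KM: "0 < K" "0 < M" and
    p: "\<And>n x. x \<in> {0..l} \<Longrightarrow> \<bar>p_coeff \<alpha> \<beta> n x\<bar> \<le> K * M ^ n / fact n" by metis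
  obtain R where R: "0 < R" "\<And>x. x \<in> {0..l} \<Longrightarrow> norm ((r x)\<^sup>2) \<le> R"
    using continuous_on_bounded_normE[of "{0..l}" "\<lambda>x. (r x)\<^sup>2"] by (auto intro!: continuous_intros r_cont)
  define f' :: "nat \<Rightarrow> real \<Rightarrow> 'a" where
    "f' n x = of_real (case n of 0 \<Rightarrow> 0 | Suc m \<Rightarrow> (r x)\<^sup>2 * p_coeff \<alpha> \<beta> m x) * \<Lambda> ^ n" for n x
  \<comment> \<open>The majorant is zero at index 0 because \<open>u_coeff\<close> is constant
    there; at \<open>Suc m\<close> the derivative contains \<open>p_coeff\<close> of index
    \<open>m\<close>.\<close>
  define B where "B n = (case n of 0 \<Rightarrow> 0 | Suc m \<Rightarrow> R * K * norm \<Lambda> * (M * norm \<Lambda>) ^ m / fact m)" for n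
  have B: "summable B"
    by (subst summable_Suc_iff[symmetric]) (use summable_exp_bound[of "R * K * norm \<Lambda>" M \<Lambda>] in \<open>simp add: B_def\<close>)
  have "((\<lambda>x. \<Sum>n. of_real (u_coeff \<alpha> \<beta> n x) * \<Lambda> ^ n) has_vector_derivative (\<Sum>n. f' n x)) (at x within {0..l})"
  proof (rule has_vector_derivative_suminf[OF _ _ B p_ser_summable(2) x])
    fix n x assume x: "x \<in> {0..l}"
    show "((\<lambda>x. of_real (u_coeff \<alpha> \<beta> n x) * \<Lambda> ^ n) has_vector_derivative f' n x) (at x within {0..l})"
      unfolding f'_def
      by (rule has_vector_derivative_mult_left[OF has_vector_derivative_of_real[OF u_coeff_deriv[OF x, folded has_real_derivative_iff_has_vector_derivative]]])
    show "norm (f' n x) \<le> B n"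
    proof (cases n)
      case 0
      then show ?thesis by (simp add: f'_def B_def)
    next
      case (Suc m)
      have "\<bar>(r x)\<^sup>2 * p_coeff \<alpha> \<beta> m x\<bar> \<le> R * (K * M ^ m / fact m)"
        using mult_mono[OF R(2)[OF x] p[OF x, of m]] R(1) by (simp add: abs_mult)
      from mult_right_mono[OF this, of "norm \<Lambda> ^ n"]
      show ?thesis
        by (simp add: f'_def B_def Suc norm_mult norm_power abs_mult power_mult_distrib mult_ac)
    qed
  qed
  also have "(\<Sum>n. f' n x) = (\<Sum>n. (\<Lambda> * of_real ((r x)\<^sup>2)) * (of_real (p_coeff \<alpha> \<beta> n x) * \<Lambda> ^ n))"
  proof -
    have "(\<lambda>n. f' (Suc n) x) = (\<lambda>n. (\<Lambda> * of_real ((r x)\<^sup>2)) * (of_real (p_coeff \<alpha> \<beta> n x) * \<Lambda> ^ n))"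
      by (simp add: f'_def mult_ac)
    moreover from this have "summable (\<lambda>n. f' (Suc n) x)"
      by (simp only: summable_mult[OF p_ser_summable(1)[OF x]])
    then have "summable (\<lambda>n. f' n x)" by (subst (asm) summable_Suc_iff)
    from suminf_split_head[OF this] have "(\<Sum>n. f' n x) = (\<Sum>n. f' (Suc n) x)" by (simp add: f'_def)
    ultimately show ?thesis by simp
  qed
  also have "\<dots> = \<Lambda> * of_real ((r x)\<^sup>2) * (\<Sum>n. of_real (p_coeff \<alpha> \<beta> n x) * \<Lambda> ^ n)"
    by (rule suminf_mult[OF p_ser_summable(1)[OF x]])
  finally show ?thesis unfolding p_ser_def u_ser_def .
qed

lemma p_ser_of_real:
  assumes "x \<in> {0..l}"
  shows "p_ser \<alpha> \<beta> (of_real \<Lambda> :: 'a::{real_normed_field, banach}) x = of_real (p_ser \<alpha> \<beta> \<Lambda> x)"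
    and "u_ser \<alpha> \<beta> (of_real \<Lambda> :: 'a) x = of_real (u_ser \<alpha> \<beta> \<Lambda> x)"
  using p_ser_summable[OF assms, where 'a = real]
  by (simp_all add: p_ser_def u_ser_def suminf_of_real flip: of_real_power of_real_mult)

lemma p_ser_cnj:
  assumes "x \<in> {0..l}"
  shows "p_ser \<alpha> \<beta> (cnj \<Lambda>) x = cnj (p_ser \<alpha> \<beta> \<Lambda> x)"
    and "u_ser \<alpha> \<beta> (cnj \<Lambda>) x = cnj (u_ser \<alpha> \<beta> \<Lambda> x)"
proof -
  have "cnj (\<Sum>n. of_real (a n) * \<Lambda> ^ n) = (\<Sum>n. of_real (a n) * cnj \<Lambda> ^ n)"
    if "summable (\<lambda>n. of_real (a n) * \<Lambda> ^ n)" for a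
  proof -
    have "(\<lambda>n. cnj (of_real (a n) * \<Lambda> ^ n)) sums cnj (\<Sum>n. of_real (a n) * \<Lambda> ^ n)"
      using summable_sums[OF that] by (simp only: sums_cnj)
    from sums_unique[OF this] show ?thesis by simp
  qed
  from this[OF p_ser_summable(1)[OF assms]] this[OF p_ser_summable(2)[OF assms]]
  show "p_ser \<alpha> \<beta> (cnj \<Lambda>) x = cnj (p_ser \<alpha> \<beta> \<Lambda> x)" "u_ser \<alpha> \<beta> (cnj \<Lambda>) x = cnj (u_ser \<alpha> \<beta> \<Lambda> x)"
    unfolding p_ser_def u_ser_def by simp_all
qed

lemma p_ser_entire:
  assumes "x \<in> {0..l}"
  shows "(\<lambda>\<Lambda>. p_ser \<alpha> \<beta> \<Lambda> x :: complex) holomorphic_on UNIV"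
    and "(\<lambda>\<Lambda>. u_ser \<alpha> \<beta> \<Lambda> x :: complex) holomorphic_on UNIV"
proof -
  have *: "(\<lambda>\<Lambda>. \<Sum>n. of_real (a n) * \<Lambda> ^ n) holomorphic_on UNIV"
    if "\<And>\<Lambda>::complex. summable (\<lambda>n. of_real (a n) * \<Lambda> ^ n)" for a
    by (rule holomorphic_onI, rule field_differentiable_at_within)
      (use termdiffs_strong_converges_everywhere[OF that] field_differentiable_def in blast)
  show "(\<lambda>\<Lambda>. p_ser \<alpha> \<beta> \<Lambda> x :: complex) holomorphic_on UNIV"
    "(\<lambda>\<Lambda>. u_ser \<alpha> \<beta> \<Lambda> x :: complex) holomorphic_on UNIV"
    unfolding p_ser_def u_ser_def by (rule *; rule p_ser_summable[OF assms])+
qed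

text \<open>All terms are nonnegative, so each series dominates its term of index 0. This is the
  source of all positivity on the imaginary axis.\<close>

lemma p_ser_nonneg:
  fixes \<Lambda> :: real
  assumes x: "x \<in> {0..l}" and "0 \<le> \<Lambda>"
  shows "\<alpha> \<le> p_ser \<alpha> \<beta> \<Lambda> x" "\<beta> \<le> u_ser \<alpha> \<beta> \<Lambda> x"
proof -
  from coeff_bounds[OF ab] obtain A B M where
    p: "\<And>n x. x \<in> {0..l} \<Longrightarrow> 0 \<le> p_coeff \<alpha> \<beta> n x \<and> p_coeff \<alpha> \<beta> n x \<le> A * M ^ n * (x ^ (2 * n) / fact (2 * n))" and
    u: "\<And>n x. x \<in> {0..l} \<Longrightarrow> 0 \<le> u_coeff \<alpha> \<beta> (Suc n) x
        \<and> u_coeff \<alpha> \<beta> (Suc n) x \<le> B * M ^ n * (x ^ Suc (2 * n) / fact (Suc (2 * n)))"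
    by metis
  have u': "0 \<le> u_coeff \<alpha> \<beta> n x" for n
    using u[OF x] ab by (cases n) (auto simp: u_coeff_def)
  have 0: "0 \<le> integral {0..x} (\<lambda>s. \<beta> / (r s)\<^sup>2)"
    by (rule integral_nonneg)
      (use ab x r_nonzero in \<open>auto intro!: integrable_continuous_real continuous_intros
        continuous_on_subset[OF r_cont]\<close>)
  have "(\<Sum>n<1. of_real (p_coeff \<alpha> \<beta> n x) * \<Lambda> ^ n) \<le> p_ser \<alpha> \<beta> \<Lambda> x"
    unfolding p_ser_def
    by (rule sum_le_suminf[OF p_ser_summable(1)[OF x]]) (use p[OF x] \<open>0 \<le> \<Lambda>\<close> in auto)
  with 0 show "\<alpha> \<le> p_ser \<alpha> \<beta> \<Lambda> x" by simp
  have "(\<Sum>n<1. of_real (u_coeff \<alpha> \<beta> n x) * \<Lambda> ^ n) \<le> u_ser \<alpha> \<beta> \<Lambda> x"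
    unfolding u_ser_def
    by (rule sum_le_suminf[OF p_ser_summable(2)[OF x]]) (use u' \<open>0 \<le> \<Lambda>\<close> in auto)
  then show "\<beta> \<le> u_ser \<alpha> \<beta> \<Lambda> x" by (simp add: u_coeff_def)
qed

lemma p_ser_initial: "p_ser \<alpha> \<beta> \<Lambda> 0 = of_real \<alpha>" "u_ser \<alpha> \<beta> \<Lambda> 0 = of_real \<beta>"
proof -
  have "p_coeff \<alpha> \<beta> n 0 = (if n = 0 then \<alpha> else 0)" "u_coeff \<alpha> \<beta> n 0 = (if n = 0 then \<beta> else 0)" for n
    by (cases n; simp add: u_coeff_def)+
  then show "p_ser \<alpha> \<beta> \<Lambda> 0 = of_real \<alpha>" "u_ser \<alpha> \<beta> \<Lambda> 0 = of_real \<beta>"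
    unfolding p_ser_def u_ser_def
    by (subst suminf_finite[of "{0}"]; simp)+
qed

lemma p_ser_at_0:
  assumes "x \<in> {0..l}"
  shows "p_ser \<alpha> 0 0 x = of_real \<alpha>" "u_ser \<alpha> \<beta> 0 x = of_real \<beta>"
  unfolding p_ser_def u_ser_def by (subst suminf_finite[of "{0}"]; simp add: u_coeff_def)+

text \<open>The (2n)! bounds sum to a hyperbolic cosine in |k|; the series for u carries an
  additional factor |k|^2 because its bounds start at index 1.\<close>

lemma p_ser_growth:
  obtains K C where "0 < K" "0 < C"
    "\<And>k::complex. norm (p_ser \<alpha> \<beta> (- k\<^sup>2) l) \<le> K * exp (C * norm k)"
    "\<And>k::complex. norm (u_ser \<alpha> \<beta> (- k\<^sup>2) l) \<le> K * exp (C * norm k)"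
proof -
  have ll: "l \<in> {0..l}" using l_pos by simp
  from coeff_bounds[OF ab] obtain A B M where ABM: "0 < A" "0 < B" "0 < M" and
    p: "\<And>n x. x \<in> {0..l} \<Longrightarrow> 0 \<le> p_coeff \<alpha> \<beta> n x \<and> p_coeff \<alpha> \<beta> n x \<le> A * M ^ n * (x ^ (2 * n) / fact (2 * n))" and
    u: "\<And>n x. x \<in> {0..l} \<Longrightarrow> 0 \<le> u_coeff \<alpha> \<beta> (Suc n) x
        \<and> u_coeff \<alpha> \<beta> (Suc n) x \<le> B * M ^ n * (x ^ Suc (2 * n) / fact (Suc (2 * n)))"
    by metis
  \<comment> \<open>With this choice \<open>M ^ n * l ^ (2 * n)\<close> times |k|^(2n) is exactly
    \<open>(c * norm k) ^ (2 * n)\<close>.\<close>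
  define c where "c = sqrt M * l"
  have c: "0 < c" "c\<^sup>2 = M * l\<^sup>2" using ABM l_pos by (auto simp: c_def power_mult_distrib)
  have cosh: "(\<lambda>n. y ^ (2 * n) / fact (2 * n)) sums cosh y" for y :: real
  proof -
    have "(\<lambda>n. if even n then y ^ n /\<^sub>R fact n else 0) sums cosh y" by (rule cosh_converges)
    moreover have "strict_mono (\<lambda>n::nat. 2 * n)" by (auto simp: strict_mono_def)
    ultimately have "(\<lambda>n. (\<lambda>n. if even n then y ^ n /\<^sub>R fact n else 0) (2 * n)) sums cosh y"
      by (subst sums_mono_reindex) (auto elim: evenE)
    then show ?thesis by (simp add: field_simps)
  qed
  have coshexp: "cosh y \<le> exp y" if "0 \<le> y" for y :: real
    using that by (simp add: cosh_def)
  have p_bound: "norm (p_ser \<alpha> \<beta> (- k\<^sup>2) l) \<le> A * exp (c * norm k)" for k :: complex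
  proof -
    let ?y = "c * norm k"
    have tb: "norm (of_real (p_coeff \<alpha> \<beta> n l) * (- k\<^sup>2) ^ n) \<le> A * (?y ^ (2 * n) / fact (2 * n))" for n
    proof -
      have "norm (of_real (p_coeff \<alpha> \<beta> n l) * (- k\<^sup>2) ^ n) = p_coeff \<alpha> \<beta> n l * (norm k)\<^sup>2 ^ n"
        using p[OF ll, of n] by (simp add: norm_mult norm_power)
      also have "\<dots> \<le> A * M ^ n * (l ^ (2 * n) / fact (2 * n)) * (norm k)\<^sup>2 ^ n"
        using p[OF ll, of n] by (intro mult_right_mono) auto
      also have "\<dots> = A * (?y ^ (2 * n) / fact (2 * n))"
        by (simp add: power_mult power_mult_distrib c(2))
      finally show ?thesis .
    qed
    have "norm (p_ser \<alpha> \<beta> (- k\<^sup>2) l) \<le> (\<Sum>n. A * (?y ^ (2 * n) / fact (2 * n)))"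
      unfolding p_ser_def by (rule norm_suminf_le[OF tb summable_mult[OF sums_summable[OF cosh]]])
    also have "\<dots> = A * cosh ?y" using sums_unique[OF sums_mult[OF cosh[of ?y], of A]] by simp
    also have "\<dots> \<le> A * exp ?y" using coshexp[of ?y] c ABM by (intro mult_left_mono) auto
    finally show ?thesis .
  qed
  have u_bound: "norm (u_ser \<alpha> \<beta> (- k\<^sup>2) l) \<le> \<beta> + (norm k)\<^sup>2 * (B * l * exp (c * norm k))" for k :: complex
  proof -
    let ?y = "c * norm k"
    let ?t = "\<lambda>n. of_real (u_coeff \<alpha> \<beta> n l) * (- k\<^sup>2) ^ n"
    have tb: "norm (?t (Suc n)) \<le> (norm k)\<^sup>2 * (B * l) * (?y ^ (2 * n) / fact (2 * n))" for n
    proof -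
      have "norm (?t (Suc n)) = u_coeff \<alpha> \<beta> (Suc n) l * ((norm k)\<^sup>2 * (norm k)\<^sup>2 ^ n)"
        using u[OF ll, of n] by (simp add: norm_mult norm_power)
      also have "\<dots> \<le> (B * M ^ n * (l ^ Suc (2 * n) / fact (Suc (2 * n)))) * ((norm k)\<^sup>2 * (norm k)\<^sup>2 ^ n)"
        using u[OF ll, of n] by (intro mult_right_mono) auto
      also have "\<dots> \<le> (B * M ^ n * (l ^ Suc (2 * n) / fact (2 * n))) * ((norm k)\<^sup>2 * (norm k)\<^sup>2 ^ n)"
        using ABM l_pos
        by (intro mult_right_mono mult_left_mono divide_left_mono) (auto intro!: fact_mono mult_nonneg_nonneg simp del: fact_Suc)
      also have "\<dots> = (norm k)\<^sup>2 * (B * l) * (?y ^ (2 * n) / fact (2 * n))"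
        by (simp add: power_mult power_mult_distrib c(2))
      finally show ?thesis .
    qed
    have "u_ser \<alpha> \<beta> (- k\<^sup>2) l = ?t 0 + (\<Sum>n. ?t (Suc n))"
      unfolding u_ser_def using suminf_split_head[OF p_ser_summable(2)[OF ll, of "- k\<^sup>2"]] by simp
    also have "norm \<dots> \<le> norm (?t 0) + norm (\<Sum>n. ?t (Suc n))" by (rule norm_triangle_ineq)
    also have "norm (\<Sum>n. ?t (Suc n)) \<le> (\<Sum>n. (norm k)\<^sup>2 * (B * l) * (?y ^ (2 * n) / fact (2 * n)))"
      by (rule norm_suminf_le[OF tb summable_mult[OF sums_summable[OF cosh]]])
    also have "\<dots> = (norm k)\<^sup>2 * (B * l) * cosh ?y"
      using sums_unique[OF sums_mult[OF cosh[of ?y], of "(norm k)\<^sup>2 * (B * l)"]] by simp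
    also have "\<dots> \<le> (norm k)\<^sup>2 * (B * l) * exp ?y"
      using coshexp[of ?y] c ABM l_pos by (intro mult_left_mono) auto
    finally show ?thesis using ab by (simp add: u_coeff_def mult.assoc)
  qed
  define K where "K = A + \<beta> + 2 * B * l"
  show thesis
  proof (rule that[of K "c + 1"])
    fix k :: complex
    have mono: "exp (c * norm k) \<le> exp ((c + 1) * norm k)" "1 \<le> exp ((c + 1) * norm k)"
      using c by (auto simp: algebra_simps)
    have "norm (p_ser \<alpha> \<beta> (- k\<^sup>2) l) \<le> A * exp ((c + 1) * norm k)"
      by (rule order_trans[OF p_bound]) (use mono ABM in simp)
    also have "\<dots> \<le> K * exp ((c + 1) * norm k)"
      using ab ABM l_pos by (intro mult_right_mono) (auto simp: K_def)
    finally show "norm (p_ser \<alpha> \<beta> (- k\<^sup>2) l) \<le> K * exp ((c + 1) * norm k)" .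
    \<comment> \<open>The factor |k|^2 is absorbed by 2 exp |k|, which explains the rate
      \<open>c + 1\<close> and the summand \<open>2 * B * l\<close> in \<open>K\<close>.\<close>
    have "(norm k)\<^sup>2 / 2 \<le> exp (norm k)"
      using exp_lower_Taylor_quadratic[of "norm k"] norm_ge_zero[of k] by linarith
    then have "(norm k)\<^sup>2 * (B * l * exp (c * norm k)) \<le> (2 * exp (norm k)) * (B * l * exp (c * norm k))"
      using ABM l_pos by (intro mult_right_mono) auto
    also have "\<dots> = 2 * B * l * exp ((c + 1) * norm k)" by (simp add: algebra_simps exp_add)
    finally have "norm (u_ser \<alpha> \<beta> (- k\<^sup>2) l) \<le> \<beta> * exp ((c + 1) * norm k) + 2 * B * l * exp ((c + 1) * norm k)"
      using u_bound[of k] mult_left_mono[OF mono(2) ab(2)] by linarith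
    also have "\<dots> \<le> K * exp ((c + 1) * norm k)"
      using ABM by (simp add: K_def algebra_simps)
    finally show "norm (u_ser \<alpha> \<beta> (- k\<^sup>2) l) \<le> K * exp ((c + 1) * norm k)" .
  qed (use ABM ab c l_pos in \<open>auto simp: K_def intro!: add_pos_nonneg add_nonneg_pos\<close>)
qed

end

section \<open>Wronskian identities and uniqueness for the first-order system\<close>

lemma zero_derivative_imp_const:
  fixes f :: "real \<Rightarrow> 'a::banach"
  assumes "continuous_on {0..l} f" "\<And>x. x \<in> {0<..<l} \<Longrightarrow> (f has_vector_derivative 0) (at x)" "x \<in> {0..l}"
  shows "f x = f 0"
proof (rule has_derivative_zero_unique_strong_interval[of "{0, l}"])
  fix y assume "y \<in> {0..l} - {0, l}"
  then have "(f has_vector_derivative 0) (at y)" by (intro assms) auto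
  then show "(f has_derivative (\<lambda>h. 0)) (at y within {0..l})"
    by (simp add: has_vector_derivative_def has_derivative_at_withinI)
qed (use assms in auto)

lemma continuous_p_ser:
  fixes \<Lambda> :: "'a::{real_normed_field, banach}"
  assumes "0 \<le> \<alpha>" "0 \<le> \<beta>"
  shows "continuous_on {0..l} (p_ser \<alpha> \<beta> \<Lambda>)" "continuous_on {0..l} (u_ser \<alpha> \<beta> \<Lambda>)"
  unfolding continuous_on_eq_continuous_within
  by (blast intro: has_vector_derivative_continuous[OF p_ser_deriv[OF assms]]
      has_vector_derivative_continuous[OF u_ser_deriv[OF assms]])+

lemma p_ser_deriv_at:
  fixes \<Lambda> :: "'a::{real_normed_field, banach}"
  assumes "0 \<le> \<alpha>" "0 \<le> \<beta>" "x \<in> {0<..<l}"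
  shows "(p_ser \<alpha> \<beta> \<Lambda> has_vector_derivative u_ser \<alpha> \<beta> \<Lambda> x / of_real ((r x)\<^sup>2)) (at x)"
    and "(u_ser \<alpha> \<beta> \<Lambda> has_vector_derivative \<Lambda> * of_real ((r x)\<^sup>2) * p_ser \<alpha> \<beta> \<Lambda> x) (at x)"
  using p_ser_deriv[OF assms(1,2), of x \<Lambda>] u_ser_deriv[OF assms(1,2), of x \<Lambda>] assms(3)
  by (auto simp: at_within_Icc_at)

text \<open>Used for both fundamental solutions, this gives uniqueness without a Gronwall estimate.\<close>

lemma wronskian:
  fixes \<Lambda> :: "'a::{real_normed_field, banach}" and Y v :: "real \<Rightarrow> 'a"
  assumes ab: "0 \<le> \<alpha>" "0 \<le> \<beta>"
    and cont: "continuous_on {0..l} Y" "continuous_on {0..l} v"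
    and Y: "\<And>x. x \<in> {0<..<l} \<Longrightarrow> (Y has_vector_derivative v x / of_real ((r x)\<^sup>2)) (at x)"
    and v: "\<And>x. x \<in> {0<..<l} \<Longrightarrow> (v has_vector_derivative \<Lambda> * of_real ((r x)\<^sup>2) * Y x) (at x)"
    and x: "x \<in> {0..l}"
  shows "v x * p_ser \<alpha> \<beta> \<Lambda> x - Y x * u_ser \<alpha> \<beta> \<Lambda> x = v 0 * of_real \<alpha> - Y 0 * of_real \<beta>"
proof -
  have "v x * p_ser \<alpha> \<beta> \<Lambda> x - Y x * u_ser \<alpha> \<beta> \<Lambda> x
      = v 0 * p_ser \<alpha> \<beta> \<Lambda> 0 - Y 0 * u_ser \<alpha> \<beta> \<Lambda> 0"
  proof (rule zero_derivative_imp_const[OF _ _ x])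
    show "continuous_on {0..l} (\<lambda>x. v x * p_ser \<alpha> \<beta> \<Lambda> x - Y x * u_ser \<alpha> \<beta> \<Lambda> x)"
      by (intro continuous_intros cont continuous_p_ser ab)
    fix y assume y: "y \<in> {0<..<l}"
    have "((\<lambda>x. v x * p_ser \<alpha> \<beta> \<Lambda> x - Y x * u_ser \<alpha> \<beta> \<Lambda> x) has_vector_derivative
       (v y * (u_ser \<alpha> \<beta> \<Lambda> y / of_real ((r y)\<^sup>2)) + \<Lambda> * of_real ((r y)\<^sup>2) * Y y * p_ser \<alpha> \<beta> \<Lambda> y)
       - (Y y * (\<Lambda> * of_real ((r y)\<^sup>2) * p_ser \<alpha> \<beta> \<Lambda> y) + v y / of_real ((r y)\<^sup>2) * u_ser \<alpha> \<beta> \<Lambda> y)) (at y)"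
      by (intro has_vector_derivative_diff has_vector_derivative_mult Y[OF y] v[OF y] p_ser_deriv_at[OF ab y])
    then show "((\<lambda>x. v x * p_ser \<alpha> \<beta> \<Lambda> x - Y x * u_ser \<alpha> \<beta> \<Lambda> x) has_vector_derivative 0) (at y)"
      by (simp add: algebra_simps)
  qed
  then show ?thesis by (simp add: p_ser_initial[OF ab])
qed

lemma wronskian_fundamental:
  fixes \<Lambda> :: "'a::{real_normed_field, banach}"
  assumes "x \<in> {0..l}"
  shows "u_ser 0 1 \<Lambda> x * p_ser 1 0 \<Lambda> x - p_ser 0 1 \<Lambda> x * u_ser 1 0 \<Lambda> x = 1"
  using wronskian[of 1 0 "p_ser 0 1 \<Lambda>" "u_ser 0 1 \<Lambda>" \<Lambda> x,
      OF _ _ continuous_p_ser p_ser_deriv_at assms]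
  by (simp add: p_ser_initial)

text \<open>The Wronskians of the given solution with the two fundamental ones are linear equations
  for \<open>Y x\<close> and \<open>v x\<close>. Their determinant is one by
  \<open>wronskian_fundamental\<close>, and Cramer's rule solves them.\<close>

lemma general_solution:
  fixes \<Lambda> :: "'a::{real_normed_field, banach}" and Y v :: "real \<Rightarrow> 'a"
  assumes cont: "continuous_on {0..l} Y" "continuous_on {0..l} v"
    and Y: "\<And>x. x \<in> {0<..<l} \<Longrightarrow> (Y has_vector_derivative v x / of_real ((r x)\<^sup>2)) (at x)"
    and v: "\<And>x. x \<in> {0<..<l} \<Longrightarrow> (v has_vector_derivative \<Lambda> * of_real ((r x)\<^sup>2) * Y x) (at x)"
    and x: "x \<in> {0..l}"
  shows "Y x = Y 0 * p_ser 1 0 \<Lambda> x + v 0 * p_ser 0 1 \<Lambda> x"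
    and "v x = Y 0 * u_ser 1 0 \<Lambda> x + v 0 * u_ser 0 1 \<Lambda> x"
proof -
  have 1: "v x * p_ser 1 0 \<Lambda> x - Y x * u_ser 1 0 \<Lambda> x = v 0"
    using wronskian[OF _ _ cont Y v x, of 1 0] by simp
  have 2: "v x * p_ser 0 1 \<Lambda> x - Y x * u_ser 0 1 \<Lambda> x = - Y 0"
    using wronskian[OF _ _ cont Y v x, of 0 1] by simp
  have 3: "u_ser 0 1 \<Lambda> x * p_ser 1 0 \<Lambda> x - p_ser 0 1 \<Lambda> x * u_ser 1 0 \<Lambda> x = 1"
    by (rule wronskian_fundamental[OF x])
  have Y0: "Y 0 = Y x * u_ser 0 1 \<Lambda> x - v x * p_ser 0 1 \<Lambda> x"
    using 2 by (simp add: algebra_simps)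
  have "Y 0 * p_ser 1 0 \<Lambda> x + v 0 * p_ser 0 1 \<Lambda> x
      = Y x * (u_ser 0 1 \<Lambda> x * p_ser 1 0 \<Lambda> x - p_ser 0 1 \<Lambda> x * u_ser 1 0 \<Lambda> x)"
    unfolding Y0 1[symmetric] by (simp add: algebra_simps)
  then show "Y x = Y 0 * p_ser 1 0 \<Lambda> x + v 0 * p_ser 0 1 \<Lambda> x" by (simp add: 3)
  have "Y 0 * u_ser 1 0 \<Lambda> x + v 0 * u_ser 0 1 \<Lambda> x
      = v x * (u_ser 0 1 \<Lambda> x * p_ser 1 0 \<Lambda> x - p_ser 0 1 \<Lambda> x * u_ser 1 0 \<Lambda> x)"
    unfolding Y0 1[symmetric] by (simp add: algebra_simps)
  then show "v x = Y 0 * u_ser 1 0 \<Lambda> x + v 0 * u_ser 0 1 \<Lambda> x" by (simp add: 3)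
qed

end

section \<open>The regular solution and the pressure at the lips\<close>

lemma absolutely_continuous_fun_on_cong:
  fixes f g :: "real \<Rightarrow> 'a::real_normed_vector"
  assumes "absolutely_continuous_fun_on a b f" "\<And>x. x \<in> {a..b} \<Longrightarrow> f x = g x"
  shows "absolutely_continuous_fun_on a b g"
proof (rule absolutely_continuous_fun_on_dominated[OF assms(1) assms(1), where C = 1])
  fix u v :: real assume "a \<le> u" "u \<le> v" "v \<le> b"
  then show "norm (g v - g u) \<le> 1 * (norm (f v - f u) + norm (f v - f u) + (v - u))"
    using assms(2)[of u] assms(2)[of v] by simp
qed

lemma dx_eqI:
  assumes "0 < l" "x \<in> {0..l}" "(f has_vector_derivative D) (at x within {0..l})"
  shows "dx l f x = D"
  unfolding dx_def using vector_derivative_within_cbox[of 0 l x f D] assms by simp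

lemma dx_cong:
  assumes "0 < l" "x \<in> {0..l}" "\<And>x. x \<in> {0..l} \<Longrightarrow> f x = g x"
    "(g has_vector_derivative D) (at x within {0..l})"
  shows "dx l f x = D"
  by (rule dx_eqI[OF assms(1,2) has_vector_derivative_transform[OF assms(2) _ assms(4)]]) (use assms(3) in auto)

locale tract =
  fixes l :: real and r :: "real \<Rightarrow> real"
  assumes vocal_tract: "vocal_tract l r"
begin

lemma l_pos: "0 < l" and r_diff: "r differentiable_on {0..l}"
  and dr_cont: "continuous_on {0..l} (dx l r)"
  and dr_ac: "absolutely_continuous_fun_on 0 l (dx l r)"
  and dr_AE: "AE x in lebesgue. x \<in> {0<..<l} \<longrightarrow> dx l r differentiable (at x)"
  and r_pos: "x \<in> {0..l} \<Longrightarrow> 0 < r x"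
  using vocal_tract unfolding vocal_tract_def class_A_def by auto

sublocale weight l r
  using l_pos r_pos differentiable_imp_continuous_on[OF r_diff] by unfold_locales auto

abbreviation "r0 \<equiv> r 0"
abbreviation "rl \<equiv> r l"

lemma ends: "0 \<in> {0..l}" "l \<in> {0..l}" "0 < r0" "0 < rl"
  using l_pos r_pos by auto

lemma dx_works:
  assumes "f differentiable_on {0..l}" "x \<in> {0..l}"
  shows "(f has_vector_derivative dx l f x) (at x within {0..l})"
  using assms unfolding dx_def differentiable_on_def by (auto simp: vector_derivative_works)

lemma r_deriv: "x \<in> {0..l} \<Longrightarrow> (r has_vector_derivative dx l r x) (at x within {0..l})"
  by (rule dx_works[OF r_diff])

lemma dx_interior: "x \<in> {0<..<l} \<Longrightarrow> dx l f x = vector_derivative f (at x)"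
  by (simp add: dx_def at_within_Icc_at)

lemma of_real_deriv:
  assumes "(f has_vector_derivative D) F"
  shows "((\<lambda>x. of_real (f x) :: 'a::real_normed_algebra_1) has_vector_derivative of_real D) F"
  by (rule has_vector_derivative_of_real) (use assms in \<open>simp add: has_real_derivative_iff_has_vector_derivative\<close>)

abbreviation p1 :: "complex \<Rightarrow> real \<Rightarrow> complex" where "p1 k \<equiv> p_ser 1 0 (- k\<^sup>2)"
abbreviation u1 :: "complex \<Rightarrow> real \<Rightarrow> complex" where "u1 k \<equiv> u_ser 1 0 (- k\<^sup>2)"
abbreviation p2 :: "complex \<Rightarrow> real \<Rightarrow> complex" where "p2 k \<equiv> p_ser 0 1 (- k\<^sup>2)"
abbreviation u2 :: "complex \<Rightarrow> real \<Rightarrow> complex" where "u2 k \<equiv> u_ser 0 1 (- k\<^sup>2)"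

text \<open>The prescribed slope r_0'/r_0 of \<phi> says exactly that u vanishes at 0. Therefore
  only the first fundamental solution occurs.\<close>

definition phi_ser :: "complex \<Rightarrow> real \<Rightarrow> complex" where
  "phi_ser k x = of_real (r x / r0) * p1 k x"

definition phi_ser' :: "complex \<Rightarrow> real \<Rightarrow> complex" where
  "phi_ser' k x = of_real (dx l r x / r0) * p1 k x + of_real (1 / (r0 * r x)) * u1 k x"

lemma phi_ser_deriv:
  assumes x: "x \<in> {0..l}"
  shows "(phi_ser k has_vector_derivative phi_ser' k x) (at x within {0..l})"
proof -
  have "((\<lambda>x. of_real (r x / r0) * p1 k x) has_vector_derivative
      (of_real (r x / r0) * (u1 k x / of_real ((r x)\<^sup>2)) + of_real (dx l r x / r0) * p1 k x)) (at x within {0..l})"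
    using x by (intro has_vector_derivative_mult of_real_deriv has_vector_derivative_divide r_deriv p_ser_deriv) auto
  moreover have "of_real (r x / r0) * (u1 k x / of_real ((r x)\<^sup>2)) + of_real (dx l r x / r0) * p1 k x = phi_ser' k x"
    unfolding phi_ser'_def using r_nonzero[OF x] ends by (simp add: field_simps power2_eq_square)
  ultimately show ?thesis unfolding phi_ser_def by simp
qed

lemma r_ac: "absolutely_continuous_fun_on 0 l r"
  by (rule absolutely_continuous_fun_on_C1[OF r_deriv dr_cont])

text \<open>The factor r' is absolutely continuous by the definition of the class; every other
  factor is continuously differentiable.\<close>

lemma phi_ser'_ac: "absolutely_continuous_fun_on 0 l (phi_ser' k)"
proof -
  have inv: "((\<lambda>x. of_real (1 / (r0 * r x)) :: complex) has_vector_derivative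
      of_real (- dx l r x / (r0 * (r x)\<^sup>2))) (at x within {0..l})" if "x \<in> {0..l}" for x
  proof (rule of_real_deriv)
    have "(r has_real_derivative dx l r x) (at x within {0..l})"
      using r_deriv[OF that] by (simp add: has_real_derivative_iff_has_vector_derivative)
    then have "((\<lambda>x. 1 / (r0 * r x)) has_real_derivative - dx l r x / (r0 * (r x)\<^sup>2)) (at x within {0..l})"
      using r_nonzero[OF that] ends by (auto intro!: derivative_eq_intros simp: field_simps power2_eq_square)
    then show "((\<lambda>x. 1 / (r0 * r x)) has_vector_derivative - dx l r x / (r0 * (r x)\<^sup>2)) (at x within {0..l})"
      by (simp add: has_real_derivative_iff_has_vector_derivative)
  qed
  have cp: "continuous_on {0..l} (\<lambda>x. u1 k x / of_real ((r x)\<^sup>2))"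
    using r_nonzero by (intro continuous_intros continuous_p_ser r_cont) auto
  have cu: "continuous_on {0..l} (\<lambda>x. - k\<^sup>2 * of_real ((r x)\<^sup>2) * p1 k x)"
    by (intro continuous_intros continuous_p_ser r_cont) auto
  have ci: "continuous_on {0..l} (\<lambda>x. of_real (- dx l r x / (r0 * (r x)\<^sup>2)) :: complex)"
    using r_nonzero ends by (intro continuous_intros r_cont dr_cont) auto
  have cr: "continuous_on {0..l} (\<lambda>x. of_real (dx l r x / r0) :: complex)"
    using ends by (intro continuous_intros dr_cont) auto
  have rs: "absolutely_continuous_fun_on 0 l (\<lambda>x. of_real (dx l r x / r0) :: complex)"
    by (rule absolutely_continuous_fun_on_cong[OF absolutely_continuous_fun_on_of_real[OF
        absolutely_continuous_fun_on_mult[OF absolutely_continuous_fun_on_const[of 0 l "1 / r0"] dr_ac]]]) simp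
  show ?thesis
    unfolding phi_ser'_def
    by (intro absolutely_continuous_fun_on_add absolutely_continuous_fun_on_mult rs
        absolutely_continuous_fun_on_C1[OF inv ci]
        absolutely_continuous_fun_on_C1[OF p_ser_deriv cp] absolutely_continuous_fun_on_C1[OF u_ser_deriv cu]) auto
qed

text \<open>The two terms containing the product of r' and u cancel. What remains is (r''/r_0) p,
  which is the potential times \<phi>, and the term with -k^2.\<close>

lemma phi_ser'_deriv:
  assumes x: "x \<in> {0<..<l}" and d: "dx l r differentiable (at x)"
  shows "(phi_ser' k has_vector_derivative
    of_real (potential l r x) * phi_ser k x - k\<^sup>2 * phi_ser k x) (at x)"
proof -
  have xl: "x \<in> {0..l}" using x by auto
  define q where "q = dx l (dx l r) x"
  have "(dx l r has_vector_derivative q) (at x)"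
    using d unfolding q_def dx_interior[OF x] by (simp add: vector_derivative_works)
  then have 1: "((\<lambda>x. of_real (dx l r x / r0) :: complex) has_vector_derivative of_real (q / r0)) (at x)"
    by (intro of_real_deriv has_vector_derivative_divide)
  have "(r has_real_derivative dx l r x) (at x)"
    using r_deriv[OF xl] x by (simp add: has_real_derivative_iff_has_vector_derivative at_within_Icc_at)
  then have "((\<lambda>x. 1 / (r0 * r x)) has_real_derivative - dx l r x / (r0 * (r x)\<^sup>2)) (at x)"
    using r_nonzero[OF xl] ends by (auto intro!: derivative_eq_intros simp: field_simps power2_eq_square)
  then have 2: "((\<lambda>x. of_real (1 / (r0 * r x)) :: complex) has_vector_derivative
      of_real (- dx l r x / (r0 * (r x)\<^sup>2))) (at x)"
    by (intro of_real_deriv) (simp add: has_real_derivative_iff_has_vector_derivative)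
  have "(phi_ser' k has_vector_derivative
      (of_real (dx l r x / r0) * (u1 k x / of_real ((r x)\<^sup>2)) + of_real (q / r0) * p1 k x)
    + (of_real (1 / (r0 * r x)) * (- k\<^sup>2 * of_real ((r x)\<^sup>2) * p1 k x)
       + of_real (- dx l r x / (r0 * (r x)\<^sup>2)) * u1 k x)) (at x)"
    unfolding phi_ser'_def
    by (intro has_vector_derivative_add has_vector_derivative_mult 1 2 p_ser_deriv_at x) auto
  moreover have "(of_real (dx l r x / r0) * (u1 k x / of_real ((r x)\<^sup>2)) + of_real (q / r0) * p1 k x)
    + (of_real (1 / (r0 * r x)) * (- k\<^sup>2 * of_real ((r x)\<^sup>2) * p1 k x)
       + of_real (- dx l r x / (r0 * (r x)\<^sup>2)) * u1 k x)
    = of_real (potential l r x) * phi_ser k x - k\<^sup>2 * phi_ser k x"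
    unfolding phi_ser_def potential_def q_def[symmetric]
    using r_nonzero[OF xl] ends by (simp add: field_simps power2_eq_square)
  ultimately show ?thesis by simp
qed

lemma regular_solution_phi_ser:
  assumes eq: "\<And>x. x \<in> {0..l} \<Longrightarrow> \<psi> x = phi_ser k x"
  shows "regular_solution l r k \<psi>"
proof -
  have d: "(\<psi> has_vector_derivative phi_ser' k x) (at x within {0..l})" if "x \<in> {0..l}" for x
    by (rule has_vector_derivative_transform[OF that _ phi_ser_deriv[OF that]]) (use eq in auto)
  have dd: "dx l \<psi> x = phi_ser' k x" if "x \<in> {0..l}" for x
    by (rule dx_eqI[OF l_pos that d[OF that]])
  show ?thesis
    unfolding regular_solution_def
  proof (intro conjI)
    show "\<psi> differentiable_on {0..l}"
      using d unfolding differentiable_on_def by (blast intro: differentiableI_vector)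
    show "absolutely_continuous_fun_on 0 l (dx l \<psi>)"
      by (rule absolutely_continuous_fun_on_cong[OF phi_ser'_ac]) (simp add: dd)
    show "\<psi> 0 = 1"
      using eq[of 0] ends by (simp add: phi_ser_def p_ser_initial)
    show "dx l \<psi> 0 = of_real (dx l r 0 / r0)"
      using dd[of 0] ends by (simp add: phi_ser'_def p_ser_initial)
    show "AE x in lebesgue. x \<in> {0<..<l} \<longrightarrow> (\<exists>D. (dx l \<psi> has_vector_derivative D) (at x) \<and>
        - D + complex_of_real (potential l r x) * \<psi> x = k\<^sup>2 * \<psi> x)"
      using dr_AE
    proof eventually_elim
      case (elim x)
      show ?case
      proof (intro impI exI conjI)
        assume x: "x \<in> {0<..<l}"
        show "(dx l \<psi> has_vector_derivative
            complex_of_real (potential l r x) * phi_ser k x - k\<^sup>2 * phi_ser k x) (at x)"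
          by (rule has_vector_derivative_transform_within_open[OF phi_ser'_deriv[OF x], where S = "{0<..<l}"])
            (use elim x dd in auto)
        show "- (complex_of_real (potential l r x) * phi_ser k x - k\<^sup>2 * phi_ser k x)
            + complex_of_real (potential l r x) * \<psi> x = k\<^sup>2 * \<psi> x"
          using eq[of x] x by simp
      qed
    qed
  qed
qed

text \<open>The almost-everywhere equation is first upgraded: for v = r^2 (\<psi>/r)' it reads v' =
  -k^2 r \<psi>, with continuous right-hand side, and absolute continuity makes it hold everywhere.
  Then \<open>general_solution\<close> applies to \<psi>/r.\<close>

lemma regular_solution_unique:
  assumes "regular_solution l r k \<psi>" and x: "x \<in> {0..l}"
  shows "\<psi> x = phi_ser k x"
proof -
  have diff: "\<psi> differentiable_on {0..l}" and ac: "absolutely_continuous_fun_on 0 l (dx l \<psi>)"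
    and ae: "AE x in lebesgue. x \<in> {0<..<l} \<longrightarrow> (\<exists>D. (dx l \<psi> has_vector_derivative D) (at x) \<and>
        - D + of_real (potential l r x) * \<psi> x = k\<^sup>2 * \<psi> x)"
    and init: "\<psi> 0 = 1" "dx l \<psi> 0 = of_real (dx l r 0 / r0)"
    using assms(1) unfolding regular_solution_def by auto
  have psi_deriv: "(\<psi> has_vector_derivative dx l \<psi> x) (at x within {0..l})" if "x \<in> {0..l}" for x
    by (rule dx_works[OF diff that])
  have psi_cont: "continuous_on {0..l} \<psi>" by (rule differentiable_imp_continuous_on[OF diff])
  have dpsi_cont: "continuous_on {0..l} (dx l \<psi>)" by (rule absolutely_continuous_fun_on_imp_continuous_on[OF ac])
  define Y where "Y x = \<psi> x / of_real (r x)" for x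
  \<comment> \<open>This is r^2 times the derivative of \<open>Y\<close>. In its own derivative the
    terms r' \<psi>' cancel and the potential removes r'' \<psi>.\<close>
  define v where "v x = of_real (r x) * dx l \<psi> x - of_real (dx l r x) * \<psi> x" for x
  define g where "g x = - k\<^sup>2 * of_real (r x) * \<psi> x" for x
  have g_cont: "continuous_on {0..l} g"
    unfolding g_def by (intro continuous_intros r_cont psi_cont)
  have int: "((\<lambda>u. integral {0..u} g) has_vector_derivative g x) (at x within {0..l})" if "x \<in> {0..l}" for x
    by (rule integral_has_vector_derivative[OF g_cont that])
  have w_ac: "absolutely_continuous_fun_on 0 l (\<lambda>x. v x - integral {0..x} g)"
    unfolding v_def
    by (intro absolutely_continuous_fun_on_diff absolutely_continuous_fun_on_mult ac
        absolutely_continuous_fun_on_of_real r_ac dr_ac absolutely_continuous_fun_on_C1[OF psi_deriv dpsi_cont]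
        absolutely_continuous_fun_on_C1[OF int g_cont])
  have "AE x in lebesgue. x \<in> {0<..<l} \<longrightarrow> (v has_vector_derivative g x) (at x)"
    using dr_AE ae
  proof eventually_elim
    case (elim x)
    show ?case
    proof
      assume x: "x \<in> {0<..<l}"
      then have xl: "x \<in> {0..l}" by auto
      from elim x obtain D where D: "(dx l \<psi> has_vector_derivative D) (at x)"
        "- D + of_real (potential l r x) * \<psi> x = k\<^sup>2 * \<psi> x" by auto
      have q: "(dx l r has_vector_derivative dx l (dx l r) x) (at x)"
        using elim(1) x unfolding dx_interior[OF x] by (simp add: vector_derivative_works)
      have at: "(r has_vector_derivative dx l r x) (at x)" "(\<psi> has_vector_derivative dx l \<psi> x) (at x)"
        using r_deriv[OF xl] psi_deriv[OF xl] x by (simp_all add: at_within_Icc_at)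
      have "(v has_vector_derivative
          (of_real (r x) * D + of_real (dx l r x) * dx l \<psi> x)
        - (of_real (dx l r x) * dx l \<psi> x + of_real (dx l (dx l r) x) * \<psi> x)) (at x)"
        unfolding v_def
        by (intro has_vector_derivative_diff has_vector_derivative_mult of_real_deriv at q D)
      moreover have "D = of_real (potential l r x) * \<psi> x - k\<^sup>2 * \<psi> x"
        using D(2) by (simp add: algebra_simps)
      ultimately show "(v has_vector_derivative g x) (at x)"
        using r_nonzero[OF xl] by (simp add: g_def potential_def algebra_simps)
    qed
  qed
  then obtain N0 where N0: "negligible N0"
    "\<And>x. x \<notin> N0 \<Longrightarrow> x \<in> {0<..<l} \<Longrightarrow> (v has_vector_derivative g x) (at x)"
    unfolding eventually_ae_filter by (auto simp: negligible_iff_null_sets)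
  define N where "N = N0 \<union> {0, l}"
  have N: "negligible N"
    unfolding N_def by (rule negligible_Un[OF N0(1)]) auto
  \<comment> \<open>\<open>v\<close> minus the integral of \<open>g\<close> is absolutely continuous
    with zero derivative off the null set \<open>N\<close>, hence constant. The endpoints belong to
    \<open>N\<close> because derivatives are known as two-sided ones only inside.\<close>
  have v_eq: "v x = v 0 + integral {0..x} g" if x: "x \<in> {0..l}" for x
  proof -
    have "v x - integral {0..x} g = v 0 - integral {0..0} g"
    proof (rule absolutely_continuous_zero_derivative[OF _ _ N])
      show "absolutely_continuous_fun_on 0 x (\<lambda>x. v x - integral {0..x} g)"
        by (rule absolutely_continuous_fun_on_subset[OF w_ac]) (use x in auto)
      fix y assume y: "y \<in> {0..x} - N"
      then have yl: "y \<in> {0<..<l}" "y \<in> {0..l}" using x by (auto simp: N_def)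
      have "(v has_vector_derivative g y) (at y)" by (rule N0(2)) (use y yl in \<open>auto simp: N_def\<close>)
      moreover have "((\<lambda>u. integral {0..u} g) has_vector_derivative g y) (at y)"
        using int[OF yl(2)] yl(1) by (simp add: at_within_Icc_at)
      ultimately have "((\<lambda>x. v x - integral {0..x} g) has_vector_derivative g y - g y) (at y)"
        by (rule has_vector_derivative_diff)
      then show "((\<lambda>x. v x - integral {0..x} g) has_vector_derivative 0) (at y within {0..x})"
        by (auto intro: has_vector_derivative_at_within)
    qed (use x in auto)
    then show ?thesis by (simp add: algebra_simps)
  qed
  have v_deriv: "(v has_vector_derivative g x) (at x within {0..l})" if x: "x \<in> {0..l}" for x
  proof (rule has_vector_derivative_transform[OF x v_eq])
    show "((\<lambda>x. v 0 + integral {0..x} g) has_vector_derivative g x) (at x within {0..l})"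
      using has_vector_derivative_add[OF has_vector_derivative_const int[OF x]] by simp
  qed
  have "Y x = Y 0 * p1 k x + v 0 * p2 k x"
  proof (rule general_solution(1)[OF _ _ _ _ x])
    show "continuous_on {0..l} Y"
      unfolding Y_def using r_nonzero by (intro continuous_intros psi_cont r_cont) auto
    show "continuous_on {0..l} v"
      unfolding v_def by (intro continuous_intros psi_cont r_cont dpsi_cont dr_cont)
    fix x assume x: "x \<in> {0<..<l}"
    then have xl: "x \<in> {0..l}" by auto
    show "(v has_vector_derivative - k\<^sup>2 * of_real ((r x)\<^sup>2) * Y x) (at x)"
      using v_deriv[OF xl] x r_nonzero[OF xl]
      by (simp add: at_within_Icc_at g_def Y_def power2_eq_square field_simps)
    have "(r has_real_derivative dx l r x) (at x)"
      using r_deriv[OF xl] x by (simp add: has_real_derivative_iff_has_vector_derivative at_within_Icc_at)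
    then have "((\<lambda>x. inverse (r x)) has_real_derivative - dx l r x / (r x)\<^sup>2) (at x)"
      using r_nonzero[OF xl] by (auto intro!: derivative_eq_intros simp: field_simps power2_eq_square)
    then have "((\<lambda>x. of_real (inverse (r x)) :: complex) has_vector_derivative of_real (- dx l r x / (r x)\<^sup>2)) (at x)"
      by (rule has_vector_derivative_of_real)
    moreover have "(\<psi> has_vector_derivative dx l \<psi> x) (at x)"
      using psi_deriv[OF xl] x by (simp add: at_within_Icc_at)
    ultimately have "((\<lambda>x. \<psi> x * of_real (inverse (r x))) has_vector_derivative
        \<psi> x * of_real (- dx l r x / (r x)\<^sup>2) + dx l \<psi> x * of_real (inverse (r x))) (at x)"
      by (intro has_vector_derivative_mult)
    moreover have "\<psi> x * of_real (- dx l r x / (r x)\<^sup>2) + dx l \<psi> x * of_real (inverse (r x))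
      = v x / of_real ((r x)\<^sup>2)"
      using r_nonzero[OF xl] by (simp add: v_def field_simps power2_eq_square)
    ultimately show "(Y has_vector_derivative v x / of_real ((r x)\<^sup>2)) (at x)"
      by (simp add: Y_def[abs_def] field_simps)
  qed
  moreover have "v 0 = 0" "Y 0 = 1 / of_real r0"
    using init ends by (simp_all add: v_def Y_def)
  ultimately show ?thesis
    using r_nonzero[OF x] ends by (simp add: Y_def phi_ser_def field_simps)
qed

lemma phi_eq: "phi l r k = (\<lambda>x. if x \<in> {0..l} then phi_ser k x else 0)"
  unfolding phi_def
proof (rule the_equality)
  show "regular_solution l r k (\<lambda>x. if x \<in> {0..l} then phi_ser k x else 0) \<and>
    (\<forall>x. x \<notin> {0..l} \<longrightarrow> (if x \<in> {0..l} then phi_ser k x else 0) = 0)"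
    by (intro conjI regular_solution_phi_ser) auto
  fix \<psi> assume "regular_solution l r k \<psi> \<and> (\<forall>x. x \<notin> {0..l} \<longrightarrow> \<psi> x = 0)"
  then show "\<psi> = (\<lambda>x. if x \<in> {0..l} then phi_ser k x else 0)"
    by (intro ext) (auto simp del: atLeastAtMost_iff intro: regular_solution_unique)
qed

lemma phi_end: "phi l r k l = of_real (rl / r0) * p1 k l"
  using ends by (simp add: phi_eq phi_ser_def)

lemma dx_phi_end: "dx l (phi l r k) l = of_real (dx l r l / r0) * p1 k l + of_real (1 / (r0 * rl)) * u1 k l"
  unfolding phi_ser'_def[symmetric]
  by (rule dx_cong[OF l_pos _ _ phi_ser_deriv]) (use ends in \<open>auto simp: phi_eq\<close>)

text \<open>The terms with r_l' cancel. Thus G carries no explicit trace of r_l', which later has to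
  be recovered from asymptotics.\<close>

lemma G_eq: "G_fun l r k = - (impedance rl k * u1 k l / of_real rl + \<i> * k * of_real rl * p1 k l) / of_real r0"
  using ends by (simp add: G_fun_def phi_end dx_phi_end field_simps)

text \<open>The initial slope prescribes the flux \<open>v 0\<close>, and the Wronskian with the
  first fundamental solution relates it to \<open>v l\<close> and \<open>P l\<close>; the impedance
  condition eliminates \<open>v l\<close>. Solvability is then the nonvanishing of one number
  \<open>d\<close>, a multiple of G / z.\<close>

lemma pressure_end_eq:
  assumes z: "impedance rl k \<noteq> 0" and G: "G_fun l r k \<noteq> 0"
  shows "pressure_end c \<mu> l r k
    = - (\<i> * k * of_real c * of_real \<mu> * impedance rl k) / (of_real (pi * r0 * rl) * G_fun l r k)"
proof -
  define z where "z = impedance rl k"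
  \<comment> \<open>\<beta> is r_0^2 times the prescribed slope at 0, \<open>d\<close> is the
    left-hand side of the impedance condition for the first fundamental solution, and \<alpha> is
    the value at 0 that makes the combination satisfy this condition.\<close>
  define \<beta> where "\<beta> = - (\<i> * k * of_real c * of_real \<mu>) / of_real pi"
  define d where "d = u1 k l / of_real (rl\<^sup>2) + \<i> * k / z * p1 k l"
  define \<alpha> where "\<alpha> = - \<beta> * (u2 k l / of_real (rl\<^sup>2) + \<i> * k / z * p2 k l) / d"
  have z0: "z \<noteq> 0" using assms by (simp add: z_def)
  have d_eq: "d = - (of_real r0 * G_fun l r k) / (z * of_real rl)"
    unfolding d_def G_eq z_def[symmetric] using ends z0 by (simp add: field_simps power2_eq_square)
  have d0: "d \<noteq> 0" unfolding d_eq using G z0 ends by simp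
  have dr: "d * of_real (rl\<^sup>2) = u1 k l + \<i> * k / z * p1 k l * of_real (rl\<^sup>2)"
    unfolding d_def using ends by (simp add: distrib_right)
  have uniq: "P x = \<alpha> * p1 k x + \<beta> * p2 k x" "P l * d * of_real (rl\<^sup>2) = - \<beta>"
    if P: "pressure_solution c \<mu> l r k P" and x: "x \<in> {0..l}" for P x
  proof -
    define v where "v x = of_real ((r x)\<^sup>2) * dx l P x" for x
    have diff: "P differentiable_on {0..l}" and cont: "continuous_on {0..l} (dx l P)"
      and ode: "\<forall>x\<in>{0<..<l}. \<exists>D. (v has_vector_derivative D) (at x) \<and> D + k\<^sup>2 * of_real ((r x)\<^sup>2) * P x = 0"
      and bc: "dx l P 0 = - (\<i> * k * of_real c * of_real \<mu>) / of_real (pi * (r 0)\<^sup>2)"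
        "dx l P l + \<i> * k / z * P l = 0"
      using P unfolding pressure_solution_def v_def z_def by auto
    have gen: "P x = P 0 * p1 k x + v 0 * p2 k x" "v x = P 0 * u1 k x + v 0 * u2 k x"
      and wr: "v x * p1 k x - P x * u1 k x = v 0"
      if x: "x \<in> {0..l}" for x
    proof -
      have 1: "continuous_on {0..l} P" by (rule differentiable_imp_continuous_on[OF diff])
      have 2: "continuous_on {0..l} v" unfolding v_def by (intro continuous_intros r_cont cont)
      have 3: "(P has_vector_derivative v x / of_real ((r x)\<^sup>2)) (at x)" if "x \<in> {0<..<l}" for x
        using dx_works[OF diff, of x] that r_nonzero[of x] by (simp add: v_def at_within_Icc_at)
      have 4: "(v has_vector_derivative - k\<^sup>2 * of_real ((r x)\<^sup>2) * P x) (at x)" if "x \<in> {0<..<l}" for x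
        using ode that by (auto simp: eq_neg_iff_add_eq_0[symmetric])
      show "P x = P 0 * p1 k x + v 0 * p2 k x" "v x = P 0 * u1 k x + v 0 * u2 k x"
        by (rule general_solution[OF 1 2 3 4 x]; assumption)+
      show "v x * p1 k x - P x * u1 k x = v 0"
        using wronskian[OF _ _ 1 2 3 4 x, of 1 0] by simp
    qed
    have v0: "v 0 = \<beta>" using bc(1) ends by (simp add: v_def \<beta>_def)
    have vl: "v l = - of_real (rl\<^sup>2) * (\<i> * k / z * P l)"
      using bc(2) by (simp add: v_def add_eq_0_iff)
    \<comment> \<open>Inserting the impedance condition into the Wronskian yields \<open>P l\<close>
      directly, without the value of P at 0.\<close>
    have "P l * (d * of_real (rl\<^sup>2)) = - (v l * p1 k l - P l * u1 k l)"
      unfolding vl dr by (simp add: algebra_simps)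
    then show "P l * d * of_real (rl\<^sup>2) = - \<beta>"
      unfolding wr[OF ends(2)] v0 by (simp add: mult.assoc)
    have "P 0 * d = \<alpha> * d"
    proof -
      have "of_real (rl\<^sup>2) * (P 0 * d + \<beta> * (u2 k l / of_real (rl\<^sup>2) + \<i> * k / z * p2 k l))
          = (P 0 * u1 k l + v 0 * u2 k l) + of_real (rl\<^sup>2) * (\<i> * k / z * (P 0 * p1 k l + v 0 * p2 k l))"
        unfolding d_def v0 using ends by (simp add: algebra_simps)
      also have "\<dots> = v l + of_real (rl\<^sup>2) * (\<i> * k / z * P l)"
        by (simp only: gen[OF ends(2), symmetric])
      also have "\<dots> = 0" by (simp add: vl)
      finally have "of_real (rl\<^sup>2) * (P 0 * d + \<beta> * (u2 k l / of_real (rl\<^sup>2) + \<i> * k / z * p2 k l)) = 0" .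
      then show ?thesis using d0 ends by (simp add: \<alpha>_def add_eq_0_iff)
    qed
    then have "P 0 = \<alpha>" using d0 by simp
    then show "P x = \<alpha> * p1 k x + \<beta> * p2 k x" using gen(1)[OF x] v0 by simp
  qed
  have ex: "pressure_solution c \<mu> l r k (\<lambda>x. \<alpha> * p1 k x + \<beta> * p2 k x)"
  proof -
    let ?P = "\<lambda>x. \<alpha> * p1 k x + \<beta> * p2 k x"
    have der: "(?P has_vector_derivative (\<alpha> * u1 k x + \<beta> * u2 k x) / of_real ((r x)\<^sup>2)) (at x within {0..l})"
      if "x \<in> {0..l}" for x
      unfolding add_divide_distrib times_divide_eq_right[symmetric]
      using that by (intro has_vector_derivative_add has_vector_derivative_mult_right p_ser_deriv) auto
    have dxP: "dx l ?P x = (\<alpha> * u1 k x + \<beta> * u2 k x) / of_real ((r x)\<^sup>2)" if "x \<in> {0..l}" for x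
      by (rule dx_eqI[OF l_pos that der[OF that]])
    show ?thesis
      unfolding pressure_solution_def z_def[symmetric]
    proof (intro conjI ballI exI)
      show "?P differentiable_on {0..l}"
        using der unfolding differentiable_on_def by (blast intro: differentiableI_vector)
      show "continuous_on {0..l} (dx l ?P)"
      proof (rule continuous_on_eq[OF _ dxP[symmetric]])
        show "continuous_on {0..l} (\<lambda>x. (\<alpha> * u1 k x + \<beta> * u2 k x) / of_real ((r x)\<^sup>2))"
          using r_nonzero by (intro continuous_intros continuous_p_ser r_cont) auto
      qed
      show "dx l ?P 0 = - (\<i> * k * of_real c * of_real \<mu>) / of_real (pi * (r 0)\<^sup>2)"
        using dxP[OF ends(1)] ends by (simp add: p_ser_initial \<beta>_def)
      have "dx l ?P l + \<i> * k / z * ?P l = \<alpha> * d + \<beta> * (u2 k l / of_real (rl\<^sup>2) + \<i> * k / z * p2 k l)"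
        unfolding dxP[OF ends(2)] d_def by (simp add: algebra_simps add_divide_distrib)
      also have "\<dots> = 0" using d0 by (simp add: \<alpha>_def)
      finally show "dx l ?P l + \<i> * k / z * ?P l = 0" .
      fix x assume x: "x \<in> {0<..<l}"
      have "((\<lambda>x. \<alpha> * u1 k x + \<beta> * u2 k x) has_vector_derivative
          \<alpha> * (- k\<^sup>2 * of_real ((r x)\<^sup>2) * p1 k x) + \<beta> * (- k\<^sup>2 * of_real ((r x)\<^sup>2) * p2 k x)) (at x)"
        by (intro has_vector_derivative_add has_vector_derivative_mult_right p_ser_deriv_at x) auto
      then show "((\<lambda>t. of_real ((r t)\<^sup>2) * dx l ?P t) has_vector_derivative
         \<alpha> * (- k\<^sup>2 * of_real ((r x)\<^sup>2) * p1 k x) + \<beta> * (- k\<^sup>2 * of_real ((r x)\<^sup>2) * p2 k x)) (at x)"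
        by (rule has_vector_derivative_transform_within_open[where S = "{0<..<l}"])
          (use x dxP r_nonzero in auto)
      show "\<alpha> * (- k\<^sup>2 * of_real ((r x)\<^sup>2) * p1 k x) + \<beta> * (- k\<^sup>2 * of_real ((r x)\<^sup>2) * p2 k x)
        + k\<^sup>2 * of_real ((r x)\<^sup>2) * ?P x = 0"
        by (simp add: algebra_simps)
    qed
  qed
  have solv: "pressure_solvable c \<mu> l r k"
    unfolding pressure_solvable_def
  proof (intro conjI allI impI ballI exI)
    fix P Q x assume "pressure_solution c \<mu> l r k P \<and> pressure_solution c \<mu> l r k Q" "x \<in> {0..l}"
    then show "P x = Q x" using uniq(1)[of P x] uniq(1)[of Q x] by simp
  qed (use z ex in auto)
  have "(THE p. \<exists>P. pressure_solution c \<mu> l r k P \<and> p = P l) = - \<beta> / (d * of_real (rl\<^sup>2))"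
  proof (rule the_equality)
    have *: "P l = - \<beta> / (d * of_real (rl\<^sup>2))" if "pressure_solution c \<mu> l r k P" for P
    proof -
      have "P l * (d * of_real (rl\<^sup>2)) = - \<beta>" using uniq(2)[OF that ends(2)] by (simp add: mult.assoc)
      moreover have "d * of_real (rl\<^sup>2) \<noteq> 0" using d0 ends by simp
      ultimately show ?thesis by (metis nonzero_mult_div_cancel_right)
    qed
    show "\<exists>P. pressure_solution c \<mu> l r k P \<and> - \<beta> / (d * of_real (rl\<^sup>2)) = P l"
      using ex *[OF ex] by metis
    fix p assume "\<exists>P. pressure_solution c \<mu> l r k P \<and> p = P l"
    then show "p = - \<beta> / (d * of_real (rl\<^sup>2))" using * by blast
  qed
  then have "pressure_end c \<mu> l r k = - \<beta> / (d * of_real (rl\<^sup>2))"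
    using solv by (simp add: pressure_end_def)
  also have "\<dots> = - (\<i> * k * of_real c * of_real \<mu> * z) / (of_real (pi * r0 * rl) * G_fun l r k)"
    unfolding \<beta>_def d_eq using G z0 ends by (simp add: field_simps power2_eq_square)
  finally show ?thesis unfolding z_def .
qed

end

section \<open>The impedance as a semicircle transform\<close>

definition semicircle_moment :: "nat \<Rightarrow> real" where
  "semicircle_moment n = integral {0..1} (\<lambda>t. t ^ n * sqrt (1 - t\<^sup>2))"

lemma DERIV_sqrt_one_minus_square:
  assumes "t \<in> {0<..<1::real}"
  shows "((\<lambda>t. sqrt (1 - t\<^sup>2)) has_real_derivative - t / sqrt (1 - t\<^sup>2)) (at t)"
    and "((\<lambda>t. (1 - t\<^sup>2) * sqrt (1 - t\<^sup>2)) has_real_derivative - 3 * t * sqrt (1 - t\<^sup>2)) (at t)"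
proof -
  have "t\<^sup>2 < 1" using assms by (simp add: abs_square_less_1)
  then have pos: "1 - t\<^sup>2 > 0" by simp
  show 1: "((\<lambda>t. sqrt (1 - t\<^sup>2)) has_real_derivative - t / sqrt (1 - t\<^sup>2)) (at t)"
    using pos by (auto intro!: derivative_eq_intros simp: field_simps)
  have "((\<lambda>t. 1 - t\<^sup>2) has_real_derivative - 2 * t) (at t)"
    by (auto intro!: derivative_eq_intros)
  from DERIV_mult[OF this 1]
  have "((\<lambda>t. (1 - t\<^sup>2) * sqrt (1 - t\<^sup>2)) has_real_derivative
      - 2 * t * sqrt (1 - t\<^sup>2) + (- t / sqrt (1 - t\<^sup>2)) * (1 - t\<^sup>2)) (at t)" .
  moreover have "(- t / sqrt (1 - t\<^sup>2)) * (1 - t\<^sup>2) = - t * ((1 - t\<^sup>2) / sqrt (1 - t\<^sup>2))"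
    by simp
  ultimately show "((\<lambda>t. (1 - t\<^sup>2) * sqrt (1 - t\<^sup>2)) has_real_derivative - 3 * t * sqrt (1 - t\<^sup>2)) (at t)"
    using real_div_sqrt[of "1 - t\<^sup>2"] pos by (simp add: mult.assoc)
qed

lemma semicircle_deriv:
  assumes "t \<in> {0<..<1::real}"
  shows "((\<lambda>t. t ^ Suc n * ((1 - t\<^sup>2) * sqrt (1 - t\<^sup>2))) has_vector_derivative
    real (Suc n) * (t ^ n * sqrt (1 - t\<^sup>2)) - real (n + 4) * (t ^ (n + 2) * sqrt (1 - t\<^sup>2))) (at t)"
proof -
  note DERIV_sqrt_one_minus_square(2)[OF assms]
  moreover have "((\<lambda>t. t ^ Suc n) has_real_derivative real (Suc n) * t ^ n) (at t)"
    using DERIV_pow[of "Suc n" t] by simp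
  ultimately have "((\<lambda>t. t ^ Suc n * ((1 - t\<^sup>2) * sqrt (1 - t\<^sup>2))) has_real_derivative
      t ^ Suc n * (- 3 * t * sqrt (1 - t\<^sup>2)) + real (Suc n) * t ^ n * ((1 - t\<^sup>2) * sqrt (1 - t\<^sup>2))) (at t)"
    using DERIV_mult' by blast
  moreover have "t ^ Suc n * (- 3 * t * sqrt (1 - t\<^sup>2)) + real (Suc n) * t ^ n * ((1 - t\<^sup>2) * sqrt (1 - t\<^sup>2))
     = real (Suc n) * (t ^ n * sqrt (1 - t\<^sup>2)) - real (n + 4) * (t ^ (n + 2) * sqrt (1 - t\<^sup>2))"
    by (simp add: algebra_simps power2_eq_square)
  ultimately show ?thesis
    by (simp add: has_real_derivative_iff_has_vector_derivative)
qed

lemma continuous_semicircle: "continuous_on {0..1} (\<lambda>t::real. t ^ n * sqrt (1 - t\<^sup>2))"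
  by (intro continuous_intros)

lemma has_integral_semicircle_moment:
  "((\<lambda>t. t ^ n * sqrt (1 - t\<^sup>2)) has_integral semicircle_moment n) {0..1}"
  unfolding semicircle_moment_def
  by (intro integrable_integral integrable_continuous_real continuous_semicircle)

text \<open>The derivative of t^(n+1) (1 - t^2)^(3/2) is integrated; the function vanishes at both
  ends. The recursion goes in steps of two, so the even and odd moments start separately from pi/4
  and 1/3.\<close>

lemma semicircle_moment_rec: "real (n + 4) * semicircle_moment (n + 2) = real (n + 1) * semicircle_moment n"
proof -
  let ?F = "\<lambda>t::real. t ^ Suc n * ((1 - t\<^sup>2) * sqrt (1 - t\<^sup>2))"
  have "((\<lambda>t. real (Suc n) * (t ^ n * sqrt (1 - t\<^sup>2)) - real (n + 4) * (t ^ (n + 2) * sqrt (1 - t\<^sup>2)))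
      has_integral ?F 1 - ?F 0) {0..1}"
    by (rule fundamental_theorem_of_calculus_interior[OF _ _ semicircle_deriv])
      (auto intro!: continuous_intros)
  moreover have "((\<lambda>t. real (Suc n) * (t ^ n * sqrt (1 - t\<^sup>2)) - real (n + 4) * (t ^ (n + 2) * sqrt (1 - t\<^sup>2)))
      has_integral real (Suc n) * semicircle_moment n - real (n + 4) * semicircle_moment (n + 2)) {0..1}"
    by (intro has_integral_diff has_integral_mult_right has_integral_semicircle_moment)
  ultimately have "real (Suc n) * semicircle_moment n - real (n + 4) * semicircle_moment (n + 2) = ?F 1 - ?F 0"
    using has_integral_unique by blast
  then show ?thesis by simp
qed

lemma semicircle_moment_0: "semicircle_moment 0 = pi / 4"
proof -
  let ?F = "\<lambda>t::real. (t * sqrt (1 - t\<^sup>2) + arcsin t) / 2"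
  have "((\<lambda>t. sqrt (1 - t\<^sup>2)) has_integral ?F 1 - ?F 0) {0..1}"
  proof (rule fundamental_theorem_of_calculus_interior)
    show "continuous_on {0..1} ?F"
      by (intro continuous_intros continuous_on_arcsin) auto
    fix t :: real assume t: "t \<in> {0<..<1}"
    then have "t\<^sup>2 < 1" by (simp add: abs_square_less_1)
    then have pos: "1 - t\<^sup>2 > 0" by simp
    note DERIV_sqrt_one_minus_square(1)[OF t]
    from DERIV_cdivide[OF DERIV_add[OF DERIV_mult[OF DERIV_ident this] DERIV_arcsin], of 2]
    have "(?F has_real_derivative (1 * sqrt (1 - t\<^sup>2) + - t / sqrt (1 - t\<^sup>2) * t + inverse (sqrt (1 - t\<^sup>2))) / 2) (at t)"
      using t by simp
    moreover have "- t / sqrt (1 - t\<^sup>2) * t + inverse (sqrt (1 - t\<^sup>2)) = (1 - t\<^sup>2) / sqrt (1 - t\<^sup>2)"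
      by (simp add: divide_inverse power2_eq_square algebra_simps)
    then have "(1 * sqrt (1 - t\<^sup>2) + - t / sqrt (1 - t\<^sup>2) * t + inverse (sqrt (1 - t\<^sup>2))) / 2 = sqrt (1 - t\<^sup>2)"
      using real_div_sqrt[of "1 - t\<^sup>2"] pos by simp
    ultimately show "(?F has_vector_derivative sqrt (1 - t\<^sup>2)) (at t)"
      by (simp only: has_real_derivative_iff_has_vector_derivative)
  qed simp
  then have *: "((\<lambda>t. t ^ 0 * sqrt (1 - t\<^sup>2)) has_integral ?F 1 - ?F 0) {0..1}" by simp
  show ?thesis using has_integral_unique[OF has_integral_semicircle_moment *] by simp
qed

lemma semicircle_moment_1: "semicircle_moment 1 = 1 / 3"
proof -
  let ?F = "\<lambda>t::real. - ((1 - t\<^sup>2) * sqrt (1 - t\<^sup>2)) / 3"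
  have "((\<lambda>t. t * sqrt (1 - t\<^sup>2)) has_integral ?F 1 - ?F 0) {0..1}"
  proof (rule fundamental_theorem_of_calculus_interior)
    show "continuous_on {0..1} ?F" by (intro continuous_intros) auto
    fix t :: real assume "t \<in> {0<..<1}"
    from DERIV_cdivide[OF DERIV_minus[OF DERIV_sqrt_one_minus_square(2)[OF this]], of 3]
    show "(?F has_vector_derivative t * sqrt (1 - t\<^sup>2)) (at t)"
      by (simp add: has_real_derivative_iff_has_vector_derivative)
  qed simp
  then have *: "((\<lambda>t. t ^ 1 * sqrt (1 - t\<^sup>2)) has_integral ?F 1 - ?F 0) {0..1}" by simp
  show ?thesis using has_integral_unique[OF has_integral_semicircle_moment *] by simp
qed

text \<open>Up to sign these are the coefficients of w^(2m) in J_1(2w)/w. The factor 4^m stems from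
  the exponent -2 i w in the transform.\<close>

lemma semicircle_moment_even:
  "4 / pi * 4 ^ m * semicircle_moment (2 * m) / fact (2 * m) = 1 / (fact m * fact (m + 1))"
proof (induction m)
  case 0
  show ?case by (simp add: semicircle_moment_0)
next
  case (Suc m)
  have rec: "semicircle_moment (2 * Suc m) = (2 * real m + 1) / (2 * real m + 4) * semicircle_moment (2 * m)"
    using semicircle_moment_rec[of "2 * m"] by (simp add: field_simps)
  have "4 / pi * 4 ^ Suc m * semicircle_moment (2 * Suc m) / fact (2 * Suc m)
     = (4 / pi * 4 ^ m * semicircle_moment (2 * m) / fact (2 * m)) * (4 * (2 * real m + 1) / (2 * real m + 4) / ((2 * real m + 1) * (2 * real m + 2)))"
    unfolding rec by (simp add: field_simps)
  also have "4 * (2 * real m + 1) / (2 * real m + 4) / ((2 * real m + 1) * (2 * real m + 2)) = 1 / ((real m + 1) * (real m + 2))"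
  proof -
    have "2 * real m + 1 \<noteq> 0" "2 * real m + 4 \<noteq> 0" "2 * real m + 2 \<noteq> 0" "real m + 1 \<noteq> 0" "real m + 2 \<noteq> 0"
      by linarith+
    then have nz: "(2 * real m + 4) * ((2 * real m + 1) * (2 * real m + 2)) \<noteq> 0" "(real m + 1) * (real m + 2) \<noteq> 0"
      by (simp_all only: mult_eq_0_iff simp_thms)
    have "4 * (2 * real m + 1) * ((real m + 1) * (real m + 2)) = 1 * ((2 * real m + 4) * ((2 * real m + 1) * (2 * real m + 2)))"
      by (simp add: algebra_simps)
    from frac_eq_eq[OF nz, THEN iffD2, OF this] show ?thesis by (simp only: divide_divide_eq_left)
  qed
  finally show ?case unfolding Suc.IH by (simp add: field_simps)
qed

text \<open>Up to sign these are the coefficients of w^(2m+1) in H_1(2w)/w, H_1 being the Struve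
  function. The constant 8 instead of 4 is the unpaired factor 2 from the odd power of 2w.\<close>

lemma semicircle_moment_odd:
  "8 / pi * 4 ^ m * semicircle_moment (2 * m + 1) / fact (2 * m + 1)
    = 1 / (Gamma (real m + 3 / 2) * Gamma (real (m + 1) + 3 / 2))"
proof (induction m)
  case 0
  have half: "(1 / 2 :: real) \<notin> \<int>\<^sub>\<le>\<^sub>0" "(3 / 2 :: real) \<notin> \<int>\<^sub>\<le>\<^sub>0"
    by (auto dest: nonpos_Ints_nonpos)
  have 1: "Gamma (3 / 2 :: real) = sqrt pi / 2"
    using Gamma_plus1[OF half(1)] by (simp add: Gamma_one_half_real)
  have 2: "Gamma (5 / 2 :: real) = 3 * sqrt pi / 4"
    using Gamma_plus1[OF half(2)] by (simp add: 1)
  have "semicircle_moment (Suc 0) = 1 / 3" using semicircle_moment_1 by simp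
  then show ?case by (simp add: 1 2 field_simps)
next
  case (Suc m)
  have rec: "semicircle_moment (2 * Suc m + 1) = (2 * real m + 2) / (2 * real m + 5) * semicircle_moment (2 * m + 1)"
    using semicircle_moment_rec[of "2 * m + 1"] by (simp add: field_simps)
  have "real m + 3 / 2 \<notin> \<int>\<^sub>\<le>\<^sub>0" "real (m + 1) + 3 / 2 \<notin> \<int>\<^sub>\<le>\<^sub>0"
    by (auto dest!: nonpos_Ints_nonpos)
  note G0 = this[THEN Gamma_plus1]
  have G: "Gamma (real (m + 1) + 3 / 2) = (real m + 3 / 2) * Gamma (real m + 3 / 2)"
    "Gamma (real (Suc m + 1) + 3 / 2) = (real (m + 1) + 3 / 2) * Gamma (real (m + 1) + 3 / 2)"
    using G0 by (simp_all add: algebra_simps)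
  have "8 / pi * 4 ^ Suc m * semicircle_moment (2 * Suc m + 1) / fact (2 * Suc m + 1)
     = (8 / pi * 4 ^ m * semicircle_moment (2 * m + 1) / fact (2 * m + 1))
       * (4 * (2 * real m + 2) / (2 * real m + 5) / ((2 * real m + 2) * (2 * real m + 3)))"
    unfolding rec by (simp add: field_simps)
  also have "4 * (2 * real m + 2) / (2 * real m + 5) / ((2 * real m + 2) * (2 * real m + 3)) = 1 / ((real m + 3 / 2) * (real m + 5 / 2))"
  proof -
    have "2 * real m + 2 \<noteq> 0" "2 * real m + 5 \<noteq> 0" "2 * real m + 3 \<noteq> 0" "real m + 3 / 2 \<noteq> 0" "real m + 5 / 2 \<noteq> 0"
      by linarith+
    then have nz: "(2 * real m + 5) * ((2 * real m + 2) * (2 * real m + 3)) \<noteq> 0" "(real m + 3 / 2) * (real m + 5 / 2) \<noteq> 0"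
      by (simp_all only: mult_eq_0_iff simp_thms)
    have "4 * (2 * real m + 2) * ((real m + 3 / 2) * (real m + 5 / 2)) = 1 * ((2 * real m + 5) * ((2 * real m + 2) * (2 * real m + 3)))"
      by (simp add: algebra_simps)
    from frac_eq_eq[OF nz, THEN iffD2, OF this] show ?thesis by (simp only: divide_divide_eq_left)
  qed
  finally have "8 / pi * 4 ^ Suc m * semicircle_moment (2 * Suc m + 1) / fact (2 * Suc m + 1)
    = 1 / (Gamma (real m + 3 / 2) * Gamma (real (m + 1) + 3 / 2)) * (1 / ((real m + 3 / 2) * (real m + 5 / 2)))"
    unfolding Suc.IH .
  also have "\<dots> = 1 / (Gamma (real (Suc m) + 3 / 2) * Gamma (real (Suc m + 1) + 3 / 2))"
  proof -
    have "real (Suc m) + 3 / 2 = real (m + 1) + 3 / 2" "real (m + 1) + 3 / 2 = real m + 5 / 2" by simp_all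
    note S = this
    show ?thesis
      unfolding S(1) G(2) unfolding G(1) by (simp only: S(2) times_divide_times_eq mult_1 mult_ac)
  qed
  finally show ?case .
qed

lemma semicircle_moment_bounds: "0 \<le> semicircle_moment n" "semicircle_moment n \<le> 1"
proof -
  have le: "t ^ n * sqrt (1 - t\<^sup>2) \<le> 1" if "t \<in> {0..1}" for t :: real
    using that by (intro mult_le_one power_le_one real_sqrt_le_1_iff[THEN iffD2]) (auto simp: power_le_one)
  show "0 \<le> semicircle_moment n"
    by (rule has_integral_nonneg[OF has_integral_semicircle_moment]) (auto simp: power_le_one)
  have "((\<lambda>t. 1) has_integral (1::real)) {0..1::real}" using has_integral_const_real[of "1::real" 0 1] by simp
  from has_integral_le[OF has_integral_semicircle_moment this] le show "semicircle_moment n \<le> 1" by blast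
qed

text \<open>The Laplace transform of the semicircle law on \<open>[0, 1]\<close>; Poisson's integrals identify the
  impedance with \<open>1 - semicircle_transform (- 2 \<i> k r\<^sub>l)\<close>.\<close>

definition semicircle_transform :: "'a \<Rightarrow> 'a::{real_normed_field, banach}" where
  "semicircle_transform s = (\<Sum>n. of_real (4 / pi * semicircle_moment n / fact n) * s ^ n)"

lemma semicircle_transform_summable_norm:
  "summable (\<lambda>n. norm (of_real (4 / pi * semicircle_moment n / fact n) * s ^ n :: 'a::{real_normed_field, banach}))"
proof (rule summable_comparison_test'[of "\<lambda>n. 4 / pi * (norm s ^ n / fact n)"])
  show "summable (\<lambda>n. 4 / pi * (norm s ^ n / fact n))"
    using summable_exp[of "norm s"] by (intro summable_mult) (simp add: field_simps)
  fix n :: nat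
  have "norm (of_real (4 / pi * semicircle_moment n / fact n) * s ^ n :: 'a)
      = 4 / pi * (norm s ^ n / fact n) * semicircle_moment n"
    using semicircle_moment_bounds[of n]
    by (simp add: norm_mult norm_power norm_divide abs_mult)
  also have "\<dots> \<le> 4 / pi * (norm s ^ n / fact n) * 1"
    using semicircle_moment_bounds[of n] by (intro mult_left_mono) auto
  finally show "norm (norm (of_real (4 / pi * semicircle_moment n / fact n) * s ^ n :: 'a)) \<le> 4 / pi * (norm s ^ n / fact n)"
    by simp
qed

lemma semicircle_transform_sums:
  "(\<lambda>n. of_real (4 / pi * semicircle_moment n / fact n) * s ^ n) sums semicircle_transform (s :: 'a::{real_normed_field, banach})"
  unfolding semicircle_transform_def
  by (rule summable_sums[OF summable_norm_cancel[OF semicircle_transform_summable_norm]])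

lemma semicircle_transform_of_real:
  "semicircle_transform (of_real s :: 'a::{real_normed_field, banach}) = of_real (semicircle_transform s)"
proof -
  have "(\<lambda>n. of_real (of_real (4 / pi * semicircle_moment n / fact n) * s ^ n) :: 'a) sums of_real (semicircle_transform s)"
    by (intro sums_of_real semicircle_transform_sums)
  then show ?thesis
    using sums_unique2[OF semicircle_transform_sums[of "of_real s :: 'a"]] by simp
qed

lemma semicircle_transform_cnj: "semicircle_transform (cnj s) = cnj (semicircle_transform s)"
proof -
  have "(\<lambda>n. cnj (of_real (4 / pi * semicircle_moment n / fact n) * s ^ n)) sums cnj (semicircle_transform s)"
    by (simp only: sums_cnj semicircle_transform_sums)
  then show ?thesis
    using sums_unique2[OF semicircle_transform_sums[of "cnj s"]] by simp
qed

lemma semicircle_transform_holomorphic: "semicircle_transform holomorphic_on (UNIV :: complex set)"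
  unfolding semicircle_transform_def[abs_def]
  by (rule holomorphic_onI, rule field_differentiable_at_within)
    (use termdiffs_strong_converges_everywhere[OF sums_summable[OF semicircle_transform_sums]]
      field_differentiable_def in blast)

lemma semicircle_transform_has_integral:
  fixes s :: "'a::{real_normed_field, banach}"
  shows "((\<lambda>t. of_real (4 / pi * sqrt (1 - t\<^sup>2)) * exp (s * of_real t)) has_integral semicircle_transform s) {0..1}"
proof -
  define f where "f n t = of_real (4 / pi * sqrt (1 - t\<^sup>2)) * ((s * of_real t) ^ n /\<^sub>R fact n)" for n t
  have bound: "norm (f n t) \<le> 4 / pi * (norm s ^ n / fact n)" if t: "t \<in> {0..1}" for n t
  proof -
    have 1: "sqrt (1 - t\<^sup>2) \<le> 1" "t ^ n \<le> 1" "0 \<le> sqrt (1 - t\<^sup>2)" using t by (auto simp: power_le_one)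
    have "norm (f n t) = 4 / pi * (norm s ^ n / fact n) * (sqrt (1 - t\<^sup>2) * t ^ n)"
      using t 1 by (simp add: f_def norm_mult norm_power norm_divide power_mult_distrib field_simps)
    also have "\<dots> \<le> 4 / pi * (norm s ^ n / fact n) * 1"
      using 1 t by (intro mult_left_mono mult_le_one) auto
    finally show ?thesis by simp
  qed
  have M: "summable (\<lambda>n. 4 / pi * (norm s ^ n / fact n))"
    using summable_exp[of "norm s"] by (intro summable_mult) (simp add: field_simps)
  have ul: "uniform_limit {0..1} (\<lambda>N t. \<Sum>n<N. f n t) (\<lambda>t. \<Sum>n. f n t) sequentially"
    by (rule Weierstrass_m_test[OF bound M]) auto
  have cont: "continuous_on {0..1} (\<lambda>t. \<Sum>n<N. f n t)" for N
    unfolding f_def by (intro continuous_intros)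
  obtain I J where IJ: "\<And>N. ((\<lambda>t. \<Sum>n<N. f n t) has_integral I N) {0..1}"
    "((\<lambda>t. \<Sum>n. f n t) has_integral J) {0..1}" "I \<longlonglongrightarrow> J"
    using uniform_limit_integral[OF ul cont] by auto
  have fI: "(f n has_integral of_real (4 / pi * semicircle_moment n / fact n) * s ^ n) {0..1}" for n
  proof -
    have "((\<lambda>t. of_real (4 / pi / fact n * (t ^ n * sqrt (1 - t\<^sup>2))) * s ^ n) has_integral
        of_real (4 / pi / fact n * semicircle_moment n) * s ^ n) {0..1}"
      by (intro has_integral_mult_left has_integral_of_real has_integral_mult_right has_integral_semicircle_moment)
    then show ?thesis
      by (rule has_integral_eq_rhs[OF has_integral_eq, rotated])
        (auto simp: f_def power_mult_distrib scaleR_conv_of_real field_simps)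
  qed
  have "((\<lambda>t. \<Sum>n<N. f n t) has_integral (\<Sum>n<N. of_real (4 / pi * semicircle_moment n / fact n) * s ^ n)) {0..1}" for N
    by (intro has_integral_sum fI) auto
  with IJ(1) have "I = (\<lambda>N. \<Sum>n<N. of_real (4 / pi * semicircle_moment n / fact n) * s ^ n)"
    using has_integral_unique by blast
  with IJ(3) have "J = semicircle_transform s"
    using semicircle_transform_sums[of s] LIMSEQ_unique unfolding sums_def by blast
  moreover have "(\<Sum>n. f n t) = of_real (4 / pi * sqrt (1 - t\<^sup>2)) * exp (s * of_real t)" for t
    unfolding f_def
    by (subst suminf_mult) (auto simp: exp_def intro: sums_summable[OF exp_converges])
  ultimately show ?thesis using IJ(2) by simp
qed

lemma semicircle_transform_0: "semicircle_transform 0 = 1"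
  unfolding semicircle_transform_def
  by (subst suminf_finite[of "{0}"]) (auto simp: semicircle_moment_0)

lemma norm_semicircle_transform_le: "norm (semicircle_transform s :: 'a::{real_normed_field, banach}) \<le> 2 * exp (norm s)"
proof -
  have sm: "(\<lambda>n. 4 / pi * (norm s ^ n /\<^sub>R fact n)) sums (4 / pi * exp (norm s))"
    by (intro sums_mult exp_converges)
  have "norm (semicircle_transform s) \<le> (\<Sum>n. 4 / pi * (norm s ^ n /\<^sub>R fact n))"
    unfolding semicircle_transform_def
  proof (rule norm_suminf_le[OF _ sums_summable[OF sm]])
    fix n
    have "norm (of_real (4 / pi * semicircle_moment n / fact n) * s ^ n :: 'a)
      = 4 / pi * (norm s ^ n / fact n) * semicircle_moment n"
      using semicircle_moment_bounds[of n] by (simp add: norm_mult norm_power norm_divide abs_mult)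
    also have "\<dots> \<le> 4 / pi * (norm s ^ n / fact n) * 1"
      using semicircle_moment_bounds[of n] by (intro mult_left_mono) auto
    finally show "norm (of_real (4 / pi * semicircle_moment n / fact n) * s ^ n :: 'a) \<le> 4 / pi * (norm s ^ n /\<^sub>R fact n)"
      by (simp add: field_simps)
  qed
  also have "\<dots> = 4 / pi * exp (norm s)" using sums_unique[OF sm] by simp
  also have "\<dots> \<le> 2 * exp (norm s)"
    using pi_ge_two by (intro mult_right_mono) (auto simp: field_simps)
  finally show ?thesis .
qed

lemma summable_even_odd:
  fixes f :: "nat \<Rightarrow> 'a::banach"
  assumes "summable (\<lambda>n. norm (f n))"
  shows "summable (\<lambda>m. f (2 * m))" "summable (\<lambda>m. f (2 * m + 1))"
    "(\<Sum>n. f n) = (\<Sum>m. f (2 * m)) + (\<Sum>m. f (2 * m + 1))"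
proof -
  have *: "summable (\<lambda>m. f (g m))" if "strict_mono g" for g :: "nat \<Rightarrow> nat"
  proof -
    have "summable (\<lambda>n. if n \<in> range g then f n else 0)"
      by (rule summable_comparison_test'[OF assms]) auto
    then have "summable (\<lambda>m. (\<lambda>n. if n \<in> range g then f n else 0) (g m))"
      by (subst summable_mono_reindex[OF that]) auto
    then show ?thesis by simp
  qed
  show 1: "summable (\<lambda>m. f (2 * m))" "summable (\<lambda>m. f (2 * m + 1))"
    by (rule *, simp add: strict_mono_def)+
  have "(\<lambda>m. sum f {m * 2..<m * 2 + 2}) sums (\<Sum>n. f n)"
    by (rule sums_group[OF summable_sums[OF summable_norm_cancel[OF assms]]]) simp
  moreover have "sum f {m * 2..<m * 2 + 2} = f (2 * m) + f (2 * m + 1)" for m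
    by (simp add: numeral_2_eq_2 mult.commute)
  ultimately have "(\<lambda>m. f (2 * m) + f (2 * m + 1)) sums (\<Sum>n. f n)" by simp
  then show "(\<Sum>n. f n) = (\<Sum>m. f (2 * m)) + (\<Sum>m. f (2 * m + 1))"
    using sums_unique2 sums_add[OF summable_sums[OF 1(1)] summable_sums[OF 1(2)]] by blast
qed

text \<open>The series of the transform at -2 i w is split by parity: its even part is J_1(2w)/w and
  its odd part is -i times H_1(2w)/w.\<close>

lemma impedance_formula:
  fixes w :: complex
  assumes "w \<noteq> 0"
  shows "1 - bessel_J 1 (2 * w) / w + \<i> * (struve_H 1 (2 * w) / w) = 1 - semicircle_transform (- 2 * \<i> * w)"
proof -
  define f where "f n = of_real (4 / pi * semicircle_moment n / fact n) * (- 2 * \<i> * w) ^ n" for n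
  have sf: "summable (\<lambda>n. norm (f n))" unfolding f_def by (rule semicircle_transform_summable_norm)
  have pow: "(- 2 * \<i> * w) ^ (2 * m) = (-1) ^ m * 4 ^ m * w ^ (2 * m)" for m
  proof -
    have "(- 2 * \<i> * w) ^ (2 * m) = ((- 2 * \<i> * w)\<^sup>2) ^ m" by (simp only: power_mult)
    also have "(- 2 * \<i> * w)\<^sup>2 = (-1) * 4 * w\<^sup>2" by (simp add: power_mult_distrib)
    finally show ?thesis by (simp only: power_mult_distrib power_mult)
  qed
  have even: "f (2 * m) = (-1) ^ m / (fact m * fact (m + 1)) * w ^ (2 * m)" for m
  proof -
    have "f (2 * m) = of_real (4 / pi * 4 ^ m * semicircle_moment (2 * m) / fact (2 * m)) * ((-1) ^ m * w ^ (2 * m))"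
      unfolding f_def pow by simp
    then show ?thesis unfolding semicircle_moment_even by simp
  qed
  have odd: "f (2 * m + 1) = - \<i> * ((-1) ^ m / (Gamma (of_nat m + 3 / 2) * Gamma (of_nat (m + 1) + 3 / 2)) * w ^ (2 * m + 1))" for m
  proof -
    have "f (2 * m + 1) = of_real (8 / pi * 4 ^ m * semicircle_moment (2 * m + 1) / fact (2 * m + 1))
        * (- \<i> * ((-1) ^ m * w ^ (2 * m + 1)))"
      unfolding f_def power_add[of _ "2 * m"] pow by simp
    moreover have "(of_nat m + 3 / 2 :: complex) = of_real (real m + 3 / 2)"
      "(of_nat (m + 1) + 3 / 2 :: complex) = of_real (real (m + 1) + 3 / 2)" by simp_all
    ultimately show ?thesis
      unfolding semicircle_moment_odd by (simp only: Gamma_complex_of_real) simp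
  qed
  have "bessel_J 1 (2 * w) = (\<Sum>m. w * f (2 * m))"
    unfolding bessel_J_def even by (simp add: mult_ac)
  also have "\<dots> = w * (\<Sum>m. f (2 * m))" by (rule suminf_mult[OF summable_even_odd(1)[OF sf]])
  finally have b: "bessel_J 1 (2 * w) / w = (\<Sum>m. f (2 * m))" using assms by simp
  have "struve_H 1 (2 * w) = (\<Sum>m. (\<i> * w) * f (2 * m + 1))"
    unfolding struve_H_def odd by (simp add: mult_ac)
  also have "\<dots> = \<i> * w * (\<Sum>m. f (2 * m + 1))" by (rule suminf_mult[OF summable_even_odd(2)[OF sf]])
  finally have "\<i> * (struve_H 1 (2 * w) / w) = - (\<Sum>m. f (2 * m + 1))" using assms by simp
  moreover have "semicircle_transform (- 2 * \<i> * w) = (\<Sum>m. f (2 * m)) + (\<Sum>m. f (2 * m + 1))"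
    using summable_even_odd(3)[OF sf] by (simp add: semicircle_transform_def f_def)
  ultimately show ?thesis using b by simp
qed

lemma impedance_eq:
  assumes "0 < R"
  shows "impedance R k = 1 - semicircle_transform (- 2 * \<i> * k * of_real R)"
proof -
  let ?g = "\<lambda>k. 1 - semicircle_transform (- 2 * \<i> * k * of_real R)"
  have "continuous_on UNIV (semicircle_transform :: complex \<Rightarrow> complex)"
    by (rule holomorphic_on_imp_continuous_on[OF semicircle_transform_holomorphic])
  then have "continuous_on UNIV ?g"
    by (intro continuous_intros continuous_on_compose2[where f = "\<lambda>k. - 2 * \<i> * k * of_real R"
          and g = semicircle_transform and t = UNIV]) auto
  then have "isCont ?g k" by (simp add: continuous_on_eq_continuous_at)
  then have lim: "?g \<midarrow>k\<rightarrow> ?g k" by (simp add: isCont_def)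
  show ?thesis
    unfolding impedance_def
  proof (rule remove_sings_eqI)
    have "eventually (\<lambda>k'. k' \<noteq> 0) (at k)"
      using eventually_neq_at_within[of 0] by blast
    then have "eventually (\<lambda>k. ?g k = 1 - bessel_J 1 (2 * k * of_real R) / (k * of_real R)
       + \<i> * (struve_H 1 (2 * k * of_real R) / (k * of_real R))) (at k)"
    proof eventually_elim
      case (elim k')
      with assms have "k' * of_real R \<noteq> 0" by simp
      from impedance_formula[OF this] show ?case by (simp add: mult.assoc)
    qed
    from Lim_transform_eventually[OF lim this]
    show "(\<lambda>k. 1 - bessel_J 1 (2 * k * of_real R) / (k * of_real R)
       + \<i> * (struve_H 1 (2 * k * of_real R) / (k * of_real R))) \<midarrow>k\<rightarrow> ?g k" .
  qed
qed

section \<open>Inequalities and growth of the semicircle transform on the axes\<close>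

lemma semicircle_integral_pos:
  assumes "continuous_on {0..1} g" "\<And>t. t \<in> {0..1} \<Longrightarrow> 0 \<le> g t" "0 < g (1 / 2)"
    and I: "((\<lambda>t. 4 / pi * sqrt (1 - t\<^sup>2) * g t) has_integral I) {0..1}"
  shows "0 < I"
proof -
  let ?f = "\<lambda>t::real. 4 / pi * sqrt (1 - t\<^sup>2) * g t"
  have cont: "continuous_on {0..1} ?f" by (intro continuous_intros assms)
  have nn: "0 \<le> ?f t" if "t \<in> {0..1}" for t
    using assms(2)[OF that] that by (auto simp: power_le_one)
  have "integral {0..1} ?f = 0 \<longleftrightarrow> (\<forall>t\<in>{0..1}. ?f t = 0)"
    by (rule integral_eq_0_iff[OF cont _ nn]) auto
  moreover have "?f (1 / 2) \<noteq> 0" using assms(3) by (simp add: power2_eq_square)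
  then have "\<not> (\<forall>t\<in>{0..1}. ?f t = 0)" by (intro notI) (drule bspec[of _ _ "1 / 2"], auto)
  moreover have "0 \<le> I" by (rule has_integral_nonneg[OF I nn])
  moreover have "integral {0..1} ?f = I" using I by (rule integral_unique)
  ultimately show ?thesis by linarith
qed

lemma semicircle_has_integral_1: "((\<lambda>t. 4 / pi * sqrt (1 - t\<^sup>2)) has_integral 1) {0..1::real}"
  using semicircle_transform_has_integral[of "0::real"] by (simp add: semicircle_transform_0)

lemma semicircle_has_integral_real:
  fixes x :: real
  shows "((\<lambda>t. 4 / pi * sqrt (1 - t\<^sup>2) * exp (x * t)) has_integral semicircle_transform x) {0..1}"
  using semicircle_transform_has_integral[of x] by simp

lemma semicircle_transform_gt_1:
  assumes "0 < (x::real)"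
  shows "1 < semicircle_transform x"
proof -
  have "((\<lambda>t. 4 / pi * sqrt (1 - t\<^sup>2) * (exp (x * t) - 1)) has_integral semicircle_transform x - 1) {0..1}"
    using has_integral_diff[OF semicircle_has_integral_real[of x] semicircle_has_integral_1]
    by (simp only: right_diff_distrib mult_1_right)
  then have "0 < semicircle_transform x - 1"
  proof (rule semicircle_integral_pos[rotated 3])
    show "continuous_on {0..1} (\<lambda>t. exp (x * t) - 1)" by (intro continuous_intros)
  qed (use assms in auto)
  then show ?thesis by simp
qed

lemma semicircle_transform_lt_1:
  assumes "(x::real) < 0"
  shows "semicircle_transform x < 1"
proof -
  have "((\<lambda>t. 4 / pi * sqrt (1 - t\<^sup>2) * (1 - exp (x * t))) has_integral 1 - semicircle_transform x) {0..1}"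
    using has_integral_diff[OF semicircle_has_integral_1 semicircle_has_integral_real[of x]]
    by (simp only: right_diff_distrib mult_1_right)
  then have "0 < 1 - semicircle_transform x"
  proof (rule semicircle_integral_pos[rotated 3])
    show "continuous_on {0..1} (\<lambda>t. 1 - exp (x * t))" by (intro continuous_intros)
  qed (use assms in \<open>auto simp: mult_le_0_iff\<close>)
  then show ?thesis by simp
qed

lemma semicircle_transform_nonneg: "0 \<le> semicircle_transform (x::real)"
  by (rule has_integral_nonneg[OF semicircle_has_integral_real]) (auto simp: power_le_one)

lemma semicircle_transform_pos: "0 < semicircle_transform (x::real)"
  by (rule semicircle_integral_pos[OF _ _ _ semicircle_has_integral_real]) (auto intro!: continuous_intros)

text \<open>The excess over 2 is the integral of a square against the density. It is the determinant
  of the linear system by which G at i \<eta> and at -i \<eta> determines its two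
  constituents.\<close>

lemma semicircle_transform_symmetric_gt_2:
  assumes "(x::real) \<noteq> 0"
  shows "2 < semicircle_transform x + semicircle_transform (- x)"
proof -
  have "((\<lambda>t. 4 / pi * sqrt (1 - t\<^sup>2) * (exp (x * t / 2) - exp (- x * t / 2))\<^sup>2) has_integral
      semicircle_transform x + semicircle_transform (- x) - (1 + 1)) {0..1}"
  proof -
    have "(exp (x * t / 2) - exp (- x * t / 2))\<^sup>2 = exp (x * t) + exp (- x * t) - (1 + 1)" for t
      by (simp add: power2_eq_square algebra_simps flip: exp_add)
    then show ?thesis
      using has_integral_diff[OF has_integral_add[OF semicircle_has_integral_real[of x]
          semicircle_has_integral_real[of "- x"]] has_integral_add[OF semicircle_has_integral_1 semicircle_has_integral_1]]
      by (simp only: distrib_left right_diff_distrib mult_1_right)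
  qed
  then have "0 < semicircle_transform x + semicircle_transform (- x) - (1 + 1)"
  proof (rule semicircle_integral_pos[rotated 3])
    show "continuous_on {0..1} (\<lambda>t. (exp (x * t / 2) - exp (- x * t / 2))\<^sup>2)"
      by (intro continuous_intros) auto
  qed (use assms in auto)
  then show ?thesis by simp
qed

text \<open>The real part averages cos(y t) over a probability density. Since real k correspond to
  imaginary arguments, the impedance has positive real part at every real k other than 0.\<close>

lemma Re_semicircle_transform_imaginary_lt_1:
  assumes "(y::real) \<noteq> 0"
  shows "Re (semicircle_transform (\<i> * of_real y)) < 1"
proof -
  have "((\<lambda>t. Re (of_real (4 / pi * sqrt (1 - t\<^sup>2)) * exp (\<i> * of_real y * of_real t))) has_integral
      Re (semicircle_transform (\<i> * of_real y))) {0..1}"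
    using has_integral_linear[OF semicircle_transform_has_integral bounded_linear_Re] by (simp add: o_def)
  then have I: "((\<lambda>t. 4 / pi * sqrt (1 - t\<^sup>2) * cos (y * t)) has_integral Re (semicircle_transform (\<i> * of_real y))) {0..1}"
    by (rule has_integral_eq[rotated]) (simp add: Re_exp)
  let ?f = "\<lambda>t::real. 4 / pi * sqrt (1 - t\<^sup>2) * (1 - cos (y * t))"
  have cont: "continuous_on {0..1} ?f" by (intro continuous_intros)
  have nn: "0 \<le> ?f t" if "t \<in> {0..1}" for t
    using that by (auto simp: power_le_one)
  have I': "(?f has_integral 1 - Re (semicircle_transform (\<i> * of_real y))) {0..1}"
    using has_integral_diff[OF semicircle_has_integral_1 I]
    by (simp only: right_diff_distrib mult_1_right)
  have ge: "0 \<le> 1 - Re (semicircle_transform (\<i> * of_real y))"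
    by (rule has_integral_nonneg[OF I' nn])
  have "1 - Re (semicircle_transform (\<i> * of_real y)) \<noteq> 0"
  proof
    assume "1 - Re (semicircle_transform (\<i> * of_real y)) = 0"
    then have z: "\<forall>t\<in>{0..1}. ?f t = 0"
      using integral_eq_0_iff[OF cont _ nn] integral_unique[OF I'] by simp
    \<comment> \<open>A point inside the interval, where the density is positive, and so close to 0
      that |y| t lies strictly above 0 and at most pi/2, where the cosine is below 1.\<close>
    define t where "t = min (1 / 2) (pi / (2 * \<bar>y\<bar>))"
    have t: "0 < t" "t < 1" "\<bar>y\<bar> * t \<le> pi / 2"
    proof -
      show "0 < t" "t < 1" using assms by (auto simp: t_def)
      have "\<bar>y\<bar> * t \<le> \<bar>y\<bar> * (pi / (2 * \<bar>y\<bar>))" by (intro mult_left_mono) (auto simp: t_def)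
      then show "\<bar>y\<bar> * t \<le> pi / 2" using assms by simp
    qed
    have "t\<^sup>2 < 1" using t by (simp add: abs_square_less_1)
    moreover have "?f t = 0" using bspec[OF z, of t] t by simp
    ultimately have "cos (y * t) = 1" by auto
    moreover have "cos (\<bar>y\<bar> * t) < cos 0"
    proof (rule cos_monotone_0_pi)
      show "\<bar>y\<bar> * t \<le> pi" using t(3) pi_gt_zero by linarith
    qed (use t assms in auto)
    moreover have "cos (\<bar>y\<bar> * t) = cos (y * t)" by (cases "0 \<le> y") auto
    ultimately show False by simp
  qed
  then show ?thesis using ge by linarith
qed

lemma semicircle_transform_tendsto_0: "((\<lambda>x. semicircle_transform (- x)) \<longlongrightarrow> (0::real)) at_top"
proof (rule tendsto_sandwich[of "\<lambda>_. 0" _ _ "\<lambda>x. 4 / pi / x"])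
  show "\<forall>\<^sub>F x in at_top. semicircle_transform (- x) \<le> 4 / pi / (x::real)"
    using eventually_gt_at_top[of "0::real"]
  proof eventually_elim
    case (elim x)
    have "((\<lambda>t. 4 / pi * exp (- x * t)) has_integral
        (- (4 / pi * exp (- x * 1) / x)) - (- (4 / pi * exp (- x * 0) / x))) {0..1}"
      by (rule fundamental_theorem_of_calculus)
        (use elim in \<open>auto intro!: derivative_eq_intros simp flip: has_real_derivative_iff_has_vector_derivative\<close>)
    from has_integral_le[OF semicircle_has_integral_real this]
    have "semicircle_transform (- x) \<le> (- (4 / pi * exp (- x * 1) / x)) - (- (4 / pi * exp (- x * 0) / x))"
      by (auto intro!: mult_right_mono simp: divide_le_cancel power_le_one)
    also have "\<dots> \<le> 4 / pi / x" using elim by simp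
    finally show ?case .
  qed
  show "((\<lambda>x. 4 / pi / x) \<longlongrightarrow> (0::real)) at_top" by real_asymp
qed (auto simp: semicircle_transform_nonneg)

text \<open>Only the exponential rate matters, so polynomial losses are harmless: the upper bound is
  2 exp x, and the lower bound replaces sqrt(1 - t^2) by 1 - t, whose transform is
  elementary.\<close>

lemma ln_semicircle_transform: "((\<lambda>x. ln (semicircle_transform x) / x) \<longlongrightarrow> (1::real)) at_top"
proof (rule tendsto_sandwich)
  have lower: "4 / pi * ((exp x - 1 - x) / x\<^sup>2) \<le> semicircle_transform x" if x: "0 < x" for x :: real
  proof -
    define a where "a = 1 / x"
    have ax: "a * x = 1" using x by (simp add: a_def)
    let ?F = "\<lambda>t. (a * (1 - t) + a * a) * exp (x * t)"
    have "((\<lambda>t. (1 - t) * exp (x * t)) has_integral ?F 1 - ?F 0) {0..1}"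
    proof (rule fundamental_theorem_of_calculus)
      fix t :: real
      have "(?F has_real_derivative (a * (1 - t) + a * a) * (exp (x * t) * x) + (- a) * exp (x * t)) (at t within {0..1})"
        by (auto intro!: derivative_eq_intros)
      moreover have "(a * (1 - t) + a * a) * (exp (x * t) * x) + (- a) * exp (x * t)
          = (a * x) * (1 - t) * exp (x * t) + (a * x) * a * exp (x * t) - a * exp (x * t)"
        by (simp add: algebra_simps)
      ultimately show "(?F has_vector_derivative (1 - t) * exp (x * t)) (at t within {0..1})"
        by (simp add: ax has_real_derivative_iff_has_vector_derivative)
    qed simp
    moreover have "?F 1 - ?F 0 = (exp x - 1 - x) / x\<^sup>2"
      using x by (simp add: a_def field_simps power2_eq_square)
    ultimately have "((\<lambda>t. (1 - t) * exp (x * t)) has_integral (exp x - 1 - x) / x\<^sup>2) {0..1}" by simp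
    from has_integral_mult_right[OF this, of "4 / pi"]
    have "((\<lambda>t. 4 / pi * ((1 - t) * exp (x * t))) has_integral 4 / pi * ((exp x - 1 - x) / x\<^sup>2)) {0..1}" .
    then show ?thesis
    proof (rule has_integral_le[OF _ semicircle_has_integral_real])
      fix t :: real assume t: "t \<in> {0..1}"
      have "(1 - t)\<^sup>2 \<le> 1 - t\<^sup>2" using t by (simp add: power2_eq_square algebra_simps mult_left_le)
      then have "1 - t \<le> sqrt (1 - t\<^sup>2)" using t by (simp add: real_le_rsqrt)
      then have "4 / pi * ((1 - t) * exp (x * t)) \<le> 4 / pi * (sqrt (1 - t\<^sup>2) * exp (x * t))"
        by (intro mult_left_mono mult_right_mono) auto
      then show "4 / pi * ((1 - t) * exp (x * t)) \<le> 4 / pi * sqrt (1 - t\<^sup>2) * exp (x * t)"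
        by (simp add: mult.assoc)
    qed
  qed
  have "\<forall>\<^sub>F x::real in at_top. 0 < 4 / pi * ((exp x - 1 - x) / x\<^sup>2)"
    by real_asymp
  with eventually_gt_at_top[of "0::real"] show "\<forall>\<^sub>F x in at_top. ln (4 / pi * ((exp x - 1 - x) / x\<^sup>2)) / x \<le> ln (semicircle_transform x) / x"
  proof (eventually_elim)
    case (elim x)
    then show ?case
      using lower[of x] by (intro divide_right_mono ln_mono) auto
  qed
  show "\<forall>\<^sub>F x in at_top. ln (semicircle_transform x) / x \<le> ln (2 * exp x) / (x::real)"
    using eventually_gt_at_top[of "0::real"]
  proof eventually_elim
    case (elim x)
    have "semicircle_transform x \<le> 2 * exp x"
      using norm_semicircle_transform_le[of x] elim by simp
    then show ?case
      using elim semicircle_transform_pos[of x] by (intro divide_right_mono ln_mono) auto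
  qed
  show "((\<lambda>x. ln (4 / pi * ((exp x - 1 - x) / x\<^sup>2)) / x) \<longlongrightarrow> (1::real)) at_top" by real_asymp
  show "((\<lambda>x. ln (2 * exp x) / x) \<longlongrightarrow> (1::real)) at_top" by real_asymp
qed

section \<open>Zero-free quotients of entire functions of exponential type\<close>

lemma entire_divide_zero:
  fixes f :: "complex \<Rightarrow> complex"
  assumes f: "f holomorphic_on UNIV" and "f a = 0" and nc: "\<not> f constant_on UNIV"
  obtains h n where "h holomorphic_on UNIV" "h a \<noteq> 0" "\<And>w. f w = (w - a) ^ n * h w"
proof -
  obtain g r n where n: "0 < n" "0 < r" "g holomorphic_on ball a r"
    "\<And>w. w \<in> ball a r \<Longrightarrow> f w = (w - a) ^ n * g w" "\<And>w. w \<in> ball a r \<Longrightarrow> g w \<noteq> 0"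
    using holomorphic_factor_zero_nonconstant[OF f open_UNIV connected_UNIV UNIV_I \<open>f a = 0\<close> nc] by metis
  define h where "h w = (if w = a then g a else f w / (w - a) ^ n)" for w
  have "h holomorphic_on (- {a}) \<union> ball a r"
  proof (rule holomorphic_on_Un)
    have "(\<lambda>w. f w / (w - a) ^ n) holomorphic_on (- {a})"
      by (intro holomorphic_intros holomorphic_on_subset[OF f]) auto
    then show "h holomorphic_on (- {a})"
      by (rule holomorphic_transform) (auto simp: h_def)
    show "h holomorphic_on ball a r"
      by (rule holomorphic_transform[OF n(3)]) (use n(4) in \<open>auto simp: h_def\<close>)
  qed auto
  moreover have "(- {a}) \<union> ball a r = UNIV" using n(2) by auto
  ultimately have "h holomorphic_on UNIV" by simp
  moreover have "h a \<noteq> 0" using n(2,5) by (simp add: h_def)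
  moreover have "f w = (w - a) ^ n * h w" for w
    using assms(2) n(1) by (simp add: h_def)
  ultimately show thesis by (rule that)
qed

text \<open>Each zero \<open>a\<close> is removed by the reciprocal of a Blaschke factor, \<open>(R\<^sup>2 - a\<^sup>* z) / (R (z - a))\<close>,
  which has modulus one on the circle and at least one at the origin.\<close>

lemma blaschke_quotient:
  fixes f :: "complex \<Rightarrow> complex"
  assumes "f holomorphic_on UNIV" "f 0 \<noteq> 0" "0 < R"
  shows "\<exists>N. N holomorphic_on UNIV \<and> (\<forall>z\<in>sphere 0 R. cmod (N z) = cmod (f z)) \<and>
    (\<forall>z\<in>ball 0 R. N z \<noteq> 0) \<and> cmod (f 0) \<le> cmod (N 0)"
  using assms(1,2)
proof (induction "card {z\<in>ball 0 R. f z = 0}" arbitrary: f rule: less_induct)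
  case less
  show ?case
  proof (cases "\<exists>a\<in>ball 0 R. f a = 0")
    case False
    then show ?thesis using less.prems by blast
  next
    case True
    then obtain a where a: "a \<in> ball 0 R" "f a = 0" by blast
    have nc: "\<not> f constant_on UNIV"
      unfolding constant_on_def using a(2) less.prems(2) by (metis UNIV_I)
    have fin: "finite {z\<in>ball 0 R. f z = 0}"
      by (rule finite_subset[OF _ holomorphic_compact_finite_zeros[OF less.prems(1) open_UNIV connected_UNIV
            compact_cball[of 0 R] subset_UNIV nc]]) auto
    obtain h n where h: "h holomorphic_on UNIV" "h a \<noteq> 0" "\<And>w. f w = (w - a) ^ n * h w"
      using entire_divide_zero[OF less.prems(1) a(2) nc] by metis
    define m where "m w = (of_real (R\<^sup>2) - cnj a * w) / of_real R" for w
    define g where "g w = m w ^ n * h w" for w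
    have m_ball: "m w \<noteq> 0" if "w \<in> ball 0 R" for w
    proof -
      have "cmod (cnj a * w) < R * R"
        unfolding norm_mult using that a by (intro mult_strict_mono') auto
      also have "R * R = cmod (of_real (R\<^sup>2))" by (simp add: power2_eq_square norm_mult)
      finally show ?thesis using \<open>0 < R\<close> by (auto simp: m_def)
    qed
    have m_sphere: "cmod (m w) = cmod (w - a)" if "w \<in> sphere 0 R" for w
    proof -
      have "of_real (R\<^sup>2) = w * cnj w" using that complex_norm_square[of w] by simp
      then have "m w = w * cnj (w - a) / of_real R" by (simp add: m_def algebra_simps)
      then show ?thesis using that \<open>0 < R\<close> by (simp add: norm_mult norm_divide del: complex_cnj_diff)
    qed
    have m0: "cmod a \<le> cmod (m 0)" using a \<open>0 < R\<close> by (simp add: m_def power2_eq_square)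
    have g: "g holomorphic_on UNIV"
      unfolding g_def m_def by (intro holomorphic_intros h(1)) (use \<open>0 < R\<close> in auto)
    have fg: "{z\<in>ball 0 R. g z = 0} = {z\<in>ball 0 R. f z = 0} - {a}"
      using m_ball h a by (auto simp: g_def)
    have "card {z\<in>ball 0 R. g z = 0} < card {z\<in>ball 0 R. f z = 0}"
      unfolding fg using fin a by (intro card_Diff1_less) auto
    moreover have g0: "cmod (f 0) \<le> cmod (g 0)"
      unfolding h(3) g_def norm_mult norm_power using m0 by (intro mult_right_mono power_mono) auto
    then have "g 0 \<noteq> 0" using less.prems(2) by auto
    ultimately obtain N where N: "N holomorphic_on UNIV" "\<forall>z\<in>sphere 0 R. cmod (N z) = cmod (g z)"
      "\<forall>z\<in>ball 0 R. N z \<noteq> 0" "cmod (g 0) \<le> cmod (N 0)"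
      using less.hyps[OF _ g] by blast
    moreover have "cmod (g z) = cmod (f z)" if "z \<in> sphere 0 R" for z
      unfolding h(3) g_def norm_mult norm_power m_sphere[OF that] ..
    ultimately show ?thesis using g0 by (intro exI[of _ N]) auto
  qed
qed

text \<open>The map A / (2M - A) sends the half-plane Re A < M into the unit disc and fixes 0. The
  Schwarz lemma bounds it by 1/2 on the disc of half the radius, and solving for A gives the
  estimate.\<close>

lemma borel_caratheodory:
  fixes A :: "complex \<Rightarrow> complex"
  assumes A: "A holomorphic_on ball 0 R" "A 0 = 0" and Re: "\<And>z. z \<in> ball 0 R \<Longrightarrow> Re (A z) < M"
    and z: "cmod z \<le> R / 2" and "0 < R"
  shows "cmod (A z) \<le> 2 * M"
proof -
  have "0 < M" using Re[of 0] A(2) \<open>0 < R\<close> by simp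
  have lt: "cmod (A w) < cmod (of_real (2 * M) - A w)" if "w \<in> ball 0 R" for w
  proof -
    have "(cmod (of_real (2 * M) - A w))\<^sup>2 - (cmod (A w))\<^sup>2 = 4 * M * (M - Re (A w))"
      unfolding cmod_power2 by (simp add: power2_eq_square algebra_simps)
    also have "\<dots> > 0" using Re[OF that] \<open>0 < M\<close> by simp
    finally show ?thesis by (simp add: power2_less_imp_less)
  qed
  have nz: "of_real (2 * M) - A w \<noteq> 0" if "w \<in> ball 0 R" for w
    using lt[OF that] by auto
  define s where "s w = A (of_real R * w) / (of_real (2 * M) - A (of_real R * w))" for w
  have sc: "of_real R * w \<in> ball 0 R" if "cmod w < 1" for w
    using that \<open>0 < R\<close> by (simp add: norm_mult)
  have "(\<lambda>w. A (of_real R * w)) holomorphic_on ball 0 1"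
    by (rule holomorphic_on_compose_gen[OF _ A(1), unfolded o_def])
      (use sc in \<open>auto intro!: holomorphic_intros\<close>)
  then have s: "s holomorphic_on ball 0 1"
    unfolding s_def by (intro holomorphic_intros) (use nz sc in auto)
  define w where "w = z / of_real R"
  have w: "cmod w \<le> 1 / 2" "of_real R * w = z"
    using z \<open>0 < R\<close> by (auto simp: w_def norm_divide field_simps)
  have "cmod (s w) \<le> cmod w"
  proof (rule Schwarz_Lemma(1)[OF s])
    show "cmod (s u) < 1" if "cmod u < 1" for u
    proof -
      have "cmod (A (of_real R * u)) / cmod (of_real (2 * M) - A (of_real R * u)) < 1"
        using lt[OF sc[OF that]] by (subst divide_less_eq_1_pos) (use norm_ge_zero le_less_trans in blast)+
      then show ?thesis by (simp only: s_def norm_divide)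
    qed
  qed (use w A(2) in \<open>auto simp: s_def\<close>)
  then have "cmod (s w) \<le> 1 / 2" using w by linarith
  then have "cmod (A z) \<le> 1 / 2 * cmod (of_real (2 * M) - A z)"
    using nz[of z] z \<open>0 < R\<close> unfolding s_def w(2) norm_divide by (subst (asm) divide_le_eq) auto
  also have "\<dots> \<le> 1 / 2 * (2 * M + cmod (A z))"
    using norm_triangle_ineq4[of "of_real (2 * M)" "A z"] \<open>0 < M\<close> by simp
  finally show ?thesis by simp
qed

text \<open>For zero-free \<open>N\<close> on the disc write \<open>N = exp A\<close>: the growth bound controls \<open>Re A\<close> from above
  and \<open>|N 0|\<close> from below, so Borel-Caratheodory controls \<open>A\<close>. Applied to the Blaschke quotients of
  \<open>f\<close> and \<open>f H\<close>, whose logarithms differ by \<open>log H\<close>, it shows that \<open>log H\<close> grows linearly.\<close>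

theorem exponential_type_quotient:
  fixes f H :: "complex \<Rightarrow> complex"
  assumes f: "f holomorphic_on UNIV" "f 0 \<noteq> 0" and H: "H holomorphic_on UNIV" "\<And>z. H z \<noteq> 0"
    and growth: "\<And>z. cmod (f z) \<le> C * exp (c * cmod z)" "\<And>z. cmod (f z * H z) \<le> C * exp (c * cmod z)"
    and "0 < c"
  shows "\<exists>a b. \<forall>z. H z = exp (a + b * z)"
proof -
  obtain g where g: "g holomorphic_on UNIV" "\<And>z. H z = exp (g z)"
    using contractible_imp_holomorphic_log[OF H(1) _ ] H(2) by (metis contractible_UNIV UNIV_I)
  have "0 < C"
    using growth(1)[of 0] f(2) by (smt (verit) zero_less_norm_iff exp_gt_zero mult_nonpos_nonneg)
  \<comment> \<open>Here \<open>d\<close> bounds |N 0| from below independently of R. The summand 1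
    turns the upper bound on the real part into the strict one that
    \<open>borel_caratheodory\<close> takes.\<close>
  have key: "cmod (A z - A 0) \<le> 2 * (ln C + c * R - ln d + 1)"
    if A: "A holomorphic_on ball 0 R" and N: "N holomorphic_on UNIV" "\<And>z. z \<in> ball 0 R \<Longrightarrow> N z = exp (A z)"
      and b: "\<And>z. z \<in> sphere 0 R \<Longrightarrow> cmod (N z) \<le> C * exp (c * R)" and d: "0 < d" "d \<le> cmod (N 0)"
      and "0 < R" "cmod z \<le> R / 2" for A N R d z
  proof (rule borel_caratheodory[of "\<lambda>z. A z - A 0"])
    show "(\<lambda>z. A z - A 0) holomorphic_on ball 0 R" by (intro holomorphic_intros A)
    fix w :: complex assume w: "w \<in> ball 0 R"
    have "cmod (N w) \<le> C * exp (c * R)"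
      by (rule maximum_modulus_frontier[of N "cball 0 R"])
        (use w b \<open>0 < R\<close> N(1) in \<open>auto intro: holomorphic_on_subset holomorphic_on_imp_continuous_on\<close>)
    then have "exp (Re (A w)) \<le> exp (ln C + c * R)"
      using N(2)[OF w] \<open>0 < C\<close> by (simp add: exp_add)
    then have 1: "Re (A w) \<le> ln C + c * R" by simp
    have "d \<le> exp (Re (A 0))" using d N(2)[of 0] \<open>0 < R\<close> by simp
    then have "ln d \<le> Re (A 0)" using d(1) by (metis ln_exp ln_le_cancel_iff exp_gt_zero)
    then show "Re (A w - A 0) < ln C + c * R - ln d + 1" using 1 by simp
  qed (use that in auto)
  \<comment> \<open>One lower bound serves both applications, since passing to the Blaschke quotient
    does not decrease the modulus at the origin.\<close>
  define d where "d = min (cmod (f 0)) (cmod (f 0 * H 0))"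
  have d: "0 < d" using f(2) H(2) by (simp add: d_def)
  define K where "K = 4 * (\<bar>ln C\<bar> + \<bar>ln d\<bar> + 1 + 2 * c)"
  have bound: "cmod (g z - g 0) \<le> K * cmod z ^ 1" if z: "1 \<le> cmod z" for z
  proof -
    \<comment> \<open>The estimate covers the disc of radius R/2, so this is the smallest R that
      reaches z.\<close>
    define R where "R = 2 * cmod z"
    have "0 < R" unfolding R_def using z by linarith
    obtain N where N: "N holomorphic_on UNIV" "\<forall>z\<in>sphere 0 R. cmod (N z) = cmod (f z)"
      "\<forall>z\<in>ball 0 R. N z \<noteq> 0" "cmod (f 0) \<le> cmod (N 0)"
      using blaschke_quotient[OF f \<open>0 < R\<close>] by blast
    have Nb: "N holomorphic_on ball 0 R" by (rule holomorphic_on_subset[OF N(1)]) auto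
    have "contractible (ball (0::complex) R)" by (rule convex_imp_contractible) simp
    then obtain A where A: "A holomorphic_on ball 0 R" "\<And>z. z \<in> ball 0 R \<Longrightarrow> N z = exp (A z)"
      using contractible_imp_holomorphic_log[OF Nb] N(3) by metis
    have 1: "cmod (A z - A 0) \<le> 2 * (ln C + c * R - ln d + 1)"
    proof (rule key[OF A(1) N(1) A(2)])
      show "cmod (N w) \<le> C * exp (c * R)" if "w \<in> sphere 0 R" for w
        using growth(1)[of w] N(2) that by simp
    qed (use N(4) d \<open>0 < R\<close> in \<open>auto simp: d_def R_def\<close>)
    have gb: "g holomorphic_on ball 0 R" by (rule holomorphic_on_subset[OF g(1)]) auto
    have 2: "cmod ((A z + g z) - (A 0 + g 0)) \<le> 2 * (ln C + c * R - ln d + 1)"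
    proof (rule key[where N = "\<lambda>z. N z * H z"])
      show "d \<le> cmod (N 0 * H 0)"
        using mult_right_mono[OF N(4), of "cmod (H 0)"] by (simp add: d_def norm_mult min_le_iff_disj)
      show "cmod (N w * H w) \<le> C * exp (c * R)" if "w \<in> sphere 0 R" for w
        using growth(2)[of w] N(2) that by (simp add: norm_mult)
    qed (use N(1) H(1) A g gb d \<open>0 < R\<close> in \<open>auto intro!: holomorphic_intros simp: exp_add R_def\<close>)
    have "g z - g 0 = ((A z + g z) - (A 0 + g 0)) - (A z - A 0)" by simp
    then have "cmod (g z - g 0) \<le> 4 * (ln C + c * R - ln d + 1)"
      using norm_triangle_ineq4[of "(A z + g z) - (A 0 + g 0)" "A z - A 0"] 1 2 by simp
    also have "\<dots> \<le> 4 * ((\<bar>ln C\<bar> + \<bar>ln d\<bar> + 1) * 1 + 2 * c * cmod z)" by (simp add: R_def)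
    also have "\<dots> \<le> 4 * ((\<bar>ln C\<bar> + \<bar>ln d\<bar> + 1) * cmod z + 2 * c * cmod z)"
      by (intro mult_left_mono add_right_mono) (use z in auto)
    finally show ?thesis by (simp add: K_def algebra_simps)
  qed
  \<comment> \<open>A linearly bounded entire function is a polynomial of degree at most one, and
    here its constant term is zero.\<close>
  have lin: "g z = g 0 + deriv (\<lambda>z. g z - g 0) 0 * z" for z
  proof -
    have "g z - g 0 = (\<Sum>k\<le>1. (deriv ^^ k) (\<lambda>z. g z - g 0) 0 / fact k * z ^ k)"
      by (rule Liouville_polynomial[OF _ bound]) (intro holomorphic_intros g)
    also have "\<dots> = deriv (\<lambda>z. g z - g 0) 0 * z" by simp
    finally show ?thesis by (simp only: diff_eq_eq add.commute)
  qed
  show ?thesis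
    by (intro exI allI) (subst g(2), rule arg_cong[where f = exp, OF lin])
qed

section \<open>Asymptotics on the imaginary axis\<close>

text \<open>With the integrating factor exp(\<nu> x), the function (\<nu> y - c) exp(\<nu> x) has
  derivative \<nu> exp(\<nu> x) (f - c). Subtracting or adding \<epsilon> exp(\<nu> x) makes it
  decreasing or increasing. So \<nu> y settles at c up to \<epsilon> and a decayed initial
  error.\<close>

lemma damped_bound:
  fixes y f :: "real \<Rightarrow> real"
  assumes "p \<le> q" "0 < \<nu>" and cont: "continuous_on {p..q} y"
    and der: "\<And>x. x \<in> {p<..<q} \<Longrightarrow> (y has_real_derivative - \<nu> * y x + f x) (at x)"
    and f: "\<And>x. x \<in> {p<..<q} \<Longrightarrow> \<bar>f x - c\<bar> \<le> \<epsilon>" and "0 \<le> \<epsilon>"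
  shows "\<bar>\<nu> * y q - c\<bar> \<le> \<epsilon> + exp (- \<nu> * (q - p)) * \<bar>\<nu> * y p - c\<bar>"
proof -
  define g where "g x = (\<nu> * y x - c) * exp (\<nu> * x)" for x
  have g: "(g has_real_derivative \<nu> * exp (\<nu> * x) * (f x - c)) (at x)" if "x \<in> {p<..<q}" for x
    unfolding g_def using der[OF that]
    by (auto intro!: derivative_eq_intros simp: algebra_simps)
  have e: "((\<lambda>x. \<epsilon> * exp (\<nu> * x)) has_real_derivative \<epsilon> * (exp (\<nu> * x) * \<nu>)) (at x)" for x
    by (auto intro!: derivative_eq_intros)
  have cg: "continuous_on {p..q} g" unfolding g_def by (intro continuous_intros cont)
  have "g q - \<epsilon> * exp (\<nu> * q) \<le> g p - \<epsilon> * exp (\<nu> * p)"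
  proof (rule DERIV_nonpos_imp_decreasing_open[OF \<open>p \<le> q\<close>])
    fix x assume "p < x" "x < q"
    then have x: "x \<in> {p<..<q}" by simp
    have "\<nu> * exp (\<nu> * x) * (f x - c) \<le> \<nu> * exp (\<nu> * x) * \<epsilon>"
      using f[OF x] \<open>0 < \<nu>\<close> by (intro mult_left_mono) auto
    then show "\<exists>y. ((\<lambda>x. g x - \<epsilon> * exp (\<nu> * x)) has_real_derivative y) (at x) \<and> y \<le> 0"
      by - (rule exI, rule conjI[OF DERIV_diff[OF g[OF x] e]], simp add: algebra_simps)
  qed (intro continuous_intros cg)
  moreover have "g p + \<epsilon> * exp (\<nu> * p) \<le> g q + \<epsilon> * exp (\<nu> * q)"
  proof (rule DERIV_nonneg_imp_increasing_open[OF \<open>p \<le> q\<close>])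
    fix x assume "p < x" "x < q"
    then have x: "x \<in> {p<..<q}" by simp
    have "\<nu> * exp (\<nu> * x) * (- \<epsilon>) \<le> \<nu> * exp (\<nu> * x) * (f x - c)"
      using f[OF x] \<open>0 < \<nu>\<close> by (intro mult_left_mono) auto
    then show "\<exists>y. ((\<lambda>x. g x + \<epsilon> * exp (\<nu> * x)) has_real_derivative y) (at x) \<and> 0 \<le> y"
      by - (rule exI, rule conjI[OF DERIV_add[OF g[OF x] e]], simp add: algebra_simps)
  qed (intro continuous_intros cg)
  moreover have "0 \<le> \<epsilon> * exp (\<nu> * p)" using \<open>0 \<le> \<epsilon>\<close> by simp
  ultimately have "\<bar>g q\<bar> \<le> \<epsilon> * exp (\<nu> * q) + \<bar>g p\<bar>" by linarith
  moreover have "exp (- \<nu> * (q - p)) * exp (\<nu> * q) = exp (\<nu> * p)"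
    by (simp add: algebra_simps flip: exp_add)
  then have "(\<epsilon> + exp (- \<nu> * (q - p)) * \<bar>\<nu> * y p - c\<bar>) * exp (\<nu> * q) = \<epsilon> * exp (\<nu> * q) + \<bar>g p\<bar>"
    unfolding g_def abs_mult abs_exp_cancel distrib_right by (metis mult.assoc mult.commute)
  moreover have "\<bar>g q\<bar> = \<bar>\<nu> * y q - c\<bar> * exp (\<nu> * q)" by (simp add: g_def abs_mult)
  ultimately have "\<bar>\<nu> * y q - c\<bar> * exp (\<nu> * q) \<le> (\<epsilon> + exp (- \<nu> * (q - p)) * \<bar>\<nu> * y p - c\<bar>) * exp (\<nu> * q)"
    by linarith
  then show ?thesis by simp
qed

text \<open>The amplitudes \<open>a, b\<close> of the growing and the decaying exponential satisfy a Dirac-type system;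
  only the boundary layer at \<open>0\<close>, of width \<open>1 / \<eta>\<close>, feels \<open>b 0 = 1 / 2\<close>.\<close>

lemma dirac_asymptotics:
  fixes a b :: "real \<Rightarrow> real \<Rightarrow> real" and s :: "real \<Rightarrow> real"
  assumes "0 < l" and s: "continuous_on {0..l} s"
    and cont: "\<And>\<eta>. 0 < \<eta> \<Longrightarrow> continuous_on {0..l} (a \<eta>)" "\<And>\<eta>. 0 < \<eta> \<Longrightarrow> continuous_on {0..l} (b \<eta>)"
    and init: "\<And>\<eta>. 0 < \<eta> \<Longrightarrow> a \<eta> 0 = 1 / 2" "\<And>\<eta>. 0 < \<eta> \<Longrightarrow> b \<eta> 0 = 1 / 2"
    and a: "\<And>\<eta> x. \<lbrakk>0 < \<eta>; x \<in> {0<..<l}\<rbrakk> \<Longrightarrow> (a \<eta> has_real_derivative s x * b \<eta> x) (at x)"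
    and b: "\<And>\<eta> x. \<lbrakk>0 < \<eta>; x \<in> {0<..<l}\<rbrakk>
      \<Longrightarrow> (b \<eta> has_real_derivative - (2 * \<eta>) * b \<eta> x + s x * a \<eta> x) (at x)"
  shows "((\<lambda>\<eta>. a \<eta> l) \<longlongrightarrow> 1 / 2) at_top" "((\<lambda>\<eta>. 2 * \<eta> * b \<eta> l) \<longlongrightarrow> s l / 2) at_top"
    "((\<lambda>\<eta>. b \<eta> l) \<longlongrightarrow> 0) at_top"
proof -
  obtain S where S: "0 < S" "\<And>x. x \<in> {0..l} \<Longrightarrow> \<bar>s x\<bar> \<le> S"
    using continuous_on_bounded_normE[OF compact_Icc s] by auto
  define B where "B = exp (S * l)"
  have B1: "1 \<le> B" using S \<open>0 < l\<close> by (simp add: B_def)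
  have bounded: "\<bar>a \<eta> x\<bar> \<le> B \<and> \<bar>b \<eta> x\<bar> \<le> B" if \<eta>: "0 < \<eta>" and x: "x \<in> {0..l}" for \<eta> x
  proof -
    \<comment> \<open>Energy estimate: the damping enters the derivative of a^2 + b^2 with a
      negative sign, so the growth rate 2S, and with it the bound \<open>B\<close>, is independent
      of \<eta>.\<close>
    let ?E = "\<lambda>x. (a \<eta> x)\<^sup>2 + (b \<eta> x)\<^sup>2"
    have "?E x * exp (- 2 * S * x) \<le> ?E 0 * exp (- 2 * S * 0)"
    proof (rule DERIV_nonpos_imp_decreasing_open[where f = "\<lambda>x. ?E x * exp (- 2 * S * x)"])
      show "0 \<le> x" using x by simp
      have "continuous_on {0..x} (a \<eta>)" "continuous_on {0..x} (b \<eta>)"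
        using cont[OF \<eta>] x by (auto elim: continuous_on_subset)
      then show "continuous_on {0..x} (\<lambda>x. ?E x * exp (- 2 * S * x))" by (intro continuous_intros)
      fix y assume "0 < y" "y < x"
      then have y: "y \<in> {0<..<l}" "y \<in> {0..l}" using x by auto
      define D where "D = 4 * s y * a \<eta> y * b \<eta> y - 4 * \<eta> * (b \<eta> y)\<^sup>2 - 2 * S * ?E y"
      have "((\<lambda>x. ?E x * exp (- 2 * S * x)) has_real_derivative D * exp (- 2 * S * y)) (at y)"
        using a[OF \<eta> y(1)] b[OF \<eta> y(1)]
        by (auto intro!: derivative_eq_intros simp: D_def algebra_simps power2_eq_square)
      moreover have "D \<le> 0"
      proof -
        have "s y * (2 * (a \<eta> y * b \<eta> y)) \<le> \<bar>s y\<bar> * \<bar>2 * (a \<eta> y * b \<eta> y)\<bar>"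
          by (metis abs_ge_self abs_mult)
        also have "\<bar>2 * (a \<eta> y * b \<eta> y)\<bar> \<le> ?E y"
          using sum_squares_bound[of "a \<eta> y" "b \<eta> y"] sum_squares_bound[of "a \<eta> y" "- b \<eta> y"]
          by (simp add: abs_le_iff)
        then have "\<bar>s y\<bar> * \<bar>2 * (a \<eta> y * b \<eta> y)\<bar> \<le> S * ?E y"
          using S(2)[OF y(2)] by (intro mult_mono) auto
        finally have "2 * (s y * (2 * (a \<eta> y * b \<eta> y))) \<le> 2 * (S * ?E y)" by linarith
        moreover have "0 \<le> 4 * \<eta> * (b \<eta> y)\<^sup>2" using \<eta> by simp
        ultimately show ?thesis by (simp add: D_def mult.assoc)
      qed
      ultimately show "\<exists>d. ((\<lambda>x. ?E x * exp (- 2 * S * x)) has_real_derivative d) (at y) \<and> d \<le> 0"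
        by (intro exI[of _ "D * exp (- 2 * S * y)"] conjI) (auto intro: mult_nonpos_nonneg)
    qed
    then have "?E x * exp (- 2 * S * x) * exp (2 * S * x) \<le> 1 * exp (2 * S * x)"
      using init[OF \<eta>] by (intro mult_right_mono) (auto simp: power2_eq_square)
    then have "?E x \<le> exp (2 * S * x)" by (simp add: mult.assoc flip: exp_add)
    also have "\<dots> \<le> exp (2 * S * l)" using x S by simp
    also have "\<dots> = B\<^sup>2" by (simp add: B_def power2_eq_square flip: exp_add)
    finally have "(a \<eta> x)\<^sup>2 \<le> B\<^sup>2" "(b \<eta> x)\<^sup>2 \<le> B\<^sup>2"
      using zero_le_power2[of "a \<eta> x"] zero_le_power2[of "b \<eta> x"] by linarith+
    then show ?thesis using B1 by (simp add: abs_le_square_iff[symmetric])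
  qed
  \<comment> \<open>Damping with target 0 and forcing s a of size at most \<open>S * B\<close>. The
    term with \<eta> is the initial error, since 2 \<eta> b(0) = \<eta>; it describes the boundary
    layer.\<close>
  have b_bound: "\<bar>2 * \<eta> * b \<eta> x\<bar> \<le> S * B + exp (- 2 * \<eta> * x) * \<eta>" if \<eta>: "0 < \<eta>" and x: "x \<in> {0..l}" for \<eta> x
  proof -
    have "\<bar>2 * \<eta> * b \<eta> x - 0\<bar> \<le> S * B + exp (- (2 * \<eta>) * (x - 0)) * \<bar>2 * \<eta> * b \<eta> 0 - 0\<bar>"
    proof (rule damped_bound)
      show "continuous_on {0..x} (b \<eta>)" using cont(2)[OF \<eta>] x by (auto elim: continuous_on_subset)
      fix y assume "y \<in> {0<..<x}"
      then have y: "y \<in> {0<..<l}" "y \<in> {0..l}" using x by auto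
      show "(b \<eta> has_real_derivative - (2 * \<eta>) * b \<eta> y + s y * a \<eta> y) (at y)" by (rule b[OF \<eta> y(1)])
      show "\<bar>s y * a \<eta> y - 0\<bar> \<le> S * B"
        unfolding diff_0_right abs_mult using S bounded[OF \<eta> y(2)] y(2) B1 by (intro mult_mono) auto
    qed (use \<eta> x S B1 in auto)
    then show ?thesis using init[OF \<eta>] \<eta> by simp
  qed
  define C where "C = S * (S * B * l + 1) / 2"
  have a_bound: "\<bar>a \<eta> x - 1 / 2\<bar> \<le> C / \<eta>" if \<eta>: "0 < \<eta>" and x: "x \<in> {0..l}" for \<eta> x
  proof -
    \<comment> \<open>An antiderivative of the bound on |s b|. Integrating the boundary layer
      contributes only order 1/\<eta>, so \<open>a\<close> stays near 1/2 uniformly in x.\<close>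
    define K where "K x = S * (S * B * x / (2 * \<eta>) - exp (- 2 * \<eta> * x) / (4 * \<eta>))" for x
    have K: "(K has_real_derivative S * (S * B / (2 * \<eta>) + exp (- 2 * \<eta> * y) / 2)) (at y)" for y
      unfolding K_def using \<eta> by (auto intro!: derivative_eq_intros)
    have cK: "continuous_on {0..x} K" unfolding K_def by (intro continuous_intros) (use \<eta> in auto)
    have ca: "continuous_on {0..x} (a \<eta>)" using cont(1)[OF \<eta>] x by (auto elim: continuous_on_subset)
    have le: "\<bar>s y * b \<eta> y\<bar> \<le> S * (S * B / (2 * \<eta>) + exp (- 2 * \<eta> * y) / 2)" if y: "y \<in> {0..l}" for y
    proof -
      have "\<bar>b \<eta> y\<bar> \<le> S * B / (2 * \<eta>) + exp (- 2 * \<eta> * y) / 2"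
        using b_bound[OF \<eta> y] \<eta> by (simp add: abs_mult field_simps)
      then show ?thesis unfolding abs_mult using S y by (intro mult_mono) auto
    qed
    have "a \<eta> x - K x \<le> a \<eta> 0 - K 0"
    proof (rule DERIV_nonpos_imp_decreasing_open[where f = "\<lambda>x. a \<eta> x - K x"])
      fix y assume "0 < y" "y < x"
      then have y: "y \<in> {0<..<l}" "y \<in> {0..l}" using x by auto
      show "\<exists>d. ((\<lambda>x. a \<eta> x - K x) has_real_derivative d) (at y) \<and> d \<le> 0"
        using le[OF y(2)] by - (rule exI, rule conjI[OF DERIV_diff[OF a[OF \<eta> y(1)] K]], linarith)
    qed (use x in \<open>auto intro!: continuous_intros cK ca\<close>)
    moreover have "a \<eta> 0 + K 0 \<le> a \<eta> x + K x"
    proof (rule DERIV_nonneg_imp_increasing_open[where f = "\<lambda>x. a \<eta> x + K x"])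
      fix y assume "0 < y" "y < x"
      then have y: "y \<in> {0<..<l}" "y \<in> {0..l}" using x by auto
      show "\<exists>d. ((\<lambda>x. a \<eta> x + K x) has_real_derivative d) (at y) \<and> 0 \<le> d"
        using le[OF y(2)] by - (rule exI, rule conjI[OF DERIV_add[OF a[OF \<eta> y(1)] K]], linarith)
    qed (use x in \<open>auto intro!: continuous_intros cK ca\<close>)
    ultimately have "\<bar>a \<eta> x - 1 / 2\<bar> \<le> K x - K 0" using init(1)[OF \<eta>] by linarith
    also have "\<dots> \<le> S * (S * B * l / (2 * \<eta>) + 1 / (4 * \<eta>))"
    proof -
      have "S * B * x / (2 * \<eta>) \<le> S * B * l / (2 * \<eta>)"
        using x S B1 \<eta> by (intro divide_right_mono mult_left_mono) auto
      moreover have "0 \<le> exp (- 2 * \<eta> * x) / (4 * \<eta>)" using \<eta> by simp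
      ultimately have "S * B * x / (2 * \<eta>) - exp (- 2 * \<eta> * x) / (4 * \<eta>) + 1 / (4 * \<eta>)
          \<le> S * B * l / (2 * \<eta>) + 1 / (4 * \<eta>)" by linarith
      from mult_left_mono[OF this, of S] S(1) show ?thesis
        by (simp add: K_def algebra_simps)
    qed
    also have "\<dots> \<le> C / \<eta>" using \<eta> S(1) B1 \<open>0 < l\<close> by (simp add: C_def field_simps)
    finally show ?thesis .
  qed
  have ll: "l \<in> {0..l}" using \<open>0 < l\<close> by simp
  have "0 \<le> C" using S(1) B1 \<open>0 < l\<close> by (simp add: C_def)
  show "((\<lambda>\<eta>. a \<eta> l) \<longlongrightarrow> 1 / 2) at_top"
  proof (rule Lim_transform_bound[of "\<lambda>\<eta>. a \<eta> l - 1 / 2" "\<lambda>\<eta>. C / \<eta>", THEN LIM_zero_cancel])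
    show "\<forall>\<^sub>F \<eta> in at_top. norm (a \<eta> l - 1 / 2) \<le> norm (C / \<eta>)"
      using eventually_gt_at_top[of 0]
      by eventually_elim (use a_bound[OF _ ll] \<open>0 \<le> C\<close> in auto)
    show "((\<lambda>\<eta>. C / \<eta>) \<longlongrightarrow> 0) at_top" by real_asymp
  qed
  \<comment> \<open>The damping estimate is restarted at l - \<delta>. Beyond it s a is close to
    s(l)/2, by continuity of s and the estimate for a, while the initial error, at most of order
    \<eta>, is killed by exp(-2 \<eta> \<delta>).\<close>
  show lim: "((\<lambda>\<eta>. 2 * \<eta> * b \<eta> l) \<longlongrightarrow> s l / 2) at_top"
  proof (rule tendstoI)
    fix \<epsilon> :: real assume "0 < \<epsilon>"
    from s ll have "continuous (at l within {0..l}) s" by (simp add: continuous_on_eq_continuous_within)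
    then obtain d where d: "0 < d" "\<And>x. \<lbrakk>x \<in> {0..l}; dist x l < d\<rbrakk> \<Longrightarrow> dist (s x) (s l) < \<epsilon>"
      unfolding continuous_within_eps_delta using \<open>0 < \<epsilon>\<close> by blast
    define \<delta> where "\<delta> = min (d / 2) (l / 2)"
    have \<delta>: "0 < \<delta>" "\<delta> < d" "\<delta> < l" using d(1) \<open>0 < l\<close> by (auto simp: \<delta>_def)
    have "\<forall>\<^sub>F \<eta> in at_top. (S * (C / \<eta>) + \<epsilon> / 2) + exp (- (2 * \<eta>) * \<delta>) * (S * B + \<eta> + \<bar>s l / 2\<bar>) < \<epsilon>"
    proof (rule order_tendstoD)
      show "((\<lambda>\<eta>. (S * (C / \<eta>) + \<epsilon> / 2) + exp (- (2 * \<eta>) * \<delta>) * (S * B + \<eta> + \<bar>s l / 2\<bar>)) \<longlongrightarrow> \<epsilon> / 2) at_top"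
        using \<delta>(1) by real_asymp
    qed (use \<open>0 < \<epsilon>\<close> in auto)
    with eventually_gt_at_top[of 0]
    show "\<forall>\<^sub>F \<eta> in at_top. dist (2 * \<eta> * b \<eta> l) (s l / 2) < \<epsilon>"
    proof eventually_elim
      case (elim \<eta>)
      then have \<eta>: "0 < \<eta>" by simp
      have dl: "l - \<delta> \<in> {0..l}" using \<delta> by auto
      have "\<bar>2 * \<eta> * b \<eta> l - s l / 2\<bar> \<le> (S * (C / \<eta>) + \<epsilon> / 2)
          + exp (- (2 * \<eta>) * (l - (l - \<delta>))) * \<bar>2 * \<eta> * b \<eta> (l - \<delta>) - s l / 2\<bar>"
      proof (rule damped_bound)
        show "continuous_on {l - \<delta>..l} (b \<eta>)" using cont(2)[OF \<eta>] \<delta> by (auto elim: continuous_on_subset)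
        fix y assume y': "y \<in> {l - \<delta><..<l}"
        then have y: "y \<in> {0<..<l}" "y \<in> {0..l}" using \<delta> by auto
        show "(b \<eta> has_real_derivative - (2 * \<eta>) * b \<eta> y + s y * a \<eta> y) (at y)" by (rule b[OF \<eta> y(1)])
        have "s y * a \<eta> y - s l / 2 = s y * (a \<eta> y - 1 / 2) + (s y - s l) / 2" by (simp add: field_simps)
        also have "\<bar>\<dots>\<bar> \<le> \<bar>s y\<bar> * \<bar>a \<eta> y - 1 / 2\<bar> + \<bar>s y - s l\<bar> / 2"
          by (rule order_trans[OF abs_triangle_ineq]) (simp add: abs_mult)
        also have "\<dots> \<le> S * (C / \<eta>) + \<epsilon> / 2"
          using S y(2) a_bound[OF \<eta> y(2)] d(2)[OF y(2)] y' \<delta>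
          by (intro add_mono mult_mono) (auto simp: dist_real_def less_imp_le)
        finally show "\<bar>s y * a \<eta> y - s l / 2\<bar> \<le> S * (C / \<eta>) + \<epsilon> / 2" .
      qed (use \<eta> \<delta> S(1) \<open>0 \<le> C\<close> \<open>0 < \<epsilon>\<close> in auto)
      also have "\<dots> \<le> (S * (C / \<eta>) + \<epsilon> / 2) + exp (- (2 * \<eta>) * \<delta>) * (S * B + \<eta> + \<bar>s l / 2\<bar>)"
      proof -
        have "exp (- 2 * \<eta> * (l - \<delta>)) * \<eta> \<le> 1 * \<eta>"
          using \<eta> \<delta> by (intro mult_right_mono) auto
        then have "\<bar>2 * \<eta> * b \<eta> (l - \<delta>) - s l / 2\<bar> \<le> S * B + \<eta> + \<bar>s l / 2\<bar>"
          using b_bound[OF \<eta> dl] by linarith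
        then have "exp (- (2 * \<eta>) * \<delta>) * \<bar>2 * \<eta> * b \<eta> (l - \<delta>) - s l / 2\<bar>
            \<le> exp (- (2 * \<eta>) * \<delta>) * (S * B + \<eta> + \<bar>s l / 2\<bar>)" by (intro mult_left_mono) auto
        then show ?thesis by simp
      qed
      also have "\<dots> < \<epsilon>" using elim by simp
      finally show ?case by (simp add: dist_real_def)
    qed
  qed
  have "((\<lambda>\<eta>::real. 1 / (2 * \<eta>)) \<longlongrightarrow> 0) at_top" by real_asymp
  from tendsto_mult[OF lim this] have "((\<lambda>\<eta>. (2 * \<eta> * b \<eta> l) * (1 / (2 * \<eta>))) \<longlongrightarrow> 0) at_top" by simp
  moreover have "\<forall>\<^sub>F \<eta> in at_top. (2 * \<eta> * b \<eta> l) * (1 / (2 * \<eta>)) = b \<eta> l"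
    using eventually_gt_at_top[of "0::real"] by eventually_elim simp
  ultimately show "((\<lambda>\<eta>. b \<eta> l) \<longlongrightarrow> 0) at_top" by (rule Lim_transform_eventually)
qed

section \<open>Orders of zeros of entire functions and of poles of their quotients\<close>

lemma entire_factor:
  fixes f :: "complex \<Rightarrow> complex"
  assumes f: "f holomorphic_on UNIV" and "f w0 \<noteq> 0"
  obtains h n where "h holomorphic_on UNIV" "h a \<noteq> 0" "\<And>w. f w = (w - a) ^ n * h w" "zorder f a = int n"
proof -
  obtain h n where h: "h holomorphic_on UNIV" "h a \<noteq> 0" "\<And>w. f w = (w - a) ^ n * h w"
  proof (cases "f a = 0")
    case True
    then have "\<not> f constant_on UNIV" unfolding constant_on_def using assms(2) by (metis UNIV_I)
    from entire_divide_zero[OF f True this] that show thesis by metis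
  next
    case False
    then show thesis using that[of f 0] f by simp
  qed
  moreover have "zorder f a = int n"
    by (rule zorder_eqI[of UNIV]) (use h in \<open>auto simp: power_int_of_nat\<close>)
  ultimately show thesis by (rule that)
qed

lemma entire_eventually_nonzero:
  fixes f :: "complex \<Rightarrow> complex"
  assumes f: "f holomorphic_on UNIV" and "f a \<noteq> 0"
  obtains r where "0 < r" "\<And>w. w \<in> ball a r \<Longrightarrow> f w \<noteq> 0"
proof -
  have "isCont f a"
    using holomorphic_on_imp_continuous_on[OF f] by (simp add: continuous_on_eq_continuous_at)
  from continuous_at_avoid[OF this \<open>f a \<noteq> 0\<close>] show thesis
    using that by (auto simp: dist_commute)
qed

text \<open>Near each point both functions contain the same power of w - k, so the quotient of the
  two cofactors is a local zero-free representative of H.\<close>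

lemma entire_same_zorder:
  fixes f g :: "complex \<Rightarrow> complex"
  assumes f: "f holomorphic_on UNIV" "f w0 \<noteq> 0" and g: "g holomorphic_on UNIV" "g w1 \<noteq> 0"
    and eq: "\<And>z. zorder f z = zorder g z"
  obtains H where "H holomorphic_on UNIV" "\<And>z. H z \<noteq> 0" "\<And>z. g z = f z * H z"
proof -
  define H where "H = remove_sings (\<lambda>w. g w / f w)"
  have loc: "\<exists>U q. open U \<and> k \<in> U \<and> q holomorphic_on U \<and> (\<forall>w\<in>U. H w = q w \<and> q w \<noteq> 0 \<and> g w = f w * q w)" for k
  proof -
    obtain a n where a: "a holomorphic_on UNIV" "a k \<noteq> 0" "\<And>w. f w = (w - k) ^ n * a w" "zorder f k = int n"
      using entire_factor[OF f, of k] by metis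
    obtain b m where b: "b holomorphic_on UNIV" "b k \<noteq> 0" "\<And>w. g w = (w - k) ^ m * b w" "zorder g k = int m"
      using entire_factor[OF g, of k] by metis
    have [simp]: "m = n" using a(4) b(4) eq[of k] by simp
    obtain r1 where r1: "0 < r1" "\<And>w. w \<in> ball k r1 \<Longrightarrow> a w \<noteq> 0"
      using entire_eventually_nonzero[OF a(1,2)] by metis
    obtain r2 where r2: "0 < r2" "\<And>w. w \<in> ball k r2 \<Longrightarrow> b w \<noteq> 0"
      using entire_eventually_nonzero[OF b(1,2)] by metis
    define U where "U = ball k (min r1 r2)"
    define q where "q w = b w / a w" for w
    have U: "open U" "k \<in> U" using r1(1) r2(1) by (auto simp: U_def)
    have nz: "a w \<noteq> 0" "b w \<noteq> 0" if "w \<in> U" for w using that r1(2) r2(2) by (auto simp: U_def)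
    have q: "q holomorphic_on U"
      unfolding q_def by (intro holomorphic_intros holomorphic_on_subset[OF a(1)] holomorphic_on_subset[OF b(1)])
        (use nz in auto)
    have "H w = q w" if w: "w \<in> U" for w
      unfolding H_def
    proof (rule remove_sings_eqI)
      have "isCont q w"
        using holomorphic_on_imp_continuous_on[OF q] U(1) w by (simp add: continuous_on_eq_continuous_at)
      then have lim: "q \<midarrow>w\<rightarrow> q w" by (simp add: isCont_def)
      have "\<forall>\<^sub>F v in at w. v \<in> U" using U(1) w by (rule eventually_at_in_open')
      moreover have "\<forall>\<^sub>F v in at w. v \<noteq> k" by (rule eventually_neq_at_within)
      ultimately have "\<forall>\<^sub>F v in at w. q v = g v / f v"
        by eventually_elim (simp add: q_def a(3) b(3))
      from Lim_transform_eventually[OF lim this] show "(\<lambda>w. g w / f w) \<midarrow>w\<rightarrow> q w" .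
    qed
    then show ?thesis
      using U q nz by (intro exI[of _ U] exI[of _ q]) (auto simp: q_def a(3) b(3))
  qed
  show thesis
  proof (rule that)
    show "H holomorphic_on UNIV"
      unfolding holomorphic_on_def
    proof
      fix k
      from loc[of k] obtain U q where U: "open U" "k \<in> U" "q holomorphic_on U" "\<forall>w\<in>U. H w = q w" by blast
      have "H holomorphic_on U" by (rule holomorphic_transform[OF U(3)]) (use U(4) in auto)
      then show "H field_differentiable at k within UNIV"
        using holomorphic_on_imp_differentiable_at U by blast
    qed
    show "H z \<noteq> 0" "g z = f z * H z" for z using loc[of z] by auto
  qed
qed

text \<open>Reflecting the factorisation at \<open>a\<close> in the imaginary axis gives one at
  \<open>- cnj a\<close> with the same exponent; the sign (-1)^n goes into the cofactor.\<close>

lemma zorder_neg_cnj: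
  fixes f :: "complex \<Rightarrow> complex"
  assumes f: "f holomorphic_on UNIV" "f w0 \<noteq> 0" and sym: "\<And>w. f (- cnj w) = cnj (f w)"
  shows "zorder f (- cnj a) = zorder f a"
proof -
  obtain h n where h: "h holomorphic_on UNIV" "h a \<noteq> 0" "\<And>w. f w = (w - a) ^ n * h w" "zorder f a = int n"
    using entire_factor[OF f, of a] by metis
  have "zorder f (- cnj a) = int n"
  proof (rule zorder_eqI[of UNIV])
    have "(\<lambda>w. h (- w)) holomorphic_on UNIV"
      using holomorphic_on_compose[OF holomorphic_on_minus[OF holomorphic_on_ident], of h UNIV]
        holomorphic_on_subset[OF h(1)] by (auto simp: o_def)
    then have "cnj \<circ> (\<lambda>w. h (- w)) \<circ> cnj holomorphic_on UNIV"
      by (intro holomorphic_on_compose_cnj_cnj) (auto elim: holomorphic_on_subset)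
    then show "(\<lambda>w. (-1) ^ n * cnj (h (- cnj w))) holomorphic_on UNIV"
      by (intro holomorphic_intros) (simp add: o_def)
    fix w :: complex
    have "f w = cnj (f (- cnj w))" using sym[of w] by simp
    also have "\<dots> = (- w - cnj a) ^ n * cnj (h (- cnj w))" by (simp add: h(3))
    also have "(- w - cnj a) ^ n = ((-1) * (w - - cnj a)) ^ n" by simp
    also have "\<dots> = (-1) ^ n * (w - - cnj a) ^ n" by (rule power_mult_distrib)
    finally show "f w = (-1) ^ n * cnj (h (- cnj w)) * (w - - cnj a) powi int n"
      by (simp add: power_int_of_nat mult_ac)
  qed (use h in auto)
  then show ?thesis using h(4) by simp
qed

text \<open>Exponent 0 would make f 0 nonzero, and an exponent of at least 2 would make the
  derivative at 0 vanish.\<close>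

lemma simple_zero_exponent:
  fixes f h :: "complex \<Rightarrow> complex"
  assumes h: "h holomorphic_on UNIV" "h 0 \<noteq> 0" and fh: "\<And>w. f w = w ^ n * h w"
    and f0: "f 0 = 0" "(f has_field_derivative D) (at 0)" "D \<noteq> 0"
  shows "n = 1"
proof -
  have f: "f = (\<lambda>w. w ^ n * h w)" using fh by auto
  obtain h' where h': "(h has_field_derivative h') (at 0)"
    using h(1) unfolding holomorphic_on_def field_differentiable_def by auto
  have "(f has_field_derivative (of_nat n * 0 ^ (n - 1) * h 0 + h' * 0 ^ n)) (at 0)"
    unfolding f using DERIV_mult[OF DERIV_power[OF DERIV_ident, of n] h'] by simp
  from DERIV_unique[OF f0(2) this] have D: "D = of_nat n * 0 ^ (n - 1) * h 0 + h' * 0 ^ n" .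
  show ?thesis
  proof (cases n)
    case 0
    with f0(1) fh[of 0] h(2) show ?thesis by simp
  next
    case (Suc m)
    with D f0(3) show ?thesis by (cases m) auto
  qed
qed

text \<open>\<open>exponential_type_quotient\<close> starts from a nonzero value at the origin, so
  the common factor w is divided out first. Outside the unit disc this preserves the growth bound;
  inside, compactness supplies one.\<close>

lemma exponential_type_quotient_simple_zero:
  fixes f g :: "complex \<Rightarrow> complex"
  assumes f: "f holomorphic_on UNIV" and g: "g holomorphic_on UNIV"
    and f0: "f 0 = 0" "(f has_field_derivative D) (at 0)" "D \<noteq> 0"
    and gnz: "g w1 \<noteq> 0"
    and growth: "\<And>z. cmod (f z) \<le> C * exp (c * cmod z)" "\<And>z. cmod (g z) \<le> C * exp (c * cmod z)" and "0 < c"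
    and eq: "\<And>z. zorder f z = zorder g z"
  shows "\<exists>a b. \<forall>z. g z = f z * exp (a + b * z)"
proof -
  have "\<exists>w0. f w0 \<noteq> 0"
  proof (rule ccontr)
    assume "\<nexists>w0. f w0 \<noteq> 0"
    then have "f = (\<lambda>_. 0)" by auto
    with f0(2) have "((\<lambda>_. 0) has_field_derivative D) (at (0::complex))" by simp
    from DERIV_unique[OF this DERIV_const] f0(3) show False by simp
  qed
  then obtain w0 where w0: "f w0 \<noteq> 0" by blast
  obtain H where H: "H holomorphic_on UNIV" "\<And>z. H z \<noteq> 0" "\<And>z. g z = f z * H z"
    using entire_same_zorder[OF f w0 g gnz eq] by metis
  obtain h n where h: "h holomorphic_on UNIV" "h 0 \<noteq> 0" "\<And>w. f w = (w - 0) ^ n * h w"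
    using entire_factor[OF f w0, of 0] by metis
  have "n = 1" by (rule simple_zero_exponent[OF h(1,2) _ f0]) (simp add: h(3))
  then have fh: "f w = w * h w" for w by (simp add: h(3))
  have hH: "(\<lambda>w. h w * H w) holomorphic_on UNIV" by (intro holomorphic_intros h H)
  obtain B1 where B1: "0 < B1" "\<And>w. w \<in> cball 0 1 \<Longrightarrow> cmod (h w) \<le> B1"
  proof (rule continuous_on_bounded_normE[OF compact_cball])
    show "continuous_on (cball 0 1) (h)"
      by (intro holomorphic_on_imp_continuous_on holomorphic_on_subset[OF h(1)]) auto
  qed blast
  obtain B2 where B2: "0 < B2" "\<And>w. w \<in> cball 0 1 \<Longrightarrow> cmod (h w * H w) \<le> B2"
  proof (rule continuous_on_bounded_normE[OF compact_cball])
    show "continuous_on (cball 0 1) (\<lambda>w. h w * H w)"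
      by (intro holomorphic_on_imp_continuous_on holomorphic_on_subset[OF hH]) auto
  qed blast
  define C' where "C' = \<bar>C\<bar> + B1 + B2"
  have C': "C \<le> C'" "B1 \<le> C'" "B2 \<le> C'" "0 \<le> C'" using B1(1) B2(1) by (auto simp: C'_def)
  have bound: "cmod (y z) \<le> C' * exp (c * cmod z)"
    if "\<And>w. w \<in> cball 0 1 \<Longrightarrow> cmod (y w) \<le> B" "B \<le> C'" "\<And>w. cmod (w * y w) \<le> C * exp (c * cmod w)"
    for y :: "complex \<Rightarrow> complex" and B z
  proof (cases "cmod z \<le> 1")
    case True
    then have "cmod (y z) \<le> C'" using that(1)[of z] that(2) by simp
    also have "\<dots> \<le> C' * exp (c * cmod z)" using C'(4) \<open>0 < c\<close> by (simp add: mult_le_cancel_left1)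
    finally show ?thesis .
  next
    case False
    then have "1 * cmod (y z) \<le> cmod z * cmod (y z)" by (intro mult_right_mono) auto
    also have "\<dots> \<le> C * exp (c * cmod z)" using that(3)[of z] by (simp add: norm_mult)
    also have "\<dots> \<le> C' * exp (c * cmod z)" using C'(1) by (intro mult_right_mono) auto
    finally show ?thesis by simp
  qed
  have "\<exists>a b. \<forall>z. H z = exp (a + b * z)"
  proof (rule exponential_type_quotient[OF h(1,2) H(1,2) _ _ \<open>0 < c\<close>])
    show "cmod (h z) \<le> C' * exp (c * cmod z)" for z
      by (rule bound[OF B1(2) C'(2)]) (use growth(1) in \<open>auto simp: fh\<close>)
    show "cmod (h z * H z) \<le> C' * exp (c * cmod z)" for z
      by (rule bound[OF B2(2) C'(3)]) (use growth(2) in \<open>auto simp: H(3) fh mult.assoc\<close>)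
  qed
  then show ?thesis using H(3) by metis
qed

text \<open>The numerator does not vanish where the denominator does, so nothing cancels. Poles and
  orders depend only on punctured neighbourhoods, which matches the dummy values of the pressure at
  exceptional k.\<close>

lemma pole_multiplicity_eq_zorder:
  fixes f :: "complex \<Rightarrow> complex"
  assumes f: "f holomorphic_on UNIV" "f w0 \<noteq> 0" and g: "g holomorphic_on UNIV"
    and k: "f k = 0 \<Longrightarrow> g k \<noteq> 0" and F: "\<forall>\<^sub>F w in at k. F w = g w / f w"
  shows "int (pole_multiplicity F k) = zorder f k"
proof -
  obtain h n where h: "h holomorphic_on UNIV" "h k \<noteq> 0" "\<And>w. f w = (w - k) ^ n * h w" "zorder f k = int n"
    using entire_factor[OF f, of k] by metis
  obtain r where r: "0 < r" "\<And>w. w \<in> ball k r \<Longrightarrow> h w \<noteq> 0"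
    using entire_eventually_nonzero[OF h(1,2)] by metis
  define q where "q w = g w / h w" for w
  have q: "q holomorphic_on ball k r"
    unfolding q_def by (intro holomorphic_intros holomorphic_on_subset[OF g] holomorphic_on_subset[OF h(1)])
      (use r(2) in auto)
  have Fq: "\<forall>\<^sub>F w in at k. F w = q w / (w - k) ^ n"
    using F by eventually_elim (simp add: q_def h(3) field_simps)
  show ?thesis
  proof (cases "n = 0")
    case True
    have "\<not> is_pole q k" by (rule not_is_pole_holomorphic[OF _ _ q]) (use r in auto)
    then have "\<not> is_pole F k" using is_pole_cong[OF Fq refl] True by simp
    then show ?thesis using h(4) True by (simp add: pole_multiplicity_def)
  next
    case False
    then have "f k = 0" using h(3)[of k] by simp
    then have qk: "q k \<noteq> 0" using k h(2) by (simp add: q_def)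
    have "is_pole (\<lambda>w. q w / (w - k) ^ n) k"
      by (rule is_pole_basic[OF q]) (use r qk False in auto)
    then have pole: "is_pole F k" using is_pole_cong[OF Fq refl] by simp
    have "zorder (\<lambda>w. q w / (w - k) ^ n) k = - int n"
      by (rule zorder_eqI[OF _ _ q qk]) (use r in \<open>auto simp: power_int_minus power_int_of_nat divide_inverse\<close>)
    then have "zorder F k = - int n" using zorder_cong[OF Fq refl] by simp
    then show ?thesis using pole h(4) by (simp add: pole_multiplicity_def)
  qed
qed

section \<open>Zeros and growth of G\<close>

context tract
begin

lemma impedance_end: "impedance rl k = 1 - semicircle_transform (- 2 * \<i> * k * of_real rl)"
  by (rule impedance_eq) (use ends in simp)

lemma square_entire: "(\<lambda>k::complex. - k\<^sup>2) holomorphic_on UNIV"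
  by (intro holomorphic_intros)

lemma fundamental_entire: "(\<lambda>k. p1 k l) holomorphic_on UNIV" "(\<lambda>k. u1 k l) holomorphic_on UNIV"
  using holomorphic_on_compose[OF square_entire holomorphic_on_subset[OF p_ser_entire(1)[of 1 0 l]]]
    holomorphic_on_compose[OF square_entire holomorphic_on_subset[OF p_ser_entire(2)[of 1 0 l]]] ends
  by (simp_all add: o_def)

lemma impedance_entire: "impedance rl holomorphic_on UNIV"
proof -
  have "(\<lambda>k. - 2 * \<i> * k * of_real rl) holomorphic_on UNIV" by (intro holomorphic_intros)
  from holomorphic_on_compose[OF this holomorphic_on_subset[OF semicircle_transform_holomorphic]]
  have "(\<lambda>k. semicircle_transform (- 2 * \<i> * k * of_real rl)) holomorphic_on UNIV" by (simp add: o_def)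
  then have "(\<lambda>k. 1 - semicircle_transform (- 2 * \<i> * k * of_real rl)) holomorphic_on UNIV"
    by (intro holomorphic_intros)
  then show ?thesis unfolding impedance_end[abs_def] .
qed

lemma G_entire: "G_fun l r holomorphic_on UNIV"
proof -
  have "(\<lambda>k. - (impedance rl k * u1 k l / of_real rl + \<i> * k * of_real rl * p1 k l) / of_real r0) holomorphic_on UNIV"
    by (intro holomorphic_intros fundamental_entire impedance_entire) (use ends in auto)
  then show ?thesis unfolding G_eq[abs_def] .
qed

lemma impedance_sym: "impedance rl (- cnj k) = cnj (impedance rl k)"
  unfolding impedance_end using semicircle_transform_cnj[of "- 2 * \<i> * k * of_real rl"] by simp

lemma fundamental_sym: "p1 (- cnj k) l = cnj (p1 k l)" "u1 (- cnj k) l = cnj (u1 k l)"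
  using p_ser_cnj[of 1 0 l "- k\<^sup>2"] ends by simp_all

lemma G_sym: "G_fun l r (- cnj k) = cnj (G_fun l r k)"
  unfolding G_eq impedance_sym fundamental_sym by simp

lemma G_growth:
  obtains K C where "0 < K" "0 < C" "\<And>k. cmod (G_fun l r k) \<le> K * exp (C * cmod k)"
proof -
  from p_ser_growth[of 1 0] obtain K C where KC: "0 < K" "0 < C"
    and p: "\<And>k::complex. norm (p1 k l) \<le> K * exp (C * norm k)"
    and u: "\<And>k::complex. norm (u1 k l) \<le> K * exp (C * norm k)" by auto
  define c where "c = 2 * rl + 1 + C"
  show thesis
  proof (rule that[of "(3 * K / rl + rl * K) / r0" c])
    fix k
    have z: "cmod (impedance rl k) \<le> 3 * exp (2 * rl * cmod k)"
    proof -
      have "cmod (impedance rl k) \<le> 1 + 2 * exp (cmod (- 2 * \<i> * k * of_real rl))"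
        unfolding impedance_end
        by (rule order_trans[OF norm_triangle_ineq4])
          (simp only: norm_one add_left_mono[OF norm_semicircle_transform_le])
      also have "cmod (- 2 * \<i> * k * of_real rl) = 2 * rl * cmod k" using ends by (simp add: norm_mult)
      also have "1 + 2 * exp (2 * rl * cmod k) \<le> 3 * exp (2 * rl * cmod k)" using ends by simp
      finally show ?thesis .
    qed
    have 1: "cmod (impedance rl k * u1 k l) \<le> 3 * K * exp (c * cmod k)"
    proof -
      have "cmod (impedance rl k * u1 k l) \<le> (3 * exp (2 * rl * cmod k)) * (K * exp (C * cmod k))"
        unfolding norm_mult by (intro mult_mono z u) auto
      also have "\<dots> = 3 * K * exp ((2 * rl + C) * cmod k)" by (simp add: algebra_simps exp_add)
      also have "\<dots> \<le> 3 * K * exp (c * cmod k)"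
        using KC by (intro mult_left_mono) (auto simp: c_def algebra_simps)
      finally show ?thesis .
    qed
    have 2: "cmod (\<i> * k * p1 k l) \<le> K * exp (c * cmod k)"
    proof -
      have "cmod k \<le> exp (cmod k)" using exp_ge_add_one_self[of "cmod k"] by linarith
      then have "cmod (\<i> * k * p1 k l) \<le> exp (cmod k) * (K * exp (C * cmod k))"
        unfolding norm_mult using p[of k] by (simp only: norm_ii mult_1) (intro mult_mono; simp)
      also have "\<dots> = K * exp ((1 + C) * cmod k)" by (simp add: algebra_simps exp_add)
      also have "\<dots> \<le> K * exp (c * cmod k)"
        using KC ends by (intro mult_left_mono) (auto simp: c_def algebra_simps)
      finally show ?thesis .
    qed
    have "cmod (G_fun l r k) = cmod (impedance rl k * u1 k l / of_real rl + \<i> * k * of_real rl * p1 k l) / r0"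
      unfolding G_eq norm_divide norm_minus_cancel using ends by simp
    also have "\<dots> = cmod (impedance rl k * u1 k l / of_real rl + \<i> * k * p1 k l * of_real rl) / r0"
      by (simp only: mult_ac)
    also have "\<dots> \<le> (cmod (impedance rl k * u1 k l) / rl + cmod (\<i> * k * p1 k l) * rl) / r0"
      using ends by (intro divide_right_mono order_trans[OF norm_triangle_ineq]) (auto simp: norm_divide norm_mult)
    also have "\<dots> \<le> (3 * K * exp (c * cmod k) / rl + K * exp (c * cmod k) * rl) / r0"
      using ends by (intro divide_right_mono add_mono mult_right_mono 1 2) auto
    also have "\<dots> = (3 * K / rl + rl * K) / r0 * exp (c * cmod k)" by (simp add: algebra_simps add_divide_distrib)
    finally show "cmod (G_fun l r k) \<le> (3 * K / rl + rl * K) / r0 * exp (c * cmod k)" .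
  qed (use KC ends in \<open>auto simp: c_def intro!: divide_pos_pos add_pos_pos\<close>)
qed

text \<open>Both z and u vanish at k = 0, so their product has no first-order term; the derivative
  comes from the term linear in k alone.\<close>

lemma G_zero: "G_fun l r 0 = 0" "(G_fun l r has_field_derivative - \<i> * of_real (rl / r0)) (at 0)"
proof -
  have at0: "p1 0 l = 1" "u1 0 l = 0" "impedance rl 0 = 0"
    using p_ser_at_0[of 1 0 l] ends by (simp_all add: impedance_end semicircle_transform_0)
  show "G_fun l r 0 = 0" by (simp add: G_eq at0)
  obtain z' where z': "(impedance rl has_field_derivative z') (at 0)"
    using impedance_entire unfolding holomorphic_on_def field_differentiable_def by auto
  obtain u' where u': "((\<lambda>k. u1 k l) has_field_derivative u') (at 0)"
    using fundamental_entire(2) unfolding holomorphic_on_def field_differentiable_def by auto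
  obtain p' where p': "((\<lambda>k. p1 k l) has_field_derivative p') (at 0)"
    using fundamental_entire(1) unfolding holomorphic_on_def field_differentiable_def by auto
  have "((\<lambda>k. - (impedance rl k * u1 k l / of_real rl + \<i> * k * of_real rl * p1 k l) / of_real r0)
      has_field_derivative
      - ((z' * u1 0 l + u' * impedance rl 0) / of_real rl + (\<i> * of_real rl * p1 0 l + p' * (\<i> * 0 * of_real rl))) / of_real r0) (at 0)"
    by (intro DERIV_cdivide DERIV_minus DERIV_add DERIV_mult z' u' p')
      (auto intro!: derivative_eq_intros)
  then show "(G_fun l r has_field_derivative - \<i> * of_real (rl / r0)) (at 0)"
    unfolding G_eq[abs_def] at0 by simp
qed

text \<open>These are \<phi>(k, l) and (\<phi>' - (r'/r) \<phi>) / \<eta> at x = l and k = i \<eta>.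
  Division by \<eta> gives both the same leading growth.\<close>

definition phi_im :: "real \<Rightarrow> real" where "phi_im \<eta> = rl * p_ser 1 0 (\<eta>\<^sup>2) l / r0"
definition w_im :: "real \<Rightarrow> real" where "w_im \<eta> = u_ser 1 0 (\<eta>\<^sup>2) l / (r0 * rl * \<eta>)"

lemma phi_im_pos: "0 < phi_im \<eta>" and w_im_nonneg: "0 < \<eta> \<Longrightarrow> 0 \<le> w_im \<eta>"
  using p_ser_nonneg[of 1 0 l "\<eta>\<^sup>2"] ends by (auto simp: phi_im_def w_im_def)

lemma fundamental_imaginary:
  "p1 (\<i> * of_real \<eta>) l = of_real (p_ser 1 0 (\<eta>\<^sup>2) l)" "u1 (\<i> * of_real \<eta>) l = of_real (u_ser 1 0 (\<eta>\<^sup>2) l)"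
  using p_ser_of_real[of 1 0 l "\<eta>\<^sup>2", where 'a = complex] ends by (simp_all add: power_mult_distrib)

lemma impedance_imaginary: "impedance rl (\<i> * of_real \<eta>) = of_real (1 - semicircle_transform (2 * \<eta> * rl))"
proof -
  have "- 2 * \<i> * (\<i> * of_real \<eta>) * of_real rl = complex_of_real (2 * \<eta> * rl)" by simp
  then show ?thesis unfolding impedance_end by (simp only: semicircle_transform_of_real of_real_diff of_real_1)
qed

text \<open>Since p and u are even in k, both half-axes involve the same two unknowns; only the
  impedance tells them apart.\<close>

lemma G_imaginary:
  assumes "0 < \<eta>"
  shows "G_fun l r (\<i> * of_real \<eta>) = of_real (\<eta> * ((semicircle_transform (2 * \<eta> * rl) - 1) * w_im \<eta> + phi_im \<eta>))"
    and "G_fun l r (- (\<i> * of_real \<eta>)) = of_real (- \<eta> * ((1 - semicircle_transform (- (2 * \<eta> * rl))) * w_im \<eta> + phi_im \<eta>))"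
proof -
  have neg: "- (\<i> * of_real \<eta>) = \<i> * complex_of_real (- \<eta>)" by simp
  have i: "\<i> * (\<i> * of_real x) * y = - (of_real x * y :: complex)" for x y by simp
  show "G_fun l r (\<i> * of_real \<eta>) = of_real (\<eta> * ((semicircle_transform (2 * \<eta> * rl) - 1) * w_im \<eta> + phi_im \<eta>))"
    unfolding G_eq fundamental_imaginary impedance_imaginary i
    using ends assms by (simp add: phi_im_def w_im_def field_simps)
  show "G_fun l r (- (\<i> * of_real \<eta>)) = of_real (- \<eta> * ((1 - semicircle_transform (- (2 * \<eta> * rl))) * w_im \<eta> + phi_im \<eta>))"
    unfolding neg unfolding G_eq fundamental_imaginary impedance_imaginary i
    using ends assms by (simp add: phi_im_def w_im_def field_simps)
qed

text \<open>On either half-axis the bracket in \<open>G_imaginary\<close> is a sum of a nonnegative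
  and a positive term: the transform exceeds 1 upwards and stays below 1 downwards.\<close>

lemma G_imaginary_nonzero:
  assumes "Re k = 0" "k \<noteq> 0"
  shows "G_fun l r k \<noteq> 0"
proof -
  have k: "k = \<i> * of_real (Im k)" using assms(1) by (simp add: complex_eq_iff)
  have "Im k \<noteq> 0" using assms by (auto simp: complex_eq_iff)
  show ?thesis
  proof (cases "0 < Im k")
    case True
    have "1 < semicircle_transform (2 * Im k * rl)"
      by (rule semicircle_transform_gt_1) (use True ends in simp)
    then have "0 < (semicircle_transform (2 * Im k * rl) - 1) * w_im (Im k) + phi_im (Im k)"
      using w_im_nonneg[OF True] phi_im_pos[of "Im k"] by (intro add_nonneg_pos) auto
    then show ?thesis using True by (subst k, subst G_imaginary(1)) (auto simp flip: of_real_mult of_real_diff of_real_add)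
  next
    case False
    define \<eta> where "\<eta> = - Im k"
    have \<eta>: "0 < \<eta>" using False \<open>Im k \<noteq> 0\<close> by (simp add: \<eta>_def)
    have k': "k = - (\<i> * of_real \<eta>)" using k by (simp add: \<eta>_def)
    have "semicircle_transform (- (2 * \<eta> * rl)) < 1"
      by (rule semicircle_transform_lt_1) (use \<eta> ends in simp)
    then have "0 < (1 - semicircle_transform (- (2 * \<eta> * rl))) * w_im \<eta> + phi_im \<eta>"
      using w_im_nonneg[OF \<eta>] phi_im_pos[of \<eta>] by (intro add_nonneg_pos) auto
    then show ?thesis using \<eta> by (subst k', subst G_imaginary(2)) (auto simp flip: of_real_mult of_real_diff of_real_add)
  qed
qed

text \<open>A zero of \<open>p\<^sub>1\<close> is an eigenvalue of a self-adjoint problem: \<open>Im (u\<^sub>1 p\<^sub>1\<^sup>*)\<close> vanishes at both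
  ends and has derivative \<open>- Im (k\<^sup>2) r\<^sup>2 |p\<^sub>1|\<^sup>2\<close>.\<close>

lemma p1_zero_real:
  assumes "p1 k l = 0"
  shows "Im (k\<^sup>2) = 0"
proof (rule ccontr)
  assume nz: "Im (k\<^sup>2) \<noteq> 0"
  define D where "D x = Im (u1 k x * cnj (p1 k x))" for x
  have der: "(D has_real_derivative - Im (k\<^sup>2) * (r x)\<^sup>2 * (cmod (p1 k x))\<^sup>2) (at x within {0..l})" if x: "x \<in> {0..l}" for x
  proof -
    have p: "(p1 k has_vector_derivative u1 k x / of_real ((r x)\<^sup>2)) (at x within {0..l})"
      and u: "(u1 k has_vector_derivative - k\<^sup>2 * of_real ((r x)\<^sup>2) * p1 k x) (at x within {0..l})"
      using p_ser_deriv[of 1 0 x "- k\<^sup>2"] u_ser_deriv[of 1 0 x "- k\<^sup>2"] x by simp_all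
    have "((\<lambda>x. u1 k x * cnj (p1 k x)) has_vector_derivative
        u1 k x * cnj (u1 k x / of_real ((r x)\<^sup>2)) + - k\<^sup>2 * of_real ((r x)\<^sup>2) * p1 k x * cnj (p1 k x)) (at x within {0..l})"
      by (intro has_vector_derivative_mult u has_vector_derivative_cnj p)
    then have "((\<lambda>x. Im (u1 k x * cnj (p1 k x))) has_vector_derivative
        Im (u1 k x * cnj (u1 k x / of_real ((r x)\<^sup>2)) + - k\<^sup>2 * of_real ((r x)\<^sup>2) * p1 k x * cnj (p1 k x))) (at x within {0..l})"
      by (rule bounded_linear.has_vector_derivative[OF bounded_linear_Im])
    moreover have "Im (u1 k x * cnj (u1 k x / of_real ((r x)\<^sup>2)) + - k\<^sup>2 * of_real ((r x)\<^sup>2) * p1 k x * cnj (p1 k x))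
      = - Im (k\<^sup>2) * (r x)\<^sup>2 * (cmod (p1 k x))\<^sup>2"
    proof -
      have "u1 k x * cnj (u1 k x / of_real ((r x)\<^sup>2)) = of_real ((cmod (u1 k x))\<^sup>2 / (r x)\<^sup>2)"
        by (simp only: complex_cnj_divide complex_cnj_complex_of_real times_divide_eq_right
            complex_norm_square[symmetric] of_real_divide)
      moreover have "- k\<^sup>2 * of_real ((r x)\<^sup>2) * p1 k x * cnj (p1 k x)
          = of_real ((r x)\<^sup>2 * (cmod (p1 k x))\<^sup>2) * (- k\<^sup>2)"
        by (simp only: mult.assoc complex_norm_square[symmetric] of_real_mult) (simp only: mult_ac)
      moreover have "Im (of_real A + of_real B * w) = B * Im w" for A B w by simp
      ultimately show ?thesis by (simp only:) simp
    qed
    ultimately show ?thesis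
      unfolding D_def[abs_def] by (simp add: has_real_derivative_iff_has_vector_derivative)
  qed
  let ?f = "\<lambda>x. - Im (k\<^sup>2) * (r x)\<^sup>2 * (cmod (p1 k x))\<^sup>2"
  have "(?f has_integral D l - D 0) {0..l}"
    by (rule fundamental_theorem_of_calculus)
      (use der l_pos in \<open>auto simp: has_real_derivative_iff_has_vector_derivative\<close>)
  moreover have "D l = 0" "D 0 = 0" using assms by (simp_all add: D_def p_ser_initial)
  ultimately have I0: "(?f has_integral 0) {0..l}" by simp
  let ?g = "\<lambda>x. (r x)\<^sup>2 * (cmod (p1 k x))\<^sup>2"
  have "(?g has_integral 0) {0..l}"
    using has_integral_mult_right[OF I0, of "- 1 / Im (k\<^sup>2)"] nz by (simp add: mult.assoc)
  then have "integral {0..l} ?g = 0" by (rule integral_unique)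
  moreover have "continuous_on {0..l} ?g"
    by (intro continuous_intros r_cont continuous_p_ser) auto
  ultimately have "\<forall>x\<in>{0..l}. ?g x = 0"
    using integral_eq_0_iff[of 0 l ?g] l_pos by simp
  then have "?g 0 = 0" using ends by blast
  then show False using ends by (simp add: p_ser_initial)
qed

text \<open>At a common zero G reduces to a multiple of k p, so p(k, l) = 0 and k^2 is real. With Re
  k > 0 this makes k real, where the impedance has positive real part.\<close>

lemma impedance_nonzero_at_zero_of_G:
  assumes "0 < Re k" "G_fun l r k = 0"
  shows "impedance rl k \<noteq> 0"
proof
  assume z: "impedance rl k = 0"
  have "k \<noteq> 0" using assms(1) by auto
  then have "p1 k l = 0" using assms(2) z ends by (simp add: G_eq)
  then have "Im (k\<^sup>2) = 0" by (rule p1_zero_real)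
  then have "Im k = 0" using assms(1) by (simp add: power2_eq_square)
  then have k: "k = of_real (Re k)" by (simp add: complex_eq_iff)
  have eq: "- 2 * \<i> * k * of_real rl = \<i> * complex_of_real (- 2 * Re k * rl)"
    by (subst k) simp
  have "Re (semicircle_transform (- 2 * \<i> * k * of_real rl)) < 1"
    unfolding eq by (rule Re_semicircle_transform_imaginary_lt_1) (use assms(1) ends in simp)
  then show False using z by (simp add: impedance_end)
qed

lemma G_nonzero_somewhere: "G_fun l r \<i> \<noteq> 0"
  by (rule G_imaginary_nonzero) auto

lemma right_poles_eq:
  assumes "c > 0" "\<mu> > 0"
  shows "int (right_poles c \<mu> l r k) = (if 0 < Re k then zorder (G_fun l r) k else 0)"
proof (cases "0 < Re k")
  case True
  define g where "g k = - (\<i> * k * of_real c * of_real \<mu> * impedance rl k) / of_real (pi * r0 * rl)" for k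
  have g: "g holomorphic_on UNIV"
    unfolding g_def by (intro holomorphic_intros impedance_entire) (use ends in auto)
  have "int (pole_multiplicity (pressure_end c \<mu> l r) k) = zorder (G_fun l r) k"
  proof (rule pole_multiplicity_eq_zorder[OF G_entire G_nonzero_somewhere g])
    show "g k \<noteq> 0" if "G_fun l r k = 0"
      using impedance_nonzero_at_zero_of_G[OF True that] assms True ends by (auto simp: g_def)
    have zi: "impedance rl \<i> \<noteq> 0"
      using impedance_imaginary[of 1] semicircle_transform_gt_1[of "2 * rl"] ends by (auto simp flip: of_real_diff)
    \<comment> \<open>Both z and G are entire and nonzero at the imaginary unit, hence nonzero in a
      punctured neighbourhood of k. There the explicit formula for the pressure holds.\<close>
    have ev: "\<forall>\<^sub>F w in at k. f w \<noteq> 0" if f: "f holomorphic_on UNIV" "f \<i> \<noteq> 0" for f :: "complex \<Rightarrow> complex"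
    proof -
      obtain h n where h: "h holomorphic_on UNIV" "h k \<noteq> 0" "\<And>w. f w = (w - k) ^ n * h w"
        using entire_factor[OF f, of k] by metis
      obtain \<rho> where \<rho>: "0 < \<rho>" "\<And>w. w \<in> ball k \<rho> \<Longrightarrow> h w \<noteq> 0"
        using entire_eventually_nonzero[OF h(1,2)] by metis
      have "\<forall>\<^sub>F w in at k. w \<in> ball k \<rho>" using \<rho>(1) by (intro eventually_at_in_open') auto
      with eventually_neq_at_within[of k k] show ?thesis
        by eventually_elim (use h \<rho> in auto)
    qed
    show "\<forall>\<^sub>F w in at k. pressure_end c \<mu> l r w = g w / G_fun l r w"
      using ev[OF impedance_entire zi] ev[OF G_entire G_nonzero_somewhere]
      by eventually_elim (simp add: pressure_end_eq g_def)
  qed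
  then show ?thesis using True by (simp add: right_poles_def)
qed (simp add: right_poles_def)

text \<open>The third limit is the second term of the expansion: it is driven by s(l) = r_l'/r_l and
  makes this quotient visible on the imaginary axis.\<close>

lemma end_asymptotics:
  "((\<lambda>\<eta>. phi_im \<eta> * exp (- \<eta> * l)) \<longlongrightarrow> 1 / 2) at_top"
  "((\<lambda>\<eta>. w_im \<eta> * exp (- \<eta> * l)) \<longlongrightarrow> 1 / 2) at_top"
  "((\<lambda>\<eta>. \<eta> * (phi_im \<eta> - w_im \<eta>) * exp (- \<eta> * l)) \<longlongrightarrow> dx l r l / rl / 2) at_top"
proof -
  define s where "s x = dx l r x / r x" for x
  define \<Phi> where "\<Phi> \<eta> x = r x / r0 * p_ser 1 0 (\<eta>\<^sup>2) x" for \<eta> x :: real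
  define W where "W \<eta> x = u_ser 1 0 (\<eta>\<^sup>2) x / (r0 * \<eta> * r x)" for \<eta> x :: real
  \<comment> \<open>Half sum and half difference diagonalise the leading part of \<Phi>' = s \<Phi>
    + \<eta> W, W' = \<eta> \<Phi> - s W. The factor exp(-\<eta> x) leaves the growing amplitude
    undamped and the other with damping 2 \<eta>.\<close>
  define a where "a \<eta> x = (\<Phi> \<eta> x + W \<eta> x) / 2 * exp (- \<eta> * x)" for \<eta> x
  define b where "b \<eta> x = (\<Phi> \<eta> x - W \<eta> x) / 2 * exp (- \<eta> * x)" for \<eta> x
  have s: "continuous_on {0..l} s"
    unfolding s_def using r_nonzero by (intro continuous_intros dr_cont r_cont) auto
  have cont: "continuous_on {0..l} (\<Phi> \<eta>)" "continuous_on {0..l} (W \<eta>)" if "0 < \<eta>" for \<eta>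
    unfolding \<Phi>_def W_def using r_nonzero ends that
    by (intro continuous_intros continuous_p_ser r_cont; force)+
  have deriv: "(\<Phi> \<eta> has_real_derivative s x * \<Phi> \<eta> x + \<eta> * W \<eta> x) (at x)"
    "(W \<eta> has_real_derivative \<eta> * \<Phi> \<eta> x - s x * W \<eta> x) (at x)"
    if \<eta>: "0 < \<eta>" and x: "x \<in> {0<..<l}" for \<eta> x
  proof -
    have xl: "x \<in> {0..l}" using x by auto
    have r: "(r has_real_derivative dx l r x) (at x)"
      using r_deriv[OF xl] x by (simp add: has_real_derivative_iff_has_vector_derivative at_within_Icc_at)
    have p: "(p_ser 1 0 (\<eta>\<^sup>2) has_real_derivative u_ser 1 0 (\<eta>\<^sup>2) x / (r x)\<^sup>2) (at x)"
      and u: "(u_ser 1 0 (\<eta>\<^sup>2) has_real_derivative \<eta>\<^sup>2 * (r x)\<^sup>2 * p_ser 1 0 (\<eta>\<^sup>2) x) (at x)"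
      using p_ser_deriv_at[of 1 0 x "\<eta>\<^sup>2"] x by (simp_all add: has_real_derivative_iff_has_vector_derivative)
    have rx: "r x \<noteq> 0" "r0 \<noteq> 0" using r_nonzero[OF xl] ends by auto
    have "(\<Phi> \<eta> has_real_derivative (dx l r x / r0) * p_ser 1 0 (\<eta>\<^sup>2) x + u_ser 1 0 (\<eta>\<^sup>2) x / (r x)\<^sup>2 * (r x / r0)) (at x)"
      unfolding \<Phi>_def by (intro DERIV_mult DERIV_cdivide r p)
    moreover have "(dx l r x / r0) * p_ser 1 0 (\<eta>\<^sup>2) x + u_ser 1 0 (\<eta>\<^sup>2) x / (r x)\<^sup>2 * (r x / r0)
        = s x * \<Phi> \<eta> x + \<eta> * W \<eta> x"
      using rx \<eta> by (simp add: s_def \<Phi>_def W_def power2_eq_square)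
    ultimately show "(\<Phi> \<eta> has_real_derivative s x * \<Phi> \<eta> x + \<eta> * W \<eta> x) (at x)" by simp
    have "(W \<eta> has_real_derivative (\<eta>\<^sup>2 * (r x)\<^sup>2 * p_ser 1 0 (\<eta>\<^sup>2) x * (r0 * \<eta> * r x)
        - u_ser 1 0 (\<eta>\<^sup>2) x * (r0 * \<eta> * dx l r x)) / ((r0 * \<eta> * r x) * (r0 * \<eta> * r x))) (at x)"
      unfolding W_def using rx \<eta> by (intro DERIV_divide DERIV_cmult r u) auto
    moreover have "(\<eta>\<^sup>2 * (r x)\<^sup>2 * p_ser 1 0 (\<eta>\<^sup>2) x * (r0 * \<eta> * r x)
        - u_ser 1 0 (\<eta>\<^sup>2) x * (r0 * \<eta> * dx l r x)) / ((r0 * \<eta> * r x) * (r0 * \<eta> * r x)) = \<eta> * \<Phi> \<eta> x - s x * W \<eta> x"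
      using rx \<eta> by (simp add: s_def \<Phi>_def W_def power2_eq_square field_simps)
    ultimately show "(W \<eta> has_real_derivative \<eta> * \<Phi> \<eta> x - s x * W \<eta> x) (at x)" by simp
  qed
  have init: "\<Phi> \<eta> 0 = 1" "W \<eta> 0 = 0" for \<eta>
    using ends by (simp_all add: \<Phi>_def W_def p_ser_initial)
  have ca: "continuous_on {0..l} (a \<eta>)" "continuous_on {0..l} (b \<eta>)" if "0 < \<eta>" for \<eta>
    unfolding a_def b_def by (intro continuous_intros cont that; simp)+
  have da: "(a \<eta> has_real_derivative s x * b \<eta> x) (at x)"
    "(b \<eta> has_real_derivative - (2 * \<eta>) * b \<eta> x + s x * a \<eta> x) (at x)"
    if \<eta>: "0 < \<eta>" and x: "x \<in> {0<..<l}" for \<eta> x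
    unfolding a_def b_def using deriv[OF that]
    by (auto intro!: derivative_eq_intros simp: field_simps)
  have lim: "((\<lambda>\<eta>. a \<eta> l) \<longlongrightarrow> 1 / 2) at_top" "((\<lambda>\<eta>. 2 * \<eta> * b \<eta> l) \<longlongrightarrow> s l / 2) at_top"
    "((\<lambda>\<eta>. b \<eta> l) \<longlongrightarrow> 0) at_top"
    by (rule dirac_asymptotics[OF l_pos s ca(1) ca(2) _ _ da(1) da(2)]; simp add: a_def b_def init)+
  have eq: "\<Phi> \<eta> l = phi_im \<eta>" "W \<eta> l = w_im \<eta>" for \<eta>
    by (simp_all add: \<Phi>_def W_def phi_im_def w_im_def mult_ac)
  have "((\<lambda>\<eta>. a \<eta> l + b \<eta> l) \<longlongrightarrow> 1 / 2) at_top" "((\<lambda>\<eta>. a \<eta> l - b \<eta> l) \<longlongrightarrow> 1 / 2) at_top"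
    using tendsto_add[OF lim(1,3)] tendsto_diff[OF lim(1,3)] by simp_all
  then show "((\<lambda>\<eta>. phi_im \<eta> * exp (- \<eta> * l)) \<longlongrightarrow> 1 / 2) at_top"
    "((\<lambda>\<eta>. w_im \<eta> * exp (- \<eta> * l)) \<longlongrightarrow> 1 / 2) at_top"
    by (simp_all add: a_def b_def eq flip: distrib_right left_diff_distrib add_divide_distrib diff_divide_distrib)
  show "((\<lambda>\<eta>. \<eta> * (phi_im \<eta> - w_im \<eta>) * exp (- \<eta> * l)) \<longlongrightarrow> dx l r l / rl / 2) at_top"
    using lim(2) by (simp add: b_def eq s_def mult.assoc)
qed

end

section \<open>Determination of the data\<close>

text \<open>Shifting \<eta> by t multiplies the function by exp(\<beta> t) without changing the
  limit, so exp(\<beta> t) = 1 for all real t; the derivative at t = 0 is \<beta>.\<close>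

lemma exp_affine_tendsto_1:
  fixes a \<beta> :: complex
  assumes "((\<lambda>\<eta>. exp (a + \<beta> * of_real \<eta>)) \<longlongrightarrow> 1) at_top"
  shows "\<beta> = 0" "exp a = 1"
proof -
  have one: "exp (\<beta> * of_real t) = 1" for t
  proof -
    have "filterlim (\<lambda>\<eta>::real. \<eta> + t) at_top at_top"
      by (rule filterlim_tendsto_add_at_top[where c = t, OF tendsto_const filterlim_ident, simplified add.commute])
    from filterlim_compose[OF assms this]
    have "((\<lambda>\<eta>. exp (a + \<beta> * of_real (\<eta> + t))) \<longlongrightarrow> 1) at_top" .
    moreover have "exp (a + \<beta> * of_real (\<eta> + t)) = exp (a + \<beta> * of_real \<eta>) * exp (\<beta> * of_real t)" for \<eta>
      by (simp add: algebra_simps flip: exp_add)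
    ultimately have "((\<lambda>\<eta>. exp (a + \<beta> * of_real \<eta>) * exp (\<beta> * of_real t)) \<longlongrightarrow> 1) at_top" by simp
    moreover have "((\<lambda>\<eta>. exp (a + \<beta> * of_real \<eta>) * exp (\<beta> * of_real t)) \<longlongrightarrow> 1 * exp (\<beta> * of_real t)) at_top"
      by (intro tendsto_mult assms tendsto_const)
    ultimately show ?thesis using tendsto_unique[OF trivial_limit_at_top_linorder] by fastforce
  qed
  have "((\<lambda>t. exp (\<beta> * of_real t)) has_vector_derivative \<beta>) (at 0)"
  proof -
    have "((\<lambda>z. exp (\<beta> * z)) has_field_derivative \<beta>) (at (of_real 0))"
      by (auto intro!: derivative_eq_intros)
    from has_vector_derivative_real_field[OF this] show ?thesis by simp
  qed
  then have "((\<lambda>t::real. 1) has_vector_derivative \<beta>) (at 0)" by (simp add: one)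
  then show "\<beta> = 0" using vector_derivative_unique_at has_vector_derivative_const by blast
  with assms have "((\<lambda>\<eta>::real. exp a) \<longlongrightarrow> 1) at_top" by simp
  from tendsto_unique[OF trivial_limit_at_top_linorder tendsto_const this] show "exp a = 1" .
qed

context tract
begin

text \<open>\<open>G_up\<close> is G(i \<eta>) / \<eta> and \<open>G_down\<close> is -G(-i \<eta>) /
  \<eta>. Both are positive reals for \<eta> > 0, so logarithms and quotients are
  unproblematic.\<close>

definition G_up :: "real \<Rightarrow> real" where
  "G_up \<eta> = (semicircle_transform (2 * \<eta> * rl) - 1) * w_im \<eta> + phi_im \<eta>"

definition G_down :: "real \<Rightarrow> real" where
  "G_down \<eta> = (1 - semicircle_transform (- (2 * \<eta> * rl))) * w_im \<eta> + phi_im \<eta>"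

lemma G_up_pos: "0 < \<eta> \<Longrightarrow> 0 < G_up \<eta>"
  unfolding G_up_def using w_im_nonneg[of \<eta>] phi_im_pos[of \<eta>] semicircle_transform_gt_1[of "2 * \<eta> * rl"] ends
  by (intro add_nonneg_pos mult_nonneg_nonneg) auto

lemma G_down_pos: "0 < \<eta> \<Longrightarrow> 0 < G_down \<eta>"
  unfolding G_down_def using w_im_nonneg[of \<eta>] phi_im_pos[of \<eta>] semicircle_transform_lt_1[of "- (2 * \<eta> * rl)"] ends
  by (intro add_nonneg_pos mult_nonneg_nonneg) auto

lemma filterlim_scale: "filterlim (\<lambda>\<eta>. 2 * \<eta> * rl) at_top at_top"
  using ends by real_asymp

lemma G_down_asymptotics: "((\<lambda>\<eta>. G_down \<eta> * exp (- \<eta> * l)) \<longlongrightarrow> 1) at_top"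
proof -
  have "((\<lambda>\<eta>. semicircle_transform (- (2 * \<eta> * rl))) \<longlongrightarrow> 0) at_top"
    by (rule filterlim_compose[OF semicircle_transform_tendsto_0 filterlim_scale])
  then have "((\<lambda>\<eta>. (1 - semicircle_transform (- (2 * \<eta> * rl))) * (w_im \<eta> * exp (- \<eta> * l))
      + phi_im \<eta> * exp (- \<eta> * l)) \<longlongrightarrow> (1 - 0) * (1 / 2) + 1 / 2) at_top"
    by (intro tendsto_add tendsto_mult tendsto_diff tendsto_const end_asymptotics)
  then show ?thesis by (simp add: G_down_def algebra_simps)
qed

lemma G_up_asymptotics: "((\<lambda>\<eta>. ln (G_up \<eta>) / \<eta>) \<longlongrightarrow> l + 2 * rl) at_top"
proof -
  define T where "T \<eta> = semicircle_transform (2 * \<eta> * rl)" for \<eta>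
  define y where "y \<eta> = (phi_im \<eta> - w_im \<eta>) * exp (- \<eta> * l)" for \<eta>
  \<comment> \<open>Chosen so that G_up exp(-\<eta> l) = T q, where q tends to 1/2 and contributes
    nothing to the rate; T alone carries the growth 2 r_l of the impedance.\<close>
  define q where "q \<eta> = w_im \<eta> * exp (- \<eta> * l) + y \<eta> / T \<eta>" for \<eta>
  have T: "1 < T \<eta>" if "0 < \<eta>" for \<eta>
    unfolding T_def using that ends by (intro semicircle_transform_gt_1) simp
  have "(y \<longlongrightarrow> 1 / 2 - 1 / 2) at_top"
    unfolding y_def left_diff_distrib by (intro tendsto_diff end_asymptotics)
  then have "(y \<longlongrightarrow> 0) at_top" by simp
  then have "((\<lambda>\<eta>. y \<eta> / T \<eta>) \<longlongrightarrow> 0) at_top"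
  proof (rule Lim_transform_bound[rotated])
    show "\<forall>\<^sub>F \<eta> in at_top. norm (y \<eta> / T \<eta>) \<le> norm (y \<eta>)"
      using eventually_gt_at_top[of 0]
    proof eventually_elim
      case (elim \<eta>)
      with T[OF elim] show ?case by (simp add: divide_le_eq mult_le_cancel_left1)
    qed
  qed
  from tendsto_add[OF end_asymptotics(2) this] have q: "(q \<longlongrightarrow> 1 / 2) at_top"
    unfolding q_def[abs_def] by simp
  have "((\<lambda>\<eta>. ln (q \<eta>) * (1 / \<eta>)) \<longlongrightarrow> ln (1 / 2) * 0) at_top"
  proof (intro tendsto_mult tendsto_ln q)
    show "((\<lambda>\<eta>::real. 1 / \<eta>) \<longlongrightarrow> 0) at_top" by real_asymp
  qed simp
  moreover have "((\<lambda>\<eta>. ln (T \<eta>) / (2 * \<eta> * rl) * (2 * rl)) \<longlongrightarrow> 1 * (2 * rl)) at_top"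
    unfolding T_def
    by (intro tendsto_mult tendsto_const filterlim_compose[OF ln_semicircle_transform filterlim_scale])
  ultimately have "((\<lambda>\<eta>. ln (q \<eta>) * (1 / \<eta>) + (l + ln (T \<eta>) / (2 * \<eta> * rl) * (2 * rl)))
      \<longlongrightarrow> ln (1 / 2) * 0 + (l + 1 * (2 * rl))) at_top"
    by (intro tendsto_add tendsto_const)
  then have lim: "((\<lambda>\<eta>. ln (q \<eta>) * (1 / \<eta>) + (l + ln (T \<eta>) / (2 * \<eta> * rl) * (2 * rl))) \<longlongrightarrow> l + 2 * rl) at_top"
    by simp
  have "\<forall>\<^sub>F \<eta> in at_top. ln (q \<eta>) * (1 / \<eta>) + (l + ln (T \<eta>) / (2 * \<eta> * rl) * (2 * rl)) = ln (G_up \<eta>) / \<eta>"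
    using eventually_gt_at_top[of 0] order_tendstoD(1)[OF q, of 0, simplified]
  proof eventually_elim
    case (elim \<eta>)
    then have \<eta>: "0 < \<eta>" "0 < q \<eta>" by simp_all
    note T = T[OF \<eta>(1)]
    have "T \<eta> * q \<eta> = G_up \<eta> * exp (- \<eta> * l)"
    proof -
      have "T \<eta> * q \<eta> = T \<eta> * (w_im \<eta> * exp (- \<eta> * l)) + y \<eta>"
        using T by (simp add: q_def distrib_left)
      also have "\<dots> = ((T \<eta> - 1) * w_im \<eta> + phi_im \<eta>) * exp (- \<eta> * l)"
        by (simp add: y_def algebra_simps)
      finally show ?thesis by (simp only: G_up_def T_def)
    qed
    then have "G_up \<eta> = T \<eta> * q \<eta> * exp (\<eta> * l)"
      by (simp add: mult.assoc flip: exp_add)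
    then have "ln (G_up \<eta>) = ln (T \<eta>) + ln (q \<eta>) + \<eta> * l"
      using T \<eta> by (simp add: ln_mult)
    then show ?case using \<eta> ends by (simp add: field_simps)
  qed
  from Lim_transform_eventually[OF lim this] show ?thesis .
qed

text \<open>With these facts the orders of the zeros in the right half-plane fix the orders in the
  whole plane.\<close>

lemma G_zorder:
  shows "zorder (G_fun l r) 0 = 1"
    and "Re k = 0 \<Longrightarrow> k \<noteq> 0 \<Longrightarrow> zorder (G_fun l r) k = 0"
    and "zorder (G_fun l r) (- cnj k) = zorder (G_fun l r) k"
proof -
  show "zorder (G_fun l r) (- cnj k) = zorder (G_fun l r) k"
    by (rule zorder_neg_cnj[OF G_entire G_nonzero_somewhere G_sym])
  show "zorder (G_fun l r) k = 0" if "Re k = 0" "k \<noteq> 0"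
    by (rule zorder_eqI[of UNIV _ "G_fun l r"]) (use G_imaginary_nonzero[OF that] G_entire in auto)
  obtain h n where h: "h holomorphic_on UNIV" "h 0 \<noteq> 0" "\<And>w. G_fun l r w = (w - 0) ^ n * h w"
      "zorder (G_fun l r) 0 = int n"
    using entire_factor[OF G_entire G_nonzero_somewhere, of 0] by metis
  show "zorder (G_fun l r) 0 = 1"
    using simple_zero_exponent[OF h(1,2) _ G_zero] h(3,4) ends by simp
qed

end

lemma G_determined:
  assumes "tract l r" "tract l' r'" and "c > 0" "\<mu> > 0" and eq: "right_poles c \<mu> l r = right_poles c \<mu> l' r'"
  shows "l + r l = l' + r' l'" "l = l' \<Longrightarrow> G_fun l r = G_fun l' r'"
proof -
  interpret A: tract l r by fact
  interpret B: tract l' r' by fact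
  have zeq: "zorder (G_fun l r) k = zorder (G_fun l' r') k" for k
  proof -
    have right: "zorder (G_fun l r) k = zorder (G_fun l' r') k" if "0 < Re k" for k
      using A.right_poles_eq[OF \<open>c > 0\<close> \<open>\<mu> > 0\<close>, of k] B.right_poles_eq[OF \<open>c > 0\<close> \<open>\<mu> > 0\<close>, of k] eq that by simp
    consider "0 < Re k" | "Re k < 0" | "k = 0" | "Re k = 0" "k \<noteq> 0" by linarith
    then show ?thesis
    proof cases
      case 2
      then show ?thesis
        using right[of "- cnj k"] A.G_zorder(3)[of k] B.G_zorder(3)[of k] by simp
    qed (simp_all add: right A.G_zorder B.G_zorder)
  qed
  obtain K1 C1 where 1: "0 < K1" "0 < C1" "\<And>k. cmod (G_fun l r k) \<le> K1 * exp (C1 * cmod k)"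
    using A.G_growth by metis
  obtain K2 C2 where 2: "0 < K2" "0 < C2" "\<And>k. cmod (G_fun l' r' k) \<le> K2 * exp (C2 * cmod k)"
    using B.G_growth by metis
  have g1: "cmod (G_fun l r k) \<le> (K1 + K2) * exp ((C1 + C2) * cmod k)" for k
    by (rule order_trans[OF 1(3)], rule mult_mono) (use 1 2 in \<open>auto intro: mult_right_mono\<close>)
  have g2: "cmod (G_fun l' r' k) \<le> (K1 + K2) * exp ((C1 + C2) * cmod k)" for k
    by (rule order_trans[OF 2(3)], rule mult_mono) (use 1 2 in \<open>auto intro: mult_right_mono\<close>)
  have D: "- \<i> * of_real (A.rl / A.r0) \<noteq> (0 :: complex)" using A.ends by simp
  obtain a b where ab: "\<And>z. G_fun l' r' z = G_fun l r z * exp (a + b * z)"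
    using exponential_type_quotient_simple_zero[OF A.G_entire B.G_entire A.G_zero D B.G_nonzero_somewhere g1 g2 _ zeq]
      1(2) 2(2) by auto
  define d where "d = l' - l"
  \<comment> \<open>On the lower half-axis the quotient is exp(a - i b \<eta>), and normalising both
    functions by their asymptotics multiplies it by exp(-d \<eta>). The limit 1 then forces i b = -d
    and exp a = 1.\<close>
  define \<beta> where "\<beta> = - \<i> * b - of_real d"
  have down: "of_real (B.G_down \<eta>) = of_real (A.G_down \<eta>) * exp (a - \<i> * b * of_real \<eta>)" if "0 < \<eta>" for \<eta>
    using ab[of "- (\<i> * of_real \<eta>)"] that
    unfolding A.G_imaginary(2)[OF that] B.G_imaginary(2)[OF that]
      A.G_down_def[symmetric] B.G_down_def[symmetric] by (simp add: mult_ac)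
  have up: "of_real (B.G_up \<eta>) = of_real (A.G_up \<eta>) * exp (a + \<i> * b * of_real \<eta>)" if "0 < \<eta>" for \<eta>
    using ab[of "\<i> * of_real \<eta>"] that
    unfolding A.G_imaginary(1)[OF that] B.G_imaginary(1)[OF that]
      A.G_up_def[symmetric] B.G_up_def[symmetric] by (simp add: mult_ac)
  have "((\<lambda>\<eta>. exp (a + \<beta> * of_real \<eta>)) \<longlongrightarrow> 1) at_top"
  proof -
    have "((\<lambda>\<eta>. (B.G_down \<eta> * exp (- \<eta> * l')) / (A.G_down \<eta> * exp (- \<eta> * l))) \<longlongrightarrow> 1 / 1) at_top"
      by (intro tendsto_divide A.G_down_asymptotics B.G_down_asymptotics) simp
    from tendsto_of_real[OF this]
    have lim: "((\<lambda>\<eta>. of_real ((B.G_down \<eta> * exp (- \<eta> * l')) / (A.G_down \<eta> * exp (- \<eta> * l)))) \<longlongrightarrow> (1::complex)) at_top"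
      by (simp only: div_by_1 of_real_1)
    have "\<forall>\<^sub>F \<eta> in at_top. of_real ((B.G_down \<eta> * exp (- \<eta> * l')) / (A.G_down \<eta> * exp (- \<eta> * l)))
        = exp (a + \<beta> * of_real \<eta>)"
      using eventually_gt_at_top[of 0]
    proof eventually_elim
      case (elim \<eta>)
      have "exp (- \<eta> * l') / exp (- \<eta> * l) = exp (- d * \<eta>)"
        by (simp add: d_def algebra_simps flip: exp_diff)
      then have "(B.G_down \<eta> * exp (- \<eta> * l')) / (A.G_down \<eta> * exp (- \<eta> * l)) = B.G_down \<eta> / A.G_down \<eta> * exp (- d * \<eta>)"
        by (simp flip: times_divide_times_eq)
      then have "of_real ((B.G_down \<eta> * exp (- \<eta> * l')) / (A.G_down \<eta> * exp (- \<eta> * l)))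
          = (of_real (B.G_down \<eta>) / of_real (A.G_down \<eta>) :: complex) * exp (- of_real d * of_real \<eta>)"
        by (simp flip: exp_of_real)
      also have "\<dots> = exp (a - \<i> * b * of_real \<eta>) * exp (- of_real d * of_real \<eta>)"
        using down[OF elim] A.G_down_pos[OF elim] by simp
      also have "\<dots> = exp (a + \<beta> * of_real \<eta>)"
        by (simp add: \<beta>_def algebra_simps flip: exp_add)
      finally show ?case .
    qed
    from Lim_transform_eventually[OF lim this] show ?thesis .
  qed
  from exp_affine_tendsto_1[OF this] have "- (\<i> * b) = of_real d" and a: "exp a = 1"
    by (simp_all add: \<beta>_def)
  then have b: "\<i> * b = - of_real d" by (metis minus_minus)
  have "B.G_up \<eta> = A.G_up \<eta> * exp (- d * \<eta>)" if "0 < \<eta>" for \<eta>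
  proof -
    have "exp (a + \<i> * b * of_real \<eta>) = of_real (exp (- d * \<eta>))"
      unfolding b exp_add a by (simp flip: exp_of_real)
    with up[OF that] show ?thesis by (simp only: of_real_mult[symmetric] of_real_eq_iff)
  qed
  then have "ln (B.G_up \<eta>) / \<eta> = ln (A.G_up \<eta>) / \<eta> - d" if "0 < \<eta>" for \<eta>
    using A.G_up_pos[OF that] that by (simp add: ln_mult diff_divide_distrib)
  then have ev: "\<forall>\<^sub>F \<eta> in at_top. ln (A.G_up \<eta>) / \<eta> - d = ln (B.G_up \<eta>) / \<eta>"
    by (intro eventually_mono[OF eventually_gt_at_top[of 0]]) simp
  \<comment> \<open>The two limits give l' + 2 r_l' = l + 2 r_l - (l' - l). The lengths then occur
    twice on each side, and halving leaves l + r_l.\<close>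
  have "((\<lambda>\<eta>. ln (B.G_up \<eta>) / \<eta>) \<longlongrightarrow> (l + 2 * r l) - d) at_top"
    by (rule Lim_transform_eventually[OF tendsto_diff[OF A.G_up_asymptotics tendsto_const] ev])
  from tendsto_unique[OF trivial_limit_at_top_linorder this B.G_up_asymptotics]
  show "l + r l = l' + r' l'" by (simp add: d_def)
  show "G_fun l r = G_fun l' r'" if "l = l'"
  proof
    fix k
    have "d = 0" using that by (simp add: d_def)
    then have "b = 0" using b by simp
    then show "G_fun l r k = G_fun l' r' k" using ab[of k] a by simp
  qed
qed

lemma entire_eq_on_positive_reals:
  fixes f g :: "complex \<Rightarrow> complex"
  assumes "f holomorphic_on UNIV" "g holomorphic_on UNIV"
    and eq: "\<And>x. 0 < x \<Longrightarrow> f (of_real x) = g (of_real x)"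
  shows "f z = g z"
proof -
  have "f z - g z = 0"
  proof (rule analytic_continuation[where f = "\<lambda>z. f z - g z" and S = UNIV and U = "of_real ` {0<..}" and \<xi> = 1])
    show "(1::complex) islimpt of_real ` {0<..}"
      unfolding islimpt_approachable
    proof (intro allI impI)
      fix e :: real assume "0 < e"
      then show "\<exists>x'\<in>of_real ` {0<..}. x' \<noteq> (1::complex) \<and> dist x' 1 < e"
        by (intro bexI[of _ "of_real (1 + e / 2)"] imageI conjI) (auto simp: dist_norm)
    qed
  qed (use assms eq in \<open>auto intro!: holomorphic_intros\<close>)
  then show ?thesis by simp
qed

text \<open>The values of G at i \<eta> and -i \<eta> form a linear system for \<open>w_im\<close>
  and \<open>phi_im\<close> whose coefficients depend only on r_l. The resulting equalities extend
  from \<Lambda> = \<eta>^2 to all complex \<Lambda>.\<close>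

lemma data_determined_by_G:
  assumes "tract l r" "tract l r'" and rl: "r l = r' l" and G: "G_fun l r = G_fun l r'"
  shows "r 0 = r' 0" "jost_F l r = jost_F l r'"
proof -
  interpret A: tract l r by fact
  interpret B: tract l r' by fact
  have eq: "A.w_im \<eta> = B.w_im \<eta>" "A.phi_im \<eta> = B.phi_im \<eta>" if \<eta>: "0 < \<eta>" for \<eta>
  proof -
    define T where "T = semicircle_transform (2 * \<eta> * r l)"
    define T' where "T' = semicircle_transform (- (2 * \<eta> * r l))"
    have up: "(T - 1) * A.w_im \<eta> + A.phi_im \<eta> = (T - 1) * B.w_im \<eta> + B.phi_im \<eta>"
      using A.G_imaginary(1)[OF \<eta>] B.G_imaginary(1)[OF \<eta>] \<eta> unfolding G rl[symmetric] T_def[symmetric]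
      by (simp only: of_real_eq_iff mult_cancel_left) auto
    have down: "(1 - T') * A.w_im \<eta> + A.phi_im \<eta> = (1 - T') * B.w_im \<eta> + B.phi_im \<eta>"
      using A.G_imaginary(2)[OF \<eta>] B.G_imaginary(2)[OF \<eta>] \<eta> unfolding G rl[symmetric] T'_def[symmetric]
      by (simp only: of_real_eq_iff mult_cancel_left) auto
    \<comment> \<open>T + T' - 2 is the determinant of the system: subtracting the two equations
      eliminates \<open>phi_im\<close> and leaves this factor in front of
      \<open>w_im\<close>.\<close>
    have "2 < T + T'"
      unfolding T_def T'_def using \<eta> A.ends by (intro semicircle_transform_symmetric_gt_2) simp
    moreover have "(T + T' - 2) * A.w_im \<eta> = (T + T' - 2) * B.w_im \<eta>"
      using up down by (simp add: algebra_simps)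
    ultimately show "A.w_im \<eta> = B.w_im \<eta>" by simp
    then show "A.phi_im \<eta> = B.phi_im \<eta>" using up by simp
  qed
  have p: "of_real (r l / r 0) * A.p_ser 1 0 \<Lambda> l = of_real (r' l / r' 0) * B.p_ser 1 0 \<Lambda> l" for \<Lambda> :: complex
  proof (rule entire_eq_on_positive_reals[where f = "\<lambda>\<Lambda>. of_real (r l / r 0) * A.p_ser 1 0 \<Lambda> l"
        and g = "\<lambda>\<Lambda>. of_real (r' l / r' 0) * B.p_ser 1 0 \<Lambda> l"])
    show "(\<lambda>\<Lambda>. of_real (r l / r 0) * A.p_ser 1 0 \<Lambda> l) holomorphic_on UNIV"
      "(\<lambda>\<Lambda>. of_real (r' l / r' 0) * B.p_ser 1 0 \<Lambda> l) holomorphic_on UNIV"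
      using A.ends by (auto intro!: holomorphic_intros A.p_ser_entire B.p_ser_entire)
    fix x :: real assume "0 < x"
    then show "of_real (r l / r 0) * A.p_ser 1 0 (of_real x) l = of_real (r' l / r' 0) * (B.p_ser 1 0 (of_real x) l :: complex)"
      using eq(2)[of "sqrt x"] A.ends A.p_ser_of_real(1)[of 1 0 l x, where 'a = complex]
        B.p_ser_of_real(1)[of 1 0 l x, where 'a = complex]
      by (simp add: A.phi_im_def B.phi_im_def flip: of_real_mult of_real_divide)
  qed
  have u: "of_real (1 / (r 0 * r l)) * A.u_ser 1 0 \<Lambda> l = of_real (1 / (r' 0 * r' l)) * B.u_ser 1 0 \<Lambda> l" for \<Lambda> :: complex
  proof (rule entire_eq_on_positive_reals[where f = "\<lambda>\<Lambda>. of_real (1 / (r 0 * r l)) * A.u_ser 1 0 \<Lambda> l"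
        and g = "\<lambda>\<Lambda>. of_real (1 / (r' 0 * r' l)) * B.u_ser 1 0 \<Lambda> l"])
    show "(\<lambda>\<Lambda>. of_real (1 / (r 0 * r l)) * A.u_ser 1 0 \<Lambda> l) holomorphic_on UNIV"
      "(\<lambda>\<Lambda>. of_real (1 / (r' 0 * r' l)) * B.u_ser 1 0 \<Lambda> l) holomorphic_on UNIV"
      using A.ends by (auto intro!: holomorphic_intros A.p_ser_entire B.p_ser_entire)
    fix x :: real assume "0 < x"
    then have "A.u_ser 1 0 x l / (r 0 * r l) = B.u_ser 1 0 x l / (r' 0 * r' l)"
      using eq(1)[of "sqrt x"] by (simp add: A.w_im_def B.w_im_def flip: divide_divide_eq_left)
    then have "of_real (A.u_ser 1 0 x l / (r 0 * r l)) = (of_real (B.u_ser 1 0 x l / (r' 0 * r' l)) :: complex)" by simp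
    then show "of_real (1 / (r 0 * r l)) * A.u_ser 1 0 (of_real x) l = of_real (1 / (r' 0 * r' l)) * (B.u_ser 1 0 (of_real x) l :: complex)"
      using A.ends A.p_ser_of_real(2)[of 1 0 l x, where 'a = complex]
        B.p_ser_of_real(2)[of 1 0 l x, where 'a = complex]
      by simp
  qed
  \<comment> \<open>At \<Lambda> = 0 both series equal 1, so only the prefactors r_l / r_0 are
    compared.\<close>
  have "(of_real (r l / r 0) :: complex) = of_real (r' l / r' 0)"
    using p[of 0] A.p_ser_at_0(1)[of 1 l, where 'a = complex] B.p_ser_at_0(1)[of 1 l, where 'a = complex] A.ends by simp
  then have "r l / r 0 = r' l / r' 0" by (simp only: of_real_eq_iff)
  then show r0: "r 0 = r' 0" using rl A.ends B.ends by (simp add: field_simps)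
  \<comment> \<open>The sequence is the same for both tracts, so its limits r_l' / (2 r_l)
    coincide.\<close>
  have "((\<lambda>\<eta>. \<eta> * (A.phi_im \<eta> - A.w_im \<eta>) * exp (- \<eta> * l)) \<longlongrightarrow> dx l r' l / r' l / 2) at_top"
    by (rule Lim_transform_eventually[OF B.end_asymptotics(3)])
      (intro eventually_mono[OF eventually_gt_at_top[of 0]], simp add: eq)
  from tendsto_unique[OF trivial_limit_at_top_linorder this A.end_asymptotics(3)]
  have dr: "dx l r l = dx l r' l" using rl A.ends by simp
  show "jost_F l r = jost_F l r'"
  proof
    fix k
    have "phi l r k l = phi l r' k l" unfolding A.phi_end B.phi_end by (rule p)
    moreover have "dx l (phi l r k) l = dx l (phi l r' k) l"
      unfolding A.dx_phi_end B.dx_phi_end dr u using p[of "- k\<^sup>2"] rl r0 A.ends by simp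
    ultimately show "jost_F l r k = jost_F l r' k" by (simp add: jost_F_def)
  qed
qed

theorem theorem6p2:
  fixes c \<mu> :: real
  assumes "c > 0" and "\<mu> > 0"
  shows
    "yields (\<lambda>l r. (l, right_poles c \<mu> l r))
            (\<lambda>l r. (E_fun l r, r l, r 0, impedance (r l), G_fun l r, jost_F l r)) \<and>
     yields (\<lambda>l r. (l, right_poles c \<mu> l r)) (\<lambda>l r. (r l, right_poles c \<mu> l r)) \<and>
     yields (\<lambda>l r. (r l, right_poles c \<mu> l r)) (\<lambda>l r. (l, right_poles c \<mu> l r)) \<and>
     yields (\<lambda>l r. (r l, right_poles c \<mu> l r))
            (\<lambda>l r. (E_fun l r, r l, r 0, impedance (r l), G_fun l r, jost_F l r))"
proof -
  have main: "l = l' \<and> r l = r' l' \<and> r 0 = r' 0 \<and> G_fun l r = G_fun l' r' \<and> jost_F l r = jost_F l' r' \<and> E_fun l r = E_fun l' r'"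
    if vt: "vocal_tract l r" "vocal_tract l' r'" and poles: "right_poles c \<mu> l r = right_poles c \<mu> l' r'"
      and or: "l = l' \<or> r l = r' l'" for l r l' r'
  proof -
    have t: "tract l r" "tract l' r'" using vt by (simp_all add: tract_def)
    \<comment> \<open>The sum l + r_l is fixed by the poles, so knowing either summand gives the
      other; this makes the two sets of data equivalent.\<close>
    have sum: "l + r l = l' + r' l'" by (rule G_determined(1)[OF t assms poles])
    then have ll: "l = l'" and rl: "r l = r' l'" using or by auto
    have G: "G_fun l r = G_fun l' r'" by (rule G_determined(2)[OF t assms poles ll])
    have t': "tract l r'" using t(2) ll by simp
    have "r 0 = r' 0" "jost_F l r = jost_F l r'"
      using data_determined_by_G[OF t(1) t'] rl G ll by simp_all
    \<comment> \<open>E depends on the tract only through G, and \<open>zero_list\<close> selects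
      the same list for equal functions.\<close>
    moreover have "E_fun l r = E_fun l' r'" by (rule ext) (simp add: E_fun_def G)
    ultimately show ?thesis using ll rl G by simp
  qed
  show ?thesis
    unfolding yields_def by (intro conjI allI impI; clarsimp) (use main in metis)+
qed

end
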